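(* Assume $\lambda\ge\mu$. Let $\bm u^0$ be the exact solution of the local problem $-\mathcal{L}^S_0\bm u^0=\bm f_0$ in $\Omega$, $\bm u^0=\bm 0$ on $\partial\Omega$, and assume it is sufficiently smooth, i.e. (extended by zero to $\Omega_{\mathcal I}$) $\bm u^0\in C^4(\overline{\Omega_\delta};\mathbb{R}^d)$. For any $\delta\in(0,\delta_0]$, let $\bm u^{\delta,h}\in S(\square\cap\Omega;\mathbb{R}^d)$ be the numerical solution of the collocation scheme $-r^h_\Omega\mathcal{L}^{S,h}_\delta\bm u^{\delta,h}=r^h_\Omega\bm f_0$. Then $$\|\bm u^0-\bm u^{\delta,h}\|_{L^2(\Omega;\mathbb{R}^d)}\le C\,(h_{\max}^2+\delta^2),$$ with $C$ independent of $h_{\max}$ and $\delta$.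
   Context: Let $d\in\{2,3\}$, $\delta_0>0$, and let $\Omega\subset\mathbb{R}^d$ be open and bounded. For $\delta>0$, $\Omega_{\mathcal I}=\{\bm x\in\mathbb{R}^d\setminus\Omega:\mathrm{dist}(\bm x,\Omega)\le2\delta\}$ and $\Omega_\delta=\Omega\cup\Omega_{\mathcal I}$. The dimension $d$, the Lamé parameters $\lambda,\mu$ (constants, $\mu>0$), the kernel $\rho$ and the vector $\hat{\bm h}$ below are fixed data. Local operator: $\mathcal{L}^S_0\bm u=\mu\,\mathrm{div}(\nabla\bm u)+(\mu+\lambda)\nabla\,\mathrm{div}\,\bm u$. Kernel: $\rho(|\bm s|)\ge 0$ is non-increasing in $|\bm s|$, supported in the unit ball $B_1$, with $\int_{B_1}\rho(|\bm s|)|\bm s|^2d\bm s=d$. For $\delta>0$ put $\rho_\delta(|\bm s|)=\delta^{-(d+2)}\rho(|\bm s|/\delta)$, and let $B_\delta$ be the ball of radius $\delta$ centered at $\bm 0$. Nonlocal operators (functions on $\mathbb{R}^d$): $\mathcal{L}^B_\delta \bm u(\bm x)=\int_{B_\delta}\rho_\delta(|\bm s|)\frac{\bm s\otimes\bm s}{|\bm s|^2}(\bm u(\bm x+\bm s)-\bm u(\bm x))d\bm s$, $\mathcal{D}_\delta\bm u(\bm x)=\int_{B_\delta}\rho_\delta(|\bm s|)\,\bm s\cdot(\bm u(\bm x+\bm s)-\bm u(\bm x))d\bm s$, $\mathcal{G}_\delta\theta(\bm x)=\int_{B_\delta}\rho_\delta(|\bm s|)\,\bm s\,(\theta(\bm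 x+\bm s)-\theta(\bm x))d\bm s$. Constants: $C_\alpha=30,\ C_\beta=3$ if $d=3$; $C_\alpha=16,\ C_\beta=2$ if $d=2$. Grid: $\bm h=(h_1,\dots,h_d)=h_{\max}\hat{\bm h}$ with $h_j>0$, $h_{\max}=\max_jh_j$, where $\hat{\bm h}$ is a fixed vector with maximum component $1$ and components bounded below by a positive constant. $\square=\{\bm x_{\bm k}=(k_1h_1,\dots,k_dh_d):\bm k\in\mathbb{Z}^d\}$. RK (reproducing kernel) basis: $\Psi_{\bm k}(\bm x)=\prod_{j=1}^d\phi(|x_j-k_jh_j|/(2h_j))$, where $\phi(x)=\frac23-4x^2+4x^3$ for $0\le x\le\frac12$, $\phi(x)=\frac43(1-x)^3$ for $\frac12\le x\le1$, and $\phi(x)=0$ otherwise. For a sequence $(u_{\bm k})$, $i^h(u_{\bm k})=\sum_{\bm k\in\mathbb{Z}^d}\Psi_{\bm k}u_{\bm k}$; for continuous $u$, $r^hu=(u(\bm x_{\bm k}))_{\bm k\in\mathbb{Z}^d}$ and $\Pi^h=i^hr^h$; all act componentwise on vector-valued objects. $r^h_\Omega u=(u(\bm x_{\bm k}))_{\bm x_{\bm k}\in\square\cap\Omega}$. $S(\square\cap\Omega;\mathbb{R}^d)$ is the space of functions $i^h(\bm u_{\bm k})$ with $\bm u_{\bm k}\in\mathbb{R}^d$ and $\bm u_{\bm k}=\bm 0$ whenever $\bm x_{\bm k}\notin\Omega$. For $\bm v$ in the trial space, $\mathcal{L}^{S,h}_\delta\bm v=\frac{C_\alpha\mu}{d}\mathcal{L}^B_\delta\bm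 v+\frac{C_\beta(\lambda-\mu)}{d}\mathcal{G}_\delta\Pi^h(\mathcal{D}_\delta\bm v)$. *)

theory Defs
  imports "HOL-Analysis.Analysis"
begin

definition partial_deriv ::
    "'n::finite \<Rightarrow> (real^'n \<Rightarrow> 'b::real_normed_vector) \<Rightarrow> real^'n \<Rightarrow> 'b" where
  "partial_deriv i f x = frechet_derivative f (at x) (axis i 1)"

primrec iter_partial ::
    "'n::finite list \<Rightarrow> (real^'n \<Rightarrow> 'b::real_normed_vector) \<Rightarrow> real^'n \<Rightarrow> 'b" where
  "iter_partial [] f = f"
| "iter_partial (i # is) f = partial_deriv i (iter_partial is f)"

text \<open>
  \<open>Ck_closure k S\<close> is the usual space \<open>C^k\<close> on the closure of \<open>S\<close>: all partial derivatives of
  order at most \<open>k\<close> exist and are continuous in the interior of \<open>S\<close> and extend continuously to the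
  closure. Differentiability of the derivatives of order below \<open>k\<close> is required because
  \<^const>\<open>frechet_derivative\<close> is an arbitrary value where the derivative does not exist.
\<close>

definition Ck_closure ::
    "nat \<Rightarrow> (real^'n::finite) set \<Rightarrow> (real^'n \<Rightarrow> 'b::real_normed_vector) \<Rightarrow> bool" where
  "Ck_closure k S f \<longleftrightarrow>
     continuous_on (closure S) f \<and>
     (\<forall>is. length is < k \<longrightarrow> iter_partial is f differentiable_on interior S) \<and>
     (\<forall>is. length is \<le> k \<longrightarrow>
        (\<exists>g. continuous_on (closure S) g \<and> (\<forall>x\<in>interior S. g x = iter_partial is f x)))"

definition gradient :: "(real^'n::finite \<Rightarrow> real) \<Rightarrow> real^'n \<Rightarrow> real^'n" where
  "gradient \<theta> x = (\<chi> i. partial_deriv i \<theta> x)"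

definition divergence :: "(real^'n::finite \<Rightarrow> real^'n) \<Rightarrow> real^'n \<Rightarrow> real" where
  "divergence u x = (\<Sum>i\<in>UNIV. partial_deriv i (\<lambda>y. u y $ i) x)"

text \<open>The divergence of the matrix field \<open>\<nabla>u\<close> is taken row by row, the \<open>i\<close>-th row being the
  gradient of the \<open>i\<close>-th component of \<open>u\<close>.\<close>

definition local_operator ::
    "real \<Rightarrow> real \<Rightarrow> (real^'n::finite \<Rightarrow> real^'n) \<Rightarrow> real^'n \<Rightarrow> real^'n" where
  "local_operator lam \<mu> u x =
     \<mu> *\<^sub>R (\<chi> i. divergence (gradient (\<lambda>y. u y $ i)) x)
     + (\<mu> + lam) *\<^sub>R gradient (divergence u) x"

definition interaction_domain :: "(real^'n::finite) set \<Rightarrow> real \<Rightarrow> (real^'n) set" where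
  "interaction_domain \<Omega> \<delta> = {x. x \<notin> \<Omega> \<and> infdist x \<Omega> \<le> 2 * \<delta>}"

definition extended_domain :: "(real^'n::finite) set \<Rightarrow> real \<Rightarrow> (real^'n) set" where
  "extended_domain \<Omega> \<delta> = \<Omega> \<union> interaction_domain \<Omega> \<delta>"

definition scaled_kernel :: "nat \<Rightarrow> (real \<Rightarrow> real) \<Rightarrow> real \<Rightarrow> real \<Rightarrow> real" where
  "scaled_kernel d \<rho> \<delta> r = \<rho> (r / \<delta>) / \<delta> ^ (d + 2)"

definition tensor :: "real^'n::finite \<Rightarrow> real^'n \<Rightarrow> real^'n^'n" where
  "tensor s t = (\<chi> i j. s $ i * t $ j)"

text \<open>
  For smooth \<open>u\<close> the integrand of the bond-based operator is only \<open>O(\<rho>(|s|) |s|)\<close>, whereas the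
  second moment condition on \<open>\<rho>\<close> controls \<open>\<rho>(|s|) |s|^2\<close>. The integral is therefore read as a
  principal value, which agrees with the Lebesgue integral whenever the integrand is integrable.
  For Lipschitz arguments the integrals in \<open>nonlocal_div\<close> and \<open>nonlocal_grad\<close> below converge
  absolutely.
\<close>

definition bond_operator ::
    "(real \<Rightarrow> real) \<Rightarrow> real \<Rightarrow> (real^'n::finite \<Rightarrow> real^'n) \<Rightarrow> real^'n \<Rightarrow> real^'n" where
  "bond_operator \<rho> \<delta> u x =
     Lim (at_right 0) (\<lambda>\<epsilon>. LINT s:ball 0 \<delta> - ball 0 \<epsilon>|lborel.
       (scaled_kernel CARD('n) \<rho> \<delta> (norm s) / (norm s)\<^sup>2) *\<^sub>R (tensor s s *v (u (x + s) - u x)))"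

definition nonlocal_div ::
    "(real \<Rightarrow> real) \<Rightarrow> real \<Rightarrow> (real^'n::finite \<Rightarrow> real^'n) \<Rightarrow> real^'n \<Rightarrow> real" where
  "nonlocal_div \<rho> \<delta> u x =
     (LINT s:ball 0 \<delta>|lborel. scaled_kernel CARD('n) \<rho> \<delta> (norm s) * (s \<bullet> (u (x + s) - u x)))"

definition nonlocal_grad ::
    "(real \<Rightarrow> real) \<Rightarrow> real \<Rightarrow> (real^'n::finite \<Rightarrow> real) \<Rightarrow> real^'n \<Rightarrow> real^'n" where
  "nonlocal_grad \<rho> \<delta> \<theta> x =
     (LINT s:ball 0 \<delta>|lborel. (scaled_kernel CARD('n) \<rho> \<delta> (norm s) * (\<theta> (x + s) - \<theta> x)) *\<^sub>R s)"

text \<open>The constants are meant for \<open>d = 2\<close> and \<open>d = 3\<close> only.\<close>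

definition C_alpha :: "nat \<Rightarrow> real" where
  "C_alpha d = (if d = 3 then 30 else 16)"

definition C_beta :: "nat \<Rightarrow> real" where
  "C_beta d = (if d = 3 then 3 else 2)"

definition grid_point :: "real^'n::finite \<Rightarrow> int^'n \<Rightarrow> real^'n" where
  "grid_point h k = (\<chi> j. of_int (k $ j) * h $ j)"

definition spline_window :: "real \<Rightarrow> real" where
  "spline_window x =
     (if 0 \<le> x \<and> x \<le> 1/2 then 2/3 - 4 * x^2 + 4 * x^3
      else if 1/2 \<le> x \<and> x \<le> 1 then 4/3 * (1 - x)^3
      else 0)"

definition rk_basis :: "real^'n::finite \<Rightarrow> int^'n \<Rightarrow> real^'n \<Rightarrow> real" where
  "rk_basis h k x = (\<Prod>j\<in>UNIV. spline_window (\<bar>x $ j - of_int (k $ j) * h $ j\<bar> / (2 * h $ j)))"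

text \<open>For each \<open>x\<close> only finitely many terms of the sum are nonzero. The codomain is generic, so
  that the operators act on scalar as well as on vector-valued objects.\<close>

definition rk_interp ::
    "real^'n::finite \<Rightarrow> (int^'n \<Rightarrow> 'b::real_normed_vector) \<Rightarrow> real^'n \<Rightarrow> 'b" where
  "rk_interp h c x = (\<Sum>\<^sub>\<infinity>k. rk_basis h k x *\<^sub>R c k)"

definition grid_restriction :: "real^'n::finite \<Rightarrow> (real^'n \<Rightarrow> 'b) \<Rightarrow> int^'n \<Rightarrow> 'b" where
  "grid_restriction h u k = u (grid_point h k)"

definition rk_projection ::
    "real^'n::finite \<Rightarrow> (real^'n \<Rightarrow> 'b::real_normed_vector) \<Rightarrow> real^'n \<Rightarrow> 'b" where
  "rk_projection h u = rk_interp h (grid_restriction h u)"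

definition trial_space :: "real^'n::finite \<Rightarrow> (real^'n) set \<Rightarrow> (real^'n \<Rightarrow> real^'n) set" where
  "trial_space h \<Omega> = {rk_interp h c | c. \<forall>k. grid_point h k \<notin> \<Omega> \<longrightarrow> c k = 0}"

definition discrete_operator ::
    "real \<Rightarrow> real \<Rightarrow> (real \<Rightarrow> real) \<Rightarrow> real \<Rightarrow> real^'n::finite \<Rightarrow>
     (real^'n \<Rightarrow> real^'n) \<Rightarrow> real^'n \<Rightarrow> real^'n" where
  "discrete_operator lam \<mu> \<rho> \<delta> h v x =
     (C_alpha CARD('n) * \<mu> / CARD('n)) *\<^sub>R bond_operator \<rho> \<delta> v x
     + (C_beta CARD('n) * (lam - \<mu>) / CARD('n)) *\<^sub>R
         nonlocal_grad \<rho> \<delta> (rk_projection h (nonlocal_div \<rho> \<delta> v)) x"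

definition numerical_solution ::
    "real \<Rightarrow> real \<Rightarrow> (real \<Rightarrow> real) \<Rightarrow> (real^'n::finite) set \<Rightarrow> (real^'n \<Rightarrow> real^'n) \<Rightarrow>
     real \<Rightarrow> real^'n \<Rightarrow> (real^'n \<Rightarrow> real^'n) \<Rightarrow> bool" where
  "numerical_solution lam \<mu> \<rho> \<Omega> f \<delta> h v \<longleftrightarrow>
     v \<in> trial_space h \<Omega> \<and>
     (\<forall>k. grid_point h k \<in> \<Omega> \<longrightarrow>
        - grid_restriction h (discrete_operator lam \<mu> \<rho> \<delta> h v) k = grid_restriction h f k)"

definition L2_norm_on :: "(real^'n::finite) set \<Rightarrow> (real^'n \<Rightarrow> real^'n) \<Rightarrow> real" where
  "L2_norm_on S f = sqrt (LINT x:S|lborel. (norm (f x))\<^sup>2)"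

end

theory Submission
  imports Defs
begin

text \<open>
  The error at the nodes in \<open>\<Omega>\<close> is bounded by stability times truncation error, all in physical space.

  \<^item> Stability. The cubic B-spline is the autocorrelation of the hat function, so the quadratic form of
    the collocated bond operator at a displacement \<open>s\<close> is a constant multiple of
    \<open>\<integral> |A (y + s) - A y|\<^sup>2 dy\<close>, where \<open>A\<close> is the multilinear interpolant of the nodal values of
    \<open>s \<bullet> e\<close>. Shifting \<open>n \<approx> diam / |s|\<close> times moves \<open>A\<close> off its own support, whence the form is at
    least \<open>\<parallel>A\<parallel>\<^sup>2 / n\<^sup>2\<close> up to a constant, and the second moment of the kernel turns the integral over
    \<open>s\<close> into \<open>\<Sum> |e\<^sub>k|\<^sup>2\<close>. The constant is independent of \<open>\<delta>\<close>. The discrete gradient is the negative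
    transpose of the discrete divergence, so for \<open>\<lambda> \<ge> \<mu>\<close> the second part of the operator has the
    right sign.

  \<^item> Consistency. The zero extension of the solution is \<open>C\<^sup>4\<close> on the whole space, because it vanishes on a
    neighbourhood of \<open>\<partial>\<Omega>\<close> outside \<open>\<Omega>\<close>. For \<open>m \<le> 2\<close> the \<open>m\<close>-th derivatives of the interpolant are exact
    on polynomials of degree \<open>m + 1\<close>, by parity of the spline, so the derivatives of the interpolation
    error up to order two are \<open>O(h\<^sup>2)\<close> uniformly in \<open>\<delta>\<close>. The second and fourth moments of the radial
    kernel give the local limit with an error \<open>O(\<delta>\<^sup>2)\<close>.

  \<^item> For \<open>h \<ge> 1\<close> the stability constant decays like \<open>h\<^sup>-\<^sup>2\<close>; there stability is applied to the discrete
    solution itself, which yields \<open>O(h\<^sup>2)\<close> directly.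
\<close>

subsection \<open>Smooth functions and Taylor expansion\<close>

text \<open>The delicate term is \<open>nonlocal_grad\<close> of the interpolated
  \<open>nonlocal_div\<close>. Only the second moment of the kernel is controlled, so an error
  passes through either operator, uniformly in \<delta>, by way of its Lipschitz constant: each
  operator costs one derivative. Hence the interpolation error has to be O(h^2) up to second
  derivatives, which consumes four derivatives of the solution and two of the spline. The bond
  operator, a second difference, has the same budget.

  Collocation has no variational form of its own. What replaces it: at the nodes every matrix entry
  depends only on the difference of two indices, and the spline is even. This Toeplitz structure
  turns point values into a Gram matrix and makes the first-order operators exactly skew. No
  relation between h and \<delta> enters, since the number of shifts in the coercivity argument is
  chosen from |s| and the size of the domain and mesh, never from h/\<delta>.

  \<open>smooth_bdd\<close> asks for derivatives below order \<open>N\<close> and a bound at order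
  \<open>N\<close>, which is what the Lagrange form of the Taylor remainder consumes.\<close>

definition smooth_bdd :: "nat \<Rightarrow> real \<Rightarrow> (real^'n::finite \<Rightarrow> real) \<Rightarrow> bool" where
  "smooth_bdd N B f \<longleftrightarrow>
     (\<forall>is x. length is < N \<longrightarrow> iter_partial is f differentiable (at x)) \<and>
     (\<forall>is x. length is = N \<longrightarrow> \<bar>iter_partial is f x\<bar> \<le> B)"

definition monomial :: "'n list \<Rightarrow> real^'n::finite \<Rightarrow> real" where
  "monomial is y = (\<Prod>i\<leftarrow>is. y $ i)"

definition l1 :: "real^'n::finite \<Rightarrow> real" where
  "l1 y = (\<Sum>p\<in>UNIV. \<bar>y $ p\<bar>)"

lemma l1_nonneg [simp]: "l1 y \<ge> 0"
  by (simp add: l1_def sum_nonneg)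

lemma l1_le: "l1 (y::real^'n::finite) \<le> CARD('n) * norm y"
  unfolding l1_def using sum_bounded_above[of UNIV "\<lambda>p. \<bar>y $ p\<bar>" "norm y"]
  by (simp add: component_le_norm_cart)

lemma monomial_simps [simp]: "monomial [] y = 1" "monomial (p # is) y = y $ p * monomial is y"
  by (simp_all add: monomial_def)

lemma smooth_bdd_nonneg: "smooth_bdd N B f \<Longrightarrow> B \<ge> 0"
  unfolding smooth_bdd_def
  by (metis (no_types, lifting) abs_ge_zero dual_order.trans length_replicate)

lemma has_derivative_partials:
  fixes f :: "real^'n::finite \<Rightarrow> real"
  assumes "f differentiable (at x)"
  shows "(f has_derivative (\<lambda>v. \<Sum>p\<in>UNIV. v $ p * partial_deriv p f x)) (at x)"
proof -
  let ?D = "frechet_derivative f (at x)"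
  have D: "(f has_derivative ?D) (at x)"
    using assms frechet_derivative_works by blast
  have lin: "linear ?D"
    using D has_derivative_linear by blast
  have "?D v = (\<Sum>p\<in>UNIV. v $ p * partial_deriv p f x)" for v
  proof -
    have "?D v = ?D (\<Sum>p\<in>UNIV. v $ p *\<^sub>R axis p 1)"
      using basis_expansion[of v] by (simp add: scalar_mult_eq_scaleR)
    also have "\<dots> = (\<Sum>p\<in>UNIV. v $ p * partial_deriv p f x)"
      by (simp add: linear_sum[OF lin] linear_cmul[OF lin] partial_deriv_def)
    finally show ?thesis .
  qed
  then have "?D = (\<lambda>v. \<Sum>p\<in>UNIV. v $ p * partial_deriv p f x)" ..
  then show ?thesis
    using D by metis
qed

lemma partial_deriv_eq:
  fixes f :: "real^'n::finite \<Rightarrow> real"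
  assumes "(f has_derivative D) (at x)"
  shows "partial_deriv p f x = D (axis p 1)"
  using frechet_derivative_at[OF assms] by (simp add: partial_deriv_def)

lemma DERIV_line:
  fixes f :: "real^'n::finite \<Rightarrow> real"
  assumes "f differentiable (at (x + t *\<^sub>R y))"
  shows "((\<lambda>t. f (x + t *\<^sub>R y)) has_real_derivative
           (\<Sum>p\<in>UNIV. y $ p * partial_deriv p f (x + t *\<^sub>R y))) (at t)"
proof -
  have "((\<lambda>t. x + t *\<^sub>R y) has_derivative (\<lambda>s. s *\<^sub>R y)) (at t)"
    by (auto intro!: derivative_eq_intros)
  from has_derivative_compose[OF this has_derivative_partials[OF assms]]
  show ?thesis
    unfolding has_field_derivative_def
    by (rule has_derivative_eq_rhs) (auto simp: sum_distrib_left fun_eq_iff mult_ac intro!: sum.cong)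
qed

lemma finite_lists_length [simp]: "finite {is :: 'n::finite list. length is = j}"
  using finite_lists_length_eq[of "UNIV :: 'n set" j] by simp

lemma sum_lists_Suc:
  fixes F :: "'n::finite list \<Rightarrow> 'a::comm_monoid_add"
  shows "(\<Sum>is | length is = Suc j. F is) = (\<Sum>p\<in>UNIV. \<Sum>is | length is = j. F (p # is))"
proof -
  have "(\<Sum>is | length is = Suc j. F is)
      = (\<Sum>is\<in>(\<lambda>(p, is). p # is) ` (UNIV \<times> {is. length is = j}). F is)"
    by (rule sum.cong) (auto simp: length_Suc_conv)
  also have "\<dots> = (\<Sum>(p, is)\<in>UNIV \<times> {is. length is = j}. F (p # is))"
    by (subst sum.reindex) (auto simp: inj_on_def case_prod_beta)
  also have "\<dots> = (\<Sum>p\<in>UNIV. \<Sum>is | length is = j. F (p # is))"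
    by (simp add: sum.cartesian_product)
  finally show ?thesis .
qed

lemma lists_length_0: "{is :: 'n list. length is = 0} = {[]}"
  by auto

lemma sum_abs_monomial: "(\<Sum>is | length is = j. \<bar>monomial is y\<bar>) = l1 y ^ j"
proof (induction j)
  case (Suc j)
  then show ?case
    by (simp only: sum_lists_Suc monomial_simps abs_mult l1_def flip: sum_distrib_left)
       (simp add: sum_distrib_right[symmetric])
qed (simp add: lists_length_0)

text \<open>The sum runs over ordered index lists, so a mixed derivative is counted once per
  ordering. This is why division by \<open>fact j\<close> alone gives the Taylor polynomial, without
  multi-index factorials.\<close>

definition taylor_term :: "nat \<Rightarrow> (real^'n::finite \<Rightarrow> real) \<Rightarrow> real^'n \<Rightarrow> real^'n \<Rightarrow> real" where
  "taylor_term j f x y = (\<Sum>is | length is = j. iter_partial is f x * monomial is y)"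

lemma taylor_term_0 [simp]: "taylor_term 0 f x y = f x"
  by (simp add: taylor_term_def lists_length_0)

lemma taylor_term_1: "taylor_term (Suc 0) f x y = (\<Sum>p\<in>UNIV. partial_deriv p f x * y $ p)"
  by (simp only: taylor_term_def sum_lists_Suc) (simp add: lists_length_0)

lemma taylor_term_2:
  "taylor_term 2 f x y = (\<Sum>p\<in>UNIV. \<Sum>q\<in>UNIV. iter_partial [p,q] f x * (y $ p * y $ q))"
  by (simp only: taylor_term_def sum_lists_Suc numeral_2_eq_2) (simp add: lists_length_0)

lemma monomial_minus: "monomial is (- y) = (-1) ^ length is * monomial is y"
  by (induction "is") auto

lemma taylor_term_minus: "taylor_term j f x (- y) = (-1) ^ j * taylor_term j f x y"
  by (simp add: taylor_term_def monomial_minus sum_distrib_left mult_ac)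

text \<open>The one-dimensional Maclaurin formula along the segment from \<open>x\<close> to
  \<open>x + y\<close>. The absolute values of all monomials of degree \<open>N\<close> add up to
  \<open>l1 y ^ N\<close>, hence the use of the sum norm.\<close>

theorem taylor_smooth_bdd:
  fixes f :: "real^'n::finite \<Rightarrow> real"
  assumes f: "smooth_bdd N B f" and N: "N > 0"
  shows "\<bar>f (x + y) - (\<Sum>j<N. taylor_term j f x y / fact j)\<bar> \<le> B * l1 y ^ N / fact N"
proof -
  define G where "G j t = taylor_term j f (x + t *\<^sub>R y) y" for j t
  have DG: "(G j has_real_derivative G (Suc j) t) (at t)" if "j < N" for j t
  proof -
    have "((\<lambda>t. iter_partial is f (x + t *\<^sub>R y) * monomial is y) has_real_derivative
             (\<Sum>p\<in>UNIV. y $ p * iter_partial (p # is) f (x + t *\<^sub>R y)) * monomial is y) (at t)"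
      if "length is = j" for "is"
      using DERIV_line[of "iter_partial is f" x t y] f that \<open>j < N\<close>
      by (auto simp: smooth_bdd_def intro!: derivative_eq_intros)
    then have "((\<lambda>t. \<Sum>is | length is = j. iter_partial is f (x + t *\<^sub>R y) * monomial is y)
         has_real_derivative (\<Sum>is | length is = j.
           (\<Sum>p\<in>UNIV. y $ p * iter_partial (p # is) f (x + t *\<^sub>R y)) * monomial is y)) (at t)"
      by (intro DERIV_sum) auto
    also have "(\<Sum>is | length is = j.
           (\<Sum>p\<in>UNIV. y $ p * iter_partial (p # is) f (x + t *\<^sub>R y)) * monomial is y) = G (Suc j) t"
      unfolding G_def taylor_term_def sum_lists_Suc
      by (subst sum.swap) (simp add: sum_distrib_left sum_distrib_right mult_ac)
    finally show ?thesis
      unfolding G_def[abs_def] taylor_term_def .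
  qed
  have "\<exists>t. 0 < t \<and> t < 1 \<and>
      G 0 1 = (\<Sum>m<N. G m 0 / fact m * 1 ^ m) + G N t / fact N * 1 ^ N"
    using DG by (intro Maclaurin[of 1 N G "G 0"]) (use N in auto)
  then obtain t where t: "G 0 1 = (\<Sum>m<N. G m 0 / fact m) + G N t / fact N"
    by auto
  have "\<bar>G N t\<bar> \<le> (\<Sum>is | length is = N. B * \<bar>monomial is y\<bar>)"
    unfolding G_def taylor_term_def
    by (rule order_trans[OF sum_abs sum_mono])
       (use f in \<open>auto simp: smooth_bdd_def abs_mult intro!: mult_right_mono\<close>)
  also have "\<dots> = B * l1 y ^ N"
    by (simp add: sum_abs_monomial flip: sum_distrib_left)
  finally have "\<bar>G N t\<bar> / fact N \<le> B * l1 y ^ N / fact N"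
    by (simp add: divide_right_mono)
  then show ?thesis
    using t by (simp add: G_def)
qed

lemma smooth_bdd_lipschitz:
  fixes f :: "real^'n::finite \<Rightarrow> real"
  assumes "smooth_bdd (Suc 0) B f"
  shows "\<bar>f (x + y) - f x\<bar> \<le> B * l1 y"
  using taylor_smooth_bdd[OF assms, of x y] by simp

lemma smooth_bdd_continuous_on: "smooth_bdd N B f \<Longrightarrow> N > 0 \<Longrightarrow> continuous_on UNIV f"
  unfolding smooth_bdd_def
  by (metis continuous_at_imp_continuous_on differentiable_imp_continuous_within
      iter_partial.simps(1) list.size(3))

lemma smooth_bdd_mono: "smooth_bdd N B f \<Longrightarrow> B \<le> B' \<Longrightarrow> smooth_bdd N B' f"
  unfolding smooth_bdd_def
proof (elim conjE, intro conjI allI impI)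
  fix "is" :: "'a list" and x
  assume "\<forall>is x. length is = N \<longrightarrow> \<bar>iter_partial is f x\<bar> \<le> B" "B \<le> B'" "length is = N"
  then have "\<bar>iter_partial is f x\<bar> \<le> B"
    by blast
  then show "\<bar>iter_partial is f x\<bar> \<le> B'"
    using \<open>B \<le> B'\<close> by linarith
qed blast

lemma iter_partial_append: "iter_partial (is @ js) f = iter_partial is (iter_partial js f)"
  by (induction "is") auto

lemma smooth_bdd_iter_partial:
  "smooth_bdd (N + length js) B f \<Longrightarrow> smooth_bdd N B (iter_partial js f)"
  unfolding smooth_bdd_def by (simp flip: iter_partial_append)

lemma smooth_bdd_partial_deriv:
  "smooth_bdd (Suc N) B f \<Longrightarrow> smooth_bdd N B (partial_deriv p f)"
  using smooth_bdd_iter_partial[of N "[p]" B f] by simp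

subsection \<open>Algebra of iterated partial derivatives\<close>

lemma iter_partial_linear_combination:
  fixes f :: "'j \<Rightarrow> real^'n::finite \<Rightarrow> real"
  assumes "\<And>j is x. j \<in> J \<Longrightarrow> length is < N \<Longrightarrow> iter_partial is (f j) differentiable (at x)"
    and "length is \<le> N"
  shows "iter_partial is (\<lambda>x. \<Sum>j\<in>J. c j * f j x) = (\<lambda>x. \<Sum>j\<in>J. c j * iter_partial is (f j) x)"
  using assms(2)
proof (induction "is")
  case (Cons p "is")
  have "partial_deriv p (\<lambda>x. \<Sum>j\<in>J. c j * iter_partial is (f j) x) x
      = (\<Sum>j\<in>J. c j * partial_deriv p (iter_partial is (f j)) x)" for x
  proof -
    have "((\<lambda>x. \<Sum>j\<in>J. c j * iter_partial is (f j) x) has_derivative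
           (\<lambda>v. \<Sum>j\<in>J. c j * frechet_derivative (iter_partial is (f j)) (at x) v)) (at x)"
      using assms(1) Cons.prems
      by (intro has_derivative_sum has_derivative_mult_right)
         (auto simp flip: frechet_derivative_works)
    from partial_deriv_eq[OF this] show ?thesis
      by (simp add: partial_deriv_def)
  qed
  with Cons show ?case
    by auto
qed simp

lemma iter_partial_zero [simp]: "iter_partial is (\<lambda>x. 0 :: real) = (\<lambda>x. 0)"
  by (induction "is") (auto simp: partial_deriv_def)

lemma smooth_bdd_linear_combination:
  fixes f :: "'j \<Rightarrow> real^'n::finite \<Rightarrow> real"
  assumes "\<And>j. j \<in> J \<Longrightarrow> smooth_bdd N (B j) (f j)"
  shows "smooth_bdd N (\<Sum>j\<in>J. \<bar>c j\<bar> * B j) (\<lambda>x. \<Sum>j\<in>J. c j * f j x)"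
  unfolding smooth_bdd_def
proof (intro conjI allI impI)
  have diff: "iter_partial is (f j) differentiable (at x)" if "j \<in> J" "length is < N" for j "is" x
    using assms that by (auto simp: smooth_bdd_def)
  fix "is" :: "'n list" and x
  show "iter_partial is (\<lambda>x. \<Sum>j\<in>J. c j * f j x) differentiable at x" if "length is < N"
    using that
    by (cases "finite J")
      (auto simp: iter_partial_linear_combination[OF diff] iter_partial_zero diff
        intro!: differentiable_sum differentiable_mult)
  show "\<bar>iter_partial is (\<lambda>x. \<Sum>j\<in>J. c j * f j x) x\<bar> \<le> (\<Sum>j\<in>J. \<bar>c j\<bar> * B j)" if "length is = N"
    using that assms
    by (auto simp: iter_partial_linear_combination[OF diff] smooth_bdd_def abs_mult
        intro!: order_trans[OF sum_abs] sum_mono mult_left_mono)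
qed

lemma smooth_bdd_sum:
  assumes "\<And>j. j \<in> J \<Longrightarrow> smooth_bdd N (B j) (f j)"
  shows "smooth_bdd N (\<Sum>j\<in>J. B j) (\<lambda>x. \<Sum>j\<in>J. f j x)"
  using smooth_bdd_linear_combination[where c = "\<lambda>_. 1", OF assms] by simp

lemma iter_partial_diff:
  fixes f g :: "real^'n::finite \<Rightarrow> real"
  assumes f: "smooth_bdd N B f" and g: "smooth_bdd N B' g" and "length is \<le> N"
  shows "iter_partial is (\<lambda>x. f x - g x) = (\<lambda>x. iter_partial is f x - iter_partial is g x)"
  using iter_partial_linear_combination[of UNIV N "\<lambda>b. if b then f else g" "is" "\<lambda>b. if b then 1 else -1"]
    assms by (simp add: UNIV_bool smooth_bdd_def)

lemma smooth_bdd_diff: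
  fixes f g :: "real^'n::finite \<Rightarrow> real"
  assumes "smooth_bdd N B f" "smooth_bdd N B' g"
  shows "smooth_bdd N (B + B') (\<lambda>x. f x - g x)"
  using smooth_bdd_linear_combination[of UNIV N "\<lambda>b. if b then B else B'" "\<lambda>b. if b then f else g" "\<lambda>b. if b then 1 else -1"]
    assms by (simp add: UNIV_bool add.commute)

lemma has_derivative_shift_iff:
  "((\<lambda>x. f (x + a)) has_derivative D) (at x) \<longleftrightarrow> (f has_derivative D) (at (x + a))"
  for f :: "'a::real_normed_vector \<Rightarrow> 'b::real_normed_vector"
proof
  assume "((\<lambda>x. f (x + a)) has_derivative D) (at x)"
  then have "((\<lambda>x. f (x + a)) has_derivative D) (at (x + a - a))"
    by simp
  from has_derivative_compose[of "\<lambda>x. x - a" "\<lambda>x. x", OF _ this]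
  show "(f has_derivative D) (at (x + a))"
    by (force intro!: derivative_eq_intros)
next
  assume "(f has_derivative D) (at (x + a))"
  from has_derivative_compose[of "\<lambda>x. x + a" "\<lambda>x. x", OF _ this]
  show "((\<lambda>x. f (x + a)) has_derivative D) (at x)"
    by (force intro!: derivative_eq_intros)
qed

lemma iter_partial_shift: "iter_partial is (\<lambda>x. f (x + a)) = (\<lambda>x. iter_partial is f (x + a))"
proof (induction "is")
  case (Cons p "is")
  have "partial_deriv p (\<lambda>x. iter_partial is f (x + a)) x = partial_deriv p (iter_partial is f) (x + a)" for x
    using has_derivative_shift_iff[of "iter_partial is f" a]
    by (simp add: partial_deriv_def frechet_derivative_def)
  then show ?case
    using Cons by auto
qed simp

lemma smooth_bdd_shift: "smooth_bdd N B f \<Longrightarrow> smooth_bdd N B (\<lambda>x. f (x + a))"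
  unfolding smooth_bdd_def differentiable_def
  by (simp add: iter_partial_shift has_derivative_shift_iff)

lemma smooth_bdd_less:
  "iter_partial is f differentiable (at x)" if "smooth_bdd N B f" "length is < N"
  using that by (auto simp: smooth_bdd_def)

text \<open>One derivative is traded for a factor \<open>l1 a\<close>. Since the nonlocal operators
  commute with translations, applying them to such a difference bounds the Lipschitz constant of
  their image.\<close>

lemma smooth_bdd_difference:
  fixes f :: "real^'n::finite \<Rightarrow> real"
  assumes f: "smooth_bdd (Suc N) B f"
  shows "smooth_bdd N (B * l1 a) (\<lambda>x. f (x + a) - f x)"
  unfolding smooth_bdd_def
proof (intro conjI allI impI)
  fix "is" :: "'n list" and x
  have eq: "iter_partial is (\<lambda>x. f (x + a) - f x) = (\<lambda>x. iter_partial is f (x + a) - iter_partial is f x)"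
    if "length is \<le> Suc N"
    using iter_partial_diff[OF smooth_bdd_shift[OF f, of a] f that] by (simp add: iter_partial_shift)
  show "iter_partial is (\<lambda>x. f (x + a) - f x) differentiable at x" if "length is < N"
    using smooth_bdd_less[OF f, of "is" x] smooth_bdd_less[OF smooth_bdd_shift[OF f, of a], of "is" x] that
    by (auto simp: eq iter_partial_shift intro!: differentiable_diff)
  show "\<bar>iter_partial is (\<lambda>x. f (x + a) - f x) x\<bar> \<le> B * l1 a" if "length is = N"
    using smooth_bdd_lipschitz[of B "iter_partial is f" x a] smooth_bdd_iter_partial[of "Suc 0" "is" B f] f that
    by (simp add: eq)
qed

lemma smooth_bdd_second_difference:
  fixes f :: "real^'n::finite \<Rightarrow> real"
  assumes "smooth_bdd 2 B f"
  shows "\<bar>f (x + s + t) - f (x + t) - (f (x + s) - f x)\<bar> \<le> B * l1 s * l1 t"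
proof -
  have "smooth_bdd (Suc 0) (B * l1 s) (\<lambda>x. f (x + s) - f x)"
    using smooth_bdd_difference assms by (simp add: numeral_2_eq_2)
  from smooth_bdd_lipschitz[OF this, of x t] show ?thesis
    by (simp add: ac_simps)
qed

text \<open>The mixed second difference with step \<open>s\<close> is symmetric in the two
  directions, and it equals s^2 times either mixed derivative up to O(s^3). Dividing by s^2 and
  letting \<open>s\<close> tend to 0 identifies the two.\<close>

lemma symmetric_partials:
  fixes f :: "real^'n::finite \<Rightarrow> real"
  assumes f: "smooth_bdd 3 B f"
  shows "iter_partial [p, q] f x = iter_partial [q, p] f x"
proof -
  define \<Delta> where "\<Delta> s = f (x + s *\<^sub>R axis p 1 + s *\<^sub>R axis q 1) - f (x + s *\<^sub>R axis p 1)
      - (f (x + s *\<^sub>R axis q 1) - f x)" for s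
  have l1_axis: "l1 (s *\<^sub>R axis i 1 :: real^'n) = \<bar>s\<bar>" for s and i :: 'n
    by (simp add: l1_def axis_def if_distrib cong: if_cong)
  have T1: "taylor_term (Suc 0) g y (s *\<^sub>R axis i 1) = s * partial_deriv i g y" for g y s and i :: 'n
    by (simp add: taylor_term_1 axis_def if_distrib mult.commute cong: if_cong)
  \<comment> \<open>\<open>V\<close> is the first difference in direction \<open>j\<close>.
    Expanding \<open>V\<close> in direction \<open>i\<close>, and then the partial derivative of
    \<open>f\<close> in direction \<open>j\<close>, picks up the two derivatives one at a
    time.\<close>
  have *: "\<bar>f (x + s *\<^sub>R axis i 1 + s *\<^sub>R axis j 1) - f (x + s *\<^sub>R axis i 1)
        - (f (x + s *\<^sub>R axis j 1) - f x) - s\<^sup>2 * iter_partial [j, i] f x\<bar> \<le> B * \<bar>s\<bar> ^ 3" for s and i j :: 'n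
  proof -
    define V where "V y = f (y + s *\<^sub>R axis j 1) - f y" for y
    have V: "smooth_bdd 2 (B * \<bar>s\<bar>) V"
      using smooth_bdd_difference[of 2 B f "s *\<^sub>R axis j 1"] f
      by (simp add: l1_axis V_def[abs_def] numeral_3_eq_3 numeral_2_eq_2)
    have 1: "\<bar>V (x + s *\<^sub>R axis i 1) - V x - s * partial_deriv i V x\<bar> \<le> B * \<bar>s\<bar> ^ 3 / 2"
      using taylor_smooth_bdd[OF V, of x "s *\<^sub>R axis i 1"]
      by (simp add: numeral_2_eq_2 T1 l1_axis power3_eq_cube algebra_simps)
    have pV: "partial_deriv i V x = partial_deriv i f (x + s *\<^sub>R axis j 1) - partial_deriv i f x"
      using iter_partial_diff[OF smooth_bdd_shift[OF f, of "s *\<^sub>R axis j 1"] f, of "[i]"]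
        iter_partial_shift[of "[i]" f]
      by (simp add: V_def[abs_def])
    have 2: "\<bar>partial_deriv i V x - s * partial_deriv j (partial_deriv i f) x\<bar> \<le> B * s\<^sup>2 / 2"
      using taylor_smooth_bdd[of 2 B "partial_deriv i f" x "s *\<^sub>R axis j 1"]
        smooth_bdd_partial_deriv[of 2 B f i] f
      by (simp add: numeral_2_eq_2 numeral_3_eq_3 T1 l1_axis pV algebra_simps)
    have "\<bar>s * (partial_deriv i V x - s * partial_deriv j (partial_deriv i f) x)\<bar> \<le> \<bar>s\<bar> * (B * s\<^sup>2 / 2)"
      unfolding abs_mult by (intro mult_left_mono 2) auto
    also have "\<bar>s\<bar> * (B * s\<^sup>2 / 2) = B * \<bar>s\<bar> ^ 3 / 2"
      by (simp add: power3_eq_cube power2_eq_square)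
    finally have 3: "\<bar>s * (partial_deriv i V x - s * partial_deriv j (partial_deriv i f) x)\<bar> \<le> B * \<bar>s\<bar> ^ 3 / 2" .
    have "f (x + s *\<^sub>R axis i 1 + s *\<^sub>R axis j 1) - f (x + s *\<^sub>R axis i 1)
        - (f (x + s *\<^sub>R axis j 1) - f x) - s\<^sup>2 * iter_partial [j, i] f x
      = (V (x + s *\<^sub>R axis i 1) - V x - s * partial_deriv i V x)
        + s * (partial_deriv i V x - s * partial_deriv j (partial_deriv i f) x)"
      by (simp add: V_def right_diff_distrib power2_eq_square)
    then show ?thesis
      using 1 3 by linarith
  qed
  define E where "E = \<bar>iter_partial [p, q] f x - iter_partial [q, p] f x\<bar>"
  have E: "E \<le> 2 * B * s" if "s > 0" for s
  proof -
    have "\<bar>s\<^sup>2 * iter_partial [p, q] f x - s\<^sup>2 * iter_partial [q, p] f x\<bar> \<le> 2 * B * s ^ 3"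
      using *[of s p q] *[of s q p] that by (simp add: algebra_simps)
    moreover have "s\<^sup>2 * E = \<bar>s\<^sup>2 * iter_partial [p, q] f x - s\<^sup>2 * iter_partial [q, p] f x\<bar>"
      unfolding E_def right_diff_distrib[symmetric] abs_mult by simp
    moreover have "2 * B * s ^ 3 = s\<^sup>2 * (2 * B * s)"
      by (simp add: power3_eq_cube power2_eq_square)
    ultimately have "s\<^sup>2 * E \<le> s\<^sup>2 * (2 * B * s)"
      by simp
    then show ?thesis
      using that by simp
  qed
  have "((\<lambda>s. 2 * B * s) \<longlongrightarrow> 2 * B * 0) (at_right 0)"
    by (intro tendsto_intros)
  then have "E \<le> 2 * B * 0"
    by (rule tendsto_lowerbound) (auto simp: eventually_at_right_less E eventually_at_filter)
  then show ?thesis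
    by (simp add: E_def)
qed

subsection \<open>The cubic B-spline\<close>

text \<open>\<open>bspl m\<close> is the \<open>m\<close>-th derivative of the cubic B-spline, for \<open>m \<le> 2\<close>, written as the fourth
  central difference of a truncated power.\<close>

definition bspl :: "nat \<Rightarrow> real \<Rightarrow> real" where
  "bspl m x = (max 0 (x + 2) ^ (3 - m) - 4 * max 0 (x + 1) ^ (3 - m) + 6 * max 0 x ^ (3 - m)
     - 4 * max 0 (x - 1) ^ (3 - m) + max 0 (x - 2) ^ (3 - m)) / fact (3 - m)"

text \<open>The window has support radius 1 and the B-spline with integer knots has radius 2, whence
  the halved argument. Between consecutive knots both sides are the same cubic.\<close>

lemma spline_window_eq_bspl: "spline_window (\<bar>x\<bar> / 2) = bspl 0 x"
proof -
  consider "x \<le> -2" | "-2 < x" "x \<le> -1" | "-1 < x" "x \<le> 0" | "0 < x" "x \<le> 1" | "1 < x" "x \<le> 2" | "2 < x"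
    by linarith
  then show ?thesis
  proof cases
  qed (simp_all add: spline_window_def bspl_def max_def fact_numeral power2_eq_square power3_eq_cube field_simps)
qed

text \<open>For \<theta> in [0,1) the four arguments are all points congruent to \<theta> modulo 1
  that the support can contain. Every sum over nodes reduces to this table.\<close>

lemma bspl_pieces:
  assumes "0 \<le> \<theta>" "\<theta> \<le> 1"
  shows "bspl 0 (\<theta> + 1) = (1 - \<theta>) ^ 3 / 6" "bspl 0 \<theta> = 2/3 - \<theta>\<^sup>2 + \<theta> ^ 3 / 2"
    "bspl 0 (\<theta> - 1) = 2/3 - (1 - \<theta>)\<^sup>2 + (1 - \<theta>) ^ 3 / 2" "bspl 0 (\<theta> - 2) = \<theta> ^ 3 / 6"
    "bspl 1 (\<theta> + 1) = - ((1 - \<theta>)\<^sup>2 / 2)" "bspl 1 \<theta> = - 2 * \<theta> + 3 / 2 * \<theta>\<^sup>2"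
    "bspl 1 (\<theta> - 1) = 2 * (1 - \<theta>) - 3 / 2 * (1 - \<theta>)\<^sup>2" "bspl 1 (\<theta> - 2) = \<theta>\<^sup>2 / 2"
    "bspl 2 (\<theta> + 1) = 1 - \<theta>" "bspl 2 \<theta> = 3 * \<theta> - 2"
    "bspl 2 (\<theta> - 1) = 1 - 3 * \<theta>" "bspl 2 (\<theta> - 2) = \<theta>"
  using assms
  by (simp_all add: bspl_def max_def fact_numeral numeral_2_eq_2 numeral_3_eq_3 field_simps)

lemma bspl_eq_0:
  assumes "\<bar>x\<bar> \<ge> 2" "m \<le> 2"
  shows "bspl m x = 0"
proof (cases "x \<le> -2")
  case True
  then show ?thesis
    using assms by (simp add: bspl_def)
next
  case False
  then have "x \<ge> 2"
    using assms by linarith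
  moreover have "m = 0 \<or> m = 1 \<or> m = 2"
    using assms by linarith
  ultimately show ?thesis
    by (auto simp: bspl_def max_def fact_numeral power2_eq_square power3_eq_cube algebra_simps)
qed

lemma bspl_even: "bspl 0 (- x) = bspl 0 x"
  using spline_window_eq_bspl[of x] spline_window_eq_bspl[of "- x"] by simp

text \<open>The only doubtful point is 0, where the difference quotient is a positive power of
  \<open>max 0 h\<close>. The exponent has to be at least two for this, so differentiation of the
  spline stops at \<open>bspl 2\<close>.\<close>

lemma DERIV_max_power:
  "((\<lambda>x::real. max 0 x ^ Suc (Suc n)) has_real_derivative real (Suc (Suc n)) * max 0 x ^ Suc n) (at x)"
proof (cases x "0::real" rule: linorder_cases)
  case less
  have "((\<lambda>x::real. 0) has_real_derivative real (Suc (Suc n)) * max 0 x ^ Suc n) (at x)"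
    using less by simp
  then show ?thesis
    by (rule has_field_derivative_transform_within_open[of _ _ _ "{..<0}"]) (use less in auto)
next
  case greater
  have "((\<lambda>x::real. x ^ Suc (Suc n)) has_real_derivative real (Suc (Suc n)) * max 0 x ^ Suc n) (at x)"
    using greater DERIV_pow[of "Suc (Suc n)" x UNIV] by simp
  then show ?thesis
    by (rule has_field_derivative_transform_within_open[of _ _ _ "{0<..}"]) (use greater in auto)
next
  case equal
  have "isCont (\<lambda>h::real. max 0 h ^ Suc n) 0"
    by (intro continuous_intros)
  then have "((\<lambda>h::real. max 0 h ^ Suc n) \<longlongrightarrow> 0) (at 0)"
    by (simp add: isCont_def)
  then have "((\<lambda>h::real. max 0 h ^ Suc (Suc n) / h) \<longlongrightarrow> 0) (at 0)"
    by (rule Lim_transform_eventually) (auto simp: eventually_at_filter max_def)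
  then show ?thesis
    using equal by (simp add: DERIV_def)
qed

lemma DERIV_max_power_shift:
  "((\<lambda>x::real. max 0 (x + a) ^ Suc (Suc n)) has_real_derivative
      real (Suc (Suc n)) * max 0 (x + a) ^ Suc n) (at x)"
  using DERIV_max_power[of n "x + a"] by (simp add: DERIV_shift)

lemma DERIV_bspl:
  assumes "m < 2"
  shows "(bspl m has_real_derivative bspl (Suc m) x) (at x)"
proof -
  consider "m = 0" | "m = 1"
    using assms by linarith
  then obtain n where n: "3 - m = Suc (Suc n)" "3 - Suc m = Suc n"
    by cases auto
  have D0: "((\<lambda>x::real. max 0 x ^ Suc (Suc n)) has_real_derivative real (Suc (Suc n)) * max 0 x ^ Suc n) (at x)"
    by (rule DERIV_max_power)
  note D = DERIV_max_power_shift[of 2 n x] DERIV_max_power_shift[of 1 n x] D0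
    DERIV_max_power_shift[of "-1" n x] DERIV_max_power_shift[of "-2" n x]
  have "((\<lambda>x. (max 0 (x + 2) ^ Suc (Suc n) - 4 * max 0 (x + 1) ^ Suc (Suc n) + 6 * max 0 x ^ Suc (Suc n)
     - 4 * max 0 (x + (-1)) ^ Suc (Suc n) + max 0 (x + (-2)) ^ Suc (Suc n)) / fact (Suc (Suc n)))
    has_real_derivative
     (real (Suc (Suc n)) * max 0 (x + 2) ^ Suc n - 4 * (real (Suc (Suc n)) * max 0 (x + 1) ^ Suc n)
      + 6 * (real (Suc (Suc n)) * max 0 x ^ Suc n) - 4 * (real (Suc (Suc n)) * max 0 (x + (-1)) ^ Suc n)
      + real (Suc (Suc n)) * max 0 (x + (-2)) ^ Suc n) / fact (Suc (Suc n))) (at x)"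
    by (intro DERIV_cdivide DERIV_add DERIV_diff DERIV_cmult D)
  also have "(real (Suc (Suc n)) * max 0 (x + 2) ^ Suc n - 4 * (real (Suc (Suc n)) * max 0 (x + 1) ^ Suc n)
      + 6 * (real (Suc (Suc n)) * max 0 x ^ Suc n) - 4 * (real (Suc (Suc n)) * max 0 (x + (-1)) ^ Suc n)
      + real (Suc (Suc n)) * max 0 (x + (-2)) ^ Suc n) = real (Suc (Suc n)) *
     (max 0 (x + 2) ^ Suc n - 4 * max 0 (x + 1) ^ Suc n + 6 * max 0 x ^ Suc n
     - 4 * max 0 (x + (-1)) ^ Suc n + max 0 (x + (-2)) ^ Suc n)"
    by (simp only: distrib_left right_diff_distrib mult.left_commute)
  also have "real (Suc (Suc n)) *
     (max 0 (x + 2) ^ Suc n - 4 * max 0 (x + 1) ^ Suc n + 6 * max 0 x ^ Suc n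
     - 4 * max 0 (x + (-1)) ^ Suc n + max 0 (x + (-2)) ^ Suc n) / fact (Suc (Suc n)) = bspl (Suc m) x"
    unfolding bspl_def n fact_Suc[of "Suc n"] of_nat_mult
    by (simp del: power_Suc fact_Suc of_nat_Suc)
  finally show ?thesis
    unfolding bspl_def[abs_def] n by simp
qed

lemma bspl_shift_cases:
  fixes y :: real
  assumes "i \<in> {\<lfloor>y\<rfloor> - 1..\<lfloor>y\<rfloor> + 2}"
  obtains "y - of_int i = frac y + 1" | "y - of_int i = frac y" | "y - of_int i = frac y - 1"
    | "y - of_int i = frac y - 2"
proof -
  have "i = \<lfloor>y\<rfloor> - 1 \<or> i = \<lfloor>y\<rfloor> \<or> i = \<lfloor>y\<rfloor> + 1 \<or> i = \<lfloor>y\<rfloor> + 2"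
    using assms by auto
  then show thesis
    using that by (auto simp: frac_def)
qed

lemma bspl_bounds:
  assumes "m \<le> 2"
  shows "\<bar>bspl m x\<bar> \<le> 2" and "bspl 0 x \<ge> 0" "bspl 0 x \<le> 1"
proof -
  have *: "\<bar>bspl m x\<bar> \<le> 2 \<and> bspl 0 x \<ge> 0 \<and> bspl 0 x \<le> 1"
  proof (cases "\<bar>x\<bar> \<ge> 2")
    case False
    define \<theta> where "\<theta> = frac x"
    have \<theta>: "0 \<le> \<theta>" "\<theta> \<le> 1"
      using frac_lt_1[of x] by (auto simp: \<theta>_def)
    \<comment> \<open>The last inequality keeps the two middle pieces of the spline positive: 2/3 -
      u^2 + u^3/2 = 2/3 - (2u^2 - u^3)/2 is at least 1/6.\<close>
    have key: "0 \<le> u\<^sup>2" "u\<^sup>2 \<le> u" "u^3 \<le> u\<^sup>2" "0 \<le> u^3" "2 * u\<^sup>2 - u^3 \<le> 1"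
      if "0 \<le> u" "u \<le> 1" for u :: real
    proof -
      have "u * (1 - (1 - u)\<^sup>2) \<le> 1"
        using that power_le_one[of "1 - u" 2] by (intro mult_le_one) auto
      then show "2 * u\<^sup>2 - u^3 \<le> 1"
        by (simp add: power2_eq_square power3_eq_cube algebra_simps)
    qed (use that power_decreasing[of 1 2 u] power_decreasing[of 2 3 u] in auto)
    define u where "u = 1 - \<theta>"
    have "0 \<le> u" "u \<le> 1"
      using \<theta> by (auto simp: u_def)
    note k = key[OF \<theta>] key[OF this]
    have all: "\<bar>bspl 0 y\<bar> \<le> 1 \<and> 0 \<le> bspl 0 y \<and> \<bar>bspl 1 y\<bar> \<le> 2 \<and> \<bar>bspl 2 y\<bar> \<le> 2"
      if "y = \<theta> + 1 \<or> y = \<theta> \<or> y = \<theta> - 1 \<or> y = \<theta> - 2" for y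
      using that
      apply (elim disjE)
         apply (simp_all only: bspl_pieces[OF \<theta>] u_def[symmetric])
         apply (intro conjI; use k \<theta> u_def in linarith)
        apply (intro conjI; use k \<theta> u_def in linarith)
       apply (intro conjI; use k \<theta> u_def in linarith)
      apply (intro conjI; use k \<theta> u_def in linarith)
      done
    have "0 \<in> {\<lfloor>x\<rfloor> - 1..\<lfloor>x\<rfloor> + 2}"
      using False by (auto simp: abs_le_iff) linarith+
    then have x: "x = \<theta> + 1 \<or> x = \<theta> \<or> x = \<theta> - 1 \<or> x = \<theta> - 2"
      unfolding \<theta>_def by (rule bspl_shift_cases[of 0 x]) auto
    have "m = 0 \<or> m = 1 \<or> m = 2"
      using assms by linarith
    then show ?thesis
      using all[OF x] by auto
  qed (simp add: bspl_eq_0 assms)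
  then show "\<bar>bspl m x\<bar> \<le> 2" "bspl 0 x \<ge> 0" "bspl 0 x \<le> 1"
    by auto
qed

text \<open>On the unit grid this is the \<open>m\<close>-th derivative at \<open>y\<close> of the
  spline built from the nodal data (i - y)^l. It therefore tests reproduction of monomials centred
  at \<open>y\<close>; the range of \<open>i\<close> covers the support.\<close>

definition spline_moment :: "nat \<Rightarrow> nat \<Rightarrow> real \<Rightarrow> real" where
  "spline_moment m l y = (\<Sum>i\<in>{\<lfloor>y\<rfloor> - 1..\<lfloor>y\<rfloor> + 2}. bspl m (y - of_int i) * (of_int i - y) ^ l)"

lemma spline_moment_expand:
  "spline_moment m l y = bspl m (frac y + 1) * (- (frac y + 1)) ^ l + bspl m (frac y) * (- frac y) ^ l
     + bspl m (frac y - 1) * (1 - frac y) ^ l + bspl m (frac y - 2) * (2 - frac y) ^ l"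
proof -
  have "{\<lfloor>y\<rfloor> - 1..\<lfloor>y\<rfloor> + 2} = {\<lfloor>y\<rfloor> - 1, \<lfloor>y\<rfloor>, \<lfloor>y\<rfloor> + 1, \<lfloor>y\<rfloor> + 2}"
    by auto
  then show ?thesis
    by (simp add: spline_moment_def frac_def algebra_simps)
qed

text \<open>Evaluation at the fractional part leaves polynomial identities. Absent is
  \<open>spline_moment 0 2\<close>, which equals 1/3 and not 0: quadratics are not reproduced, and
  this limits the order to two.\<close>

lemma spline_moment_values:
  "spline_moment 0 0 y = 1" "spline_moment 0 1 y = 0" "spline_moment 0 3 y = 0"
  "spline_moment 1 0 y = 0" "spline_moment 1 1 y = 1" "spline_moment 1 2 y = 0"
  "spline_moment 2 0 y = 0" "spline_moment 2 1 y = 0" "spline_moment 2 2 y = 2" "spline_moment 2 3 y = 0"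
proof -
  have "0 \<le> frac y" "frac y \<le> 1"
    using frac_lt_1[of y] by auto
  then show "spline_moment 0 0 y = 1" "spline_moment 0 1 y = 0" "spline_moment 0 3 y = 0"
    "spline_moment 1 0 y = 0" "spline_moment 1 1 y = 1" "spline_moment 1 2 y = 0"
    "spline_moment 2 0 y = 0" "spline_moment 2 1 y = 0" "spline_moment 2 2 y = 2" "spline_moment 2 3 y = 0"
    by (simp_all only: spline_moment_expand bspl_pieces)
      (simp_all add: power2_eq_square power3_eq_cube field_simps)
qed

lemma spline_moment_eq_0:
  assumes "m \<le> 2" "l \<le> 3" "l < m \<or> odd (m + l)"
  shows "spline_moment m l y = 0"
proof -
  have "m = 0 \<or> m = 1 \<or> m = 2" "l = 0 \<or> l = 1 \<or> l = 2 \<or> l = 3"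
    using assms by linarith+
  then show ?thesis
    using assms(3) by (elim disjE) (auto simp only: spline_moment_values odd_add even_numeral, auto)
qed

lemma spline_moment_diag:
  assumes "m \<le> 2"
  shows "spline_moment m m y = fact m"
proof -
  have "m = 0 \<or> m = 1 \<or> m = 2"
    using assms by linarith
  then show ?thesis
    by (elim disjE) (simp_all only: spline_moment_values, simp_all)
qed

subsection \<open>Tensor product splines\<close>

text \<open>The orders form a multi-index, encoded as the function \<open>m\<close>. An index list
  \<open>is\<close> of partial derivatives corresponds to the multi-index
  \<open>count_list is\<close>, which forgets the order of differentiation.\<close>

definition basis_deriv :: "real^'n::finite \<Rightarrow> ('n \<Rightarrow> nat) \<Rightarrow> int^'n \<Rightarrow> real^'n \<Rightarrow> real" where
  "basis_deriv h m k x = (\<Prod>j\<in>UNIV. bspl (m j) (x $ j / h $ j - of_int (k $ j)) / h $ j ^ m j)"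

lemma rk_basis_eq:
  assumes "\<And>j. h $ j > 0"
  shows "rk_basis h k x = basis_deriv h (\<lambda>_. 0) k x"
proof -
  have "\<bar>x $ j - of_int (k $ j) * h $ j\<bar> / (2 * h $ j) = \<bar>x $ j / h $ j - of_int (k $ j)\<bar> / 2" for j
  proof -
    have "x $ j - of_int (k $ j) * h $ j = (x $ j / h $ j - of_int (k $ j)) * h $ j"
      using assms[of j] by (simp add: field_simps)
    then show ?thesis
      using assms[of j] by (simp add: abs_mult)
  qed
  then show ?thesis
    unfolding rk_basis_def basis_deriv_def by (simp only: spline_window_eq_bspl) simp
qed

text \<open>Distributivity, in the form that splits a sum over a box of multi-indices into
  one-dimensional sums. It carries the tensor product structure both for the moments and for the
  Gram factorisation.\<close>

lemma sum_vec_prod: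
  fixes g :: "'n::finite \<Rightarrow> 'a \<Rightarrow> 'c::comm_semiring_1"
  assumes "\<And>j. finite (B j)"
  shows "(\<Sum>k | \<forall>j. k $ j \<in> B j. \<Prod>j\<in>UNIV. g j (k $ j)) = (\<Prod>j\<in>UNIV. \<Sum>i\<in>B j. g j i)"
proof -
  have "(\<Prod>j\<in>UNIV. \<Sum>i\<in>B j. g j i) = (\<Sum>f\<in>PiE UNIV B. \<Prod>j\<in>UNIV. g j (f j))"
    using assms by (intro prod_sum_PiE) auto
  also have "\<dots> = (\<Sum>k | \<forall>j. k $ j \<in> B j. \<Prod>j\<in>UNIV. g j (k $ j))"
    by (rule sum.reindex_bij_witness[of _ vec_nth vec_lambda]) (auto simp: vec_lambda_eta)
  finally show ?thesis ..
qed

lemma finite_vec_box: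
  assumes "\<And>j. finite (B j)"
  shows "finite {k :: 'a^'n::finite. \<forall>j. k $ j \<in> B j}"
proof -
  have "{k :: 'a^'n. \<forall>j. k $ j \<in> B j} = vec_lambda ` PiE UNIV B"
    by (force simp: image_iff vec_lambda_eta intro: bexI[of _ "vec_nth _"])
  then show ?thesis
    using assms by (simp add: finite_PiE)
qed

lemma card_vec_box:
  assumes "\<And>j. finite (B j)"
  shows "card {k :: 'a^'n::finite. \<forall>j. k $ j \<in> B j} = (\<Prod>j\<in>UNIV. card (B j))"
  using sum_vec_prod[OF assms, of "\<lambda>_ _. 1::nat"] by simp

lemma monomial_eq_prod: "monomial is y = (\<Prod>j\<in>UNIV. y $ j ^ count_list is j)"
proof (induction "is")
  case (Cons p "is")
  have "(\<Prod>j\<in>UNIV. y $ j ^ count_list (p # is) j)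
      = (\<Prod>j\<in>UNIV. (if j = p then y $ p else 1) * y $ j ^ count_list is j)"
    by (rule prod.cong) auto
  also have "\<dots> = y $ p * (\<Prod>j\<in>UNIV. y $ j ^ count_list is j)"
    by (simp add: prod.distrib)
  finally show ?case
    using Cons by simp
qed simp

lemma basis_deriv_has_derivative:
  fixes h :: "real^'n::finite"
  assumes "\<And>j. m j < 2" "\<And>j. h $ j > 0"
  shows "basis_deriv h m k differentiable (at x)"
    and "partial_deriv p (basis_deriv h m k) x = basis_deriv h (m(p := Suc (m p))) k x"
proof -
  let ?g = "\<lambda>m j (x::real^'n). bspl (m j) (x $ j / h $ j - of_int (k $ j)) / h $ j ^ m j"
  let ?g' = "\<lambda>j y. bspl (Suc (m j)) (x $ j / h $ j - of_int (k $ j)) * (y $ j / h $ j) / h $ j ^ m j"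
  have 1: "(?g m j has_derivative ?g' j) (at x)" for j
  proof -
    have "((\<lambda>x::real^'n. x $ j / h $ j - of_int (k $ j)) has_derivative (\<lambda>y. y $ j / h $ j)) (at x)"
      using assms(2)[of j] by (auto intro!: derivative_eq_intros bounded_linear_imp_has_derivative
          bounded_linear_divide[THEN bounded_linear_compose] bounded_linear_vec_nth)
    from has_derivative_compose[OF this DERIV_bspl[OF assms(1), unfolded has_field_derivative_def]]
    have "((\<lambda>x::real^'n. bspl (m j) (x $ j / h $ j - of_int (k $ j))) has_derivative
       (\<lambda>y. bspl (Suc (m j)) (x $ j / h $ j - of_int (k $ j)) * (y $ j / h $ j))) (at x)" .
    then show ?thesis
      using has_derivative_mult_left[of _ _ _ "inverse (h $ j ^ m j)"] by (simp add: divide_inverse)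
  qed
  have D: "(basis_deriv h m k has_derivative (\<lambda>y. \<Sum>i\<in>UNIV. ?g' i y * (\<Prod>j\<in>UNIV - {i}. ?g m j x))) (at x)"
    unfolding basis_deriv_def[abs_def] using 1 by (rule has_derivative_prod)
  then show "basis_deriv h m k differentiable (at x)"
    by (auto simp: differentiable_def)
  have "partial_deriv p (basis_deriv h m k) x
      = (\<Sum>i\<in>UNIV. ?g' i (axis p 1) * (\<Prod>j\<in>UNIV - {i}. ?g m j x))"
    using partial_deriv_eq[OF D] .
  also have "\<dots> = (\<Sum>i\<in>UNIV. if i = p then ?g (m(p := Suc (m p))) p x * (\<Prod>j\<in>UNIV - {p}. ?g m j x) else 0)"
    by (rule sum.cong) (auto simp: axis_def)
  also have "\<dots> = ?g (m(p := Suc (m p))) p x * (\<Prod>j\<in>UNIV - {p}. ?g (m(p := Suc (m p))) j x)"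
    by (simp add: mult_ac)
  also have "\<dots> = basis_deriv h (m(p := Suc (m p))) k x"
    unfolding basis_deriv_def by (subst prod.remove[of UNIV p]) auto
  finally show "partial_deriv p (basis_deriv h m k) x = basis_deriv h (m(p := Suc (m p))) k x" .
qed

lemma count_list_Cons_upd: "count_list (p # is) = (count_list is)(p := Suc (count_list is p))"
  by (rule ext) auto

lemma count_list_le_2: "length is \<le> 2 \<Longrightarrow> count_list is j \<le> 2"
  by (meson count_le_length le_trans)

lemma iter_partial_basis:
  fixes h :: "real^'n::finite"
  assumes "length is \<le> 2" "\<And>j. h $ j > 0"
  shows "iter_partial is (basis_deriv h (\<lambda>_. 0) k) = basis_deriv h (count_list is) k"
  using assms(1)
proof (induction "is")
  case (Cons p "is")
  have "count_list is j < 2" for j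
    using count_le_length[of "is" j] Cons.prems by simp
  moreover have "iter_partial is (basis_deriv h (\<lambda>_. 0) k) = basis_deriv h (count_list is) k"
    using Cons by simp
  ultimately show ?case
    unfolding iter_partial.simps count_list_Cons_upd
    by (intro ext) (simp only: basis_deriv_has_derivative(2) assms(2))
next
  case Nil
  have "count_list [] = (\<lambda>_ :: 'n. 0)"
    by (rule ext) simp
  then show ?case
    by simp
qed

lemma iter_partial_basis_differentiable:
  assumes "length is < 2" "\<And>j. h $ j > 0"
  shows "iter_partial is (basis_deriv h (\<lambda>_. 0) k) differentiable (at x)"
proof -
  have "count_list is j < 2" for j
    using count_le_length[of "is" j] assms by simp
  then show ?thesis
    using assms by (simp add: iter_partial_basis basis_deriv_has_derivative(1))
qed

text \<open>\<open>H\<close> is the largest mesh width and \<eta> the quasi-uniformity constant,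
  which allows inverse powers of every mesh width to be bounded by inverse powers of
  \<open>H\<close>.\<close>

locale grid =
  fixes h :: "real^'n::finite" and \<eta> H :: real
  assumes \<eta>: "0 < \<eta>" "\<eta> \<le> 1" and H: "H > 0"
    and h_bounds: "\<And>j. \<eta> * H \<le> h $ j" "\<And>j. h $ j \<le> H"
begin

lemma h_pos: "h $ j > 0"
  using h_bounds(1)[of j] \<eta> H by (meson less_le_trans mult_pos_pos)

definition near :: "real^'n \<Rightarrow> (int^'n) set" where
  "near x = {k. \<forall>j. k $ j \<in> {\<lfloor>x $ j / h $ j\<rfloor> - 1..\<lfloor>x $ j / h $ j\<rfloor> + 2}}"

lemma finite_near [simp]: "finite (near x)"
  unfolding near_def by (rule finite_vec_box) auto

lemma card_near: "card (near x) = 4 ^ CARD('n)"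
  unfolding near_def by (subst card_vec_box) auto

lemma basis_deriv_eq_0:
  assumes "k \<notin> near x" "\<And>j. m j \<le> 2"
  shows "basis_deriv h m k x = 0"
proof -
  obtain j where j: "k $ j \<notin> {\<lfloor>x $ j / h $ j\<rfloor> - 1..\<lfloor>x $ j / h $ j\<rfloor> + 2}"
    using assms by (auto simp: near_def)
  then have "k $ j \<le> \<lfloor>x $ j / h $ j\<rfloor> - 2 \<or> k $ j \<ge> \<lfloor>x $ j / h $ j\<rfloor> + 3"
    by auto
  then have "\<bar>x $ j / h $ j - of_int (k $ j)\<bar> \<ge> 2"
    by linarith
  then have "bspl (m j) (x $ j / h $ j - of_int (k $ j)) = 0"
    using assms by (intro bspl_eq_0) auto
  then show ?thesis
    unfolding basis_deriv_def by (intro prod_zero) auto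
qed

lemma grid_point_component: "(grid_point h k - x) $ j = h $ j * (of_int (k $ j) - x $ j / h $ j)"
  using h_pos[of j] by (simp add: grid_point_def field_simps)

lemma l1_near:
  assumes "k \<in> near x"
  shows "l1 (grid_point h k - x) \<le> 2 * CARD('n) * H"
proof -
  have "\<bar>(grid_point h k - x) $ j\<bar> \<le> 2 * H" for j
  proof -
    have "k $ j \<in> {\<lfloor>x $ j / h $ j\<rfloor> - 1..\<lfloor>x $ j / h $ j\<rfloor> + 2}"
      using assms by (auto simp: near_def)
    then have "\<lfloor>x $ j / h $ j\<rfloor> - 1 \<le> k $ j" "k $ j \<le> \<lfloor>x $ j / h $ j\<rfloor> + 2"
      by auto
    then have "\<bar>of_int (k $ j) - x $ j / h $ j\<bar> \<le> 2"
      by linarith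
    then have "h $ j * \<bar>of_int (k $ j) - x $ j / h $ j\<bar> \<le> H * 2"
      using h_bounds[of j] h_pos[of j] H by (intro mult_mono) auto
    then show ?thesis
      using h_pos[of j] by (simp only: grid_point_component abs_mult abs_of_pos mult.commute)
  qed
  then have "l1 (grid_point h k - x) \<le> of_nat CARD('n) * (2 * H)"
    unfolding l1_def using sum_bounded_above[of "UNIV::'n set" "\<lambda>j. \<bar>(grid_point h k - x) $ j\<bar>" "2 * H"] by simp
  then show ?thesis
    by (simp add: mult_ac)
qed

section \<open>Polynomial exactness and interpolation error on the grid\<close>

lemma moment_prod:
  "(\<Sum>k\<in>near x. basis_deriv h m k x * monomial is (grid_point h k - x))
    = (\<Prod>j\<in>UNIV. spline_moment (m j) (count_list is j) (x $ j / h $ j) * h $ j ^ count_list is j / h $ j ^ m j)"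
proof -
  have "(\<Sum>k\<in>near x. basis_deriv h m k x * monomial is (grid_point h k - x))
    = (\<Sum>k | \<forall>j. k $ j \<in> {\<lfloor>x $ j / h $ j\<rfloor> - 1..\<lfloor>x $ j / h $ j\<rfloor> + 2}. \<Prod>j\<in>UNIV.
        (\<lambda>j i. bspl (m j) (x $ j / h $ j - of_int i) * (of_int i - x $ j / h $ j) ^ count_list is j
         * h $ j ^ count_list is j / h $ j ^ m j) j (k $ j))"
    unfolding near_def monomial_eq_prod basis_deriv_def prod.distrib[symmetric] grid_point_component
    by (simp add: power_mult_distrib mult_ac)
  also have "\<dots> = (\<Prod>j\<in>UNIV. \<Sum>i\<in>{\<lfloor>x $ j / h $ j\<rfloor> - 1..\<lfloor>x $ j / h $ j\<rfloor> + 2}.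
        bspl (m j) (x $ j / h $ j - of_int i) * (of_int i - x $ j / h $ j) ^ count_list is j
         * h $ j ^ count_list is j / h $ j ^ m j)"
    by (rule sum_vec_prod) auto
  also have "\<dots> = (\<Prod>j\<in>UNIV. spline_moment (m j) (count_list is j) (x $ j / h $ j) * h $ j ^ count_list is j / h $ j ^ m j)"
    by (simp add: spline_moment_def sum_distrib_right sum_divide_distrib)
  finally show ?thesis .
qed

lemma sum_count_list_UNIV: "(\<Sum>j\<in>UNIV. count_list is j) = length (is :: 'n list)"
  using sum_count_set[of "is" UNIV] by simp

text \<open>If no coordinate gave a vanishing one-dimensional moment, then in each coordinate the
  order in \<open>is\<close> would be at least that in \<open>js\<close> and of the same parity. For
  different multi-indices the lengths would then differ by a positive even number, but they differ
  by at most one.\<close>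

lemma moment_lists:
  assumes "length js \<le> 2" "length is \<le> Suc (length js)"
  shows "(\<Sum>k\<in>near x. basis_deriv h (count_list js) k x * monomial is (grid_point h k - x))
    = (if count_list is = count_list js then \<Prod>j\<in>UNIV. fact (count_list js j) else 0)"
proof (cases "count_list is = count_list js")
  case True
  then show ?thesis
    unfolding moment_prod using h_pos by (simp add: spline_moment_diag count_list_le_2 assms less_imp_neq[THEN not_sym])
next
  case False
  have "\<exists>j. count_list is j < count_list js j \<or> odd (count_list js j + count_list is j)"
  proof (rule ccontr)
    assume "\<not> ?thesis"
    then have le: "count_list js j \<le> count_list is j" and ev: "even (count_list js j + count_list is j)" for j
      by (auto simp: not_less)
    then have "even (\<Sum>j\<in>UNIV. count_list js j + count_list is j)"
      by (auto intro: dvd_sum)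
    then have "even (length js + length is)"
      by (simp add: sum.distrib sum_count_list_UNIV)
    moreover obtain j where "count_list is j \<noteq> count_list js j"
      using False by (auto simp: fun_eq_iff)
    then have "(\<Sum>j\<in>UNIV. count_list js j) < (\<Sum>j\<in>UNIV. count_list is j)"
      using le by (intro sum_strict_mono_ex1) (auto simp: less_le intro!: exI[of _ j])
    then have "length js < length is"
      by (simp add: sum_count_list_UNIV)
    ultimately show False
      using assms(2) by (cases "length is = Suc (length js)") auto
  qed
  then obtain j where j: "count_list is j < count_list js j \<or> odd (count_list js j + count_list is j)"
    by blast
  have "spline_moment (count_list js j) (count_list is j) (x $ j / h $ j) = 0"
    using j assms count_le_length[of "is" j] by (intro spline_moment_eq_0 count_list_le_2) auto
  then have "(\<Prod>j\<in>UNIV. spline_moment (count_list js j) (count_list is j) (x $ j / h $ j)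
      * h $ j ^ count_list is j / h $ j ^ count_list js j) = 0"
    by (intro prod_zero) (auto intro!: exI[of _ j])
  then show ?thesis
    unfolding moment_prod using False by simp
qed

lemma basis_deriv_abs_le:
  assumes "length js \<le> 2"
  shows "\<bar>basis_deriv h (count_list js) k x\<bar> \<le> 2 ^ CARD('n) / (\<eta> * H) ^ length js"
proof -
  have "\<bar>basis_deriv h (count_list js) k x\<bar>
      = (\<Prod>j\<in>UNIV. \<bar>bspl (count_list js j) (x $ j / h $ j - of_int (k $ j))\<bar> / h $ j ^ count_list js j)"
    using h_pos by (simp add: basis_deriv_def abs_prod abs_divide power_abs less_imp_le)
  also have "\<dots> \<le> (\<Prod>j\<in>UNIV. 2 / (\<eta> * H) ^ count_list js j)"
    using \<eta> H h_bounds h_pos assms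
    by (intro prod_mono) (auto intro!: frac_le bspl_bounds(1) power_mono count_list_le_2 simp: less_imp_le)
  also have "\<dots> = 2 ^ CARD('n) / (\<eta> * H) ^ length js"
    by (simp add: prod_dividef flip: power_sum sum_count_list_UNIV)
  finally show ?thesis .
qed

lemma iter_partial_sum_basis:
  assumes "length is \<le> 2"
  shows "iter_partial is (\<lambda>x. \<Sum>k\<in>K. c k * basis_deriv h (\<lambda>_. 0) k x)
    = (\<lambda>x. \<Sum>k\<in>K. c k * basis_deriv h (count_list is) k x)"
proof -
  have "iter_partial is (\<lambda>x. \<Sum>k\<in>K. c k * basis_deriv h (\<lambda>_. 0) k x)
    = (\<lambda>x. \<Sum>k\<in>K. c k * iter_partial is (basis_deriv h (\<lambda>_. 0) k) x)"
    by (rule iter_partial_linear_combination[of K 2])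
      (simp_all add: iter_partial_basis_differentiable h_pos assms)
  then show ?thesis
    by (simp add: iter_partial_basis h_pos assms)
qed

lemma sum_basis_differentiable:
  assumes "length is < 2"
  shows "iter_partial is (\<lambda>x. \<Sum>k\<in>K. c k * basis_deriv h (\<lambda>_. 0) k x) differentiable (at x)"
proof (cases "finite K")
  case True
  have "count_list is j < 2" for j
    using count_le_length[of "is" j] assms by simp
  then show ?thesis
    using assms True
    by (auto simp: iter_partial_sum_basis intro!: differentiable_sum differentiable_mult basis_deriv_has_derivative h_pos)
qed simp

lemma smooth_bdd_sum_basis:
  assumes "finite K" "N \<le> 2"
  shows "smooth_bdd N (\<Sum>k\<in>K. \<bar>c k\<bar> * (2 ^ CARD('n) / (\<eta> * H) ^ N))
     (\<lambda>x. \<Sum>k\<in>K. c k * basis_deriv h (\<lambda>_. 0) k x)"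
  unfolding smooth_bdd_def
proof (intro conjI allI impI)
  fix "is" :: "'n list" and x
  show "iter_partial is (\<lambda>x. \<Sum>k\<in>K. c k * basis_deriv h (\<lambda>_. 0) k x) differentiable at x"
    if "length is < N"
    using that assms by (intro sum_basis_differentiable) simp
  show "\<bar>iter_partial is (\<lambda>x. \<Sum>k\<in>K. c k * basis_deriv h (\<lambda>_. 0) k x) x\<bar>
      \<le> (\<Sum>k\<in>K. \<bar>c k\<bar> * (2 ^ CARD('n) / (\<eta> * H) ^ N))" if "length is = N"
    using that assms basis_deriv_abs_le
    by (subst iter_partial_sum_basis) (auto simp del: times_divide_eq_right
        simp: abs_mult intro!: order_trans[OF sum_abs] sum_mono mult_left_mono)
qed

lemma sum_near:
  assumes "finite K" "\<And>k. k \<notin> K \<Longrightarrow> c k = 0" "\<And>j. m j \<le> 2"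
  shows "(\<Sum>k\<in>K. c k * basis_deriv h m k x) = (\<Sum>k\<in>near x. c k * basis_deriv h m k x)"
proof -
  have "(\<Sum>k\<in>K. c k * basis_deriv h m k x) = (\<Sum>k\<in>K \<union> near x. c k * basis_deriv h m k x)"
    using assms by (intro sum.mono_neutral_left) auto
  also have "\<dots> = (\<Sum>k\<in>near x. c k * basis_deriv h m k x)"
    using assms by (intro sum.mono_neutral_right) (auto simp: basis_deriv_eq_0)
  finally show ?thesis .
qed

text \<open>The factor \<open>\<eta>\<^sup>-\<^sup>2\<close> comes from the derivatives of the basis functions along the smallest mesh
  width.\<close>

definition Cint :: real where
  "Cint = 8 ^ CARD('n) * (2 * CARD('n)) ^ 4 / \<eta>\<^sup>2"

lemma Cint_nonneg: "Cint \<ge> 0"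
  by (simp add: Cint_def)

text \<open>Only the lists with the multi-index of \<open>js\<close> survive the moments. Their
  number times the product of factorials is \<open>fact (length js)\<close>, and symmetry of mixed
  derivatives makes all their terms equal. The separate bound \<open>f3\<close> feeds
  \<open>symmetric_partials\<close>: \<open>smooth_bdd 4\<close> bounds fourth derivatives only, not
  third ones.\<close>

lemma taylor_exact:
  assumes js: "length js \<le> 2" and f: "smooth_bdd (length js + 2) B f"
    and f3: "length js = 2 \<Longrightarrow> smooth_bdd 3 B' f"
  shows "(\<Sum>k\<in>near x. basis_deriv h (count_list js) k x *
            (\<Sum>j<length js + 2. taylor_term j f x (grid_point h k - x) / fact j)) = iter_partial js f x"
proof -
  let ?F = "\<Prod>j\<in>UNIV. fact (count_list js j) :: real"
  have T: "(\<Sum>k\<in>near x. basis_deriv h (count_list js) k x * taylor_term j f x (grid_point h k - x))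
      = (\<Sum>is | length is = j. if count_list is = count_list js then iter_partial is f x * ?F else 0)"
    if "j \<le> Suc (length js)" for j
  proof -
    have "(\<Sum>k\<in>near x. basis_deriv h (count_list js) k x * taylor_term j f x (grid_point h k - x))
      = (\<Sum>is | length is = j. \<Sum>k\<in>near x. iter_partial is f x *
          (basis_deriv h (count_list js) k x * monomial is (grid_point h k - x)))"
      unfolding taylor_term_def sum_distrib_left by (subst sum.swap) (simp add: mult_ac)
    also have "\<dots> = (\<Sum>is | length is = j. if count_list is = count_list js then iter_partial is f x * ?F else 0)"
      using that js by (intro sum.cong refl) (simp add: moment_lists flip: sum_distrib_left)
    finally show ?thesis .
  qed
  have len: "length is = length js" if "count_list is = count_list js" for "is" :: "'n list"
    using that by (metis sum_count_list_UNIV)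
  have T0: "(\<Sum>is | length is = j. if count_list is = count_list js then iter_partial is f x * ?F else 0) = 0"
    if "j \<noteq> length js" for j
    using that by (intro sum.neutral) (auto dest: len)
  have "(\<Sum>k\<in>near x. basis_deriv h (count_list js) k x *
            (\<Sum>j<length js + 2. taylor_term j f x (grid_point h k - x) / fact j))
     = (\<Sum>j<length js + 2. (\<Sum>k\<in>near x. basis_deriv h (count_list js) k x * taylor_term j f x (grid_point h k - x)) / fact j)"
    unfolding sum_distrib_left sum_divide_distrib by (subst sum.swap) simp
  also have "\<dots> = (\<Sum>j<length js + 2. if j = length js then
      (\<Sum>is | length is = j. if count_list is = count_list js then iter_partial is f x * ?F else 0) / fact j else 0)"
    by (intro sum.cong refl) (auto simp: T T0)
  also have "\<dots> = (\<Sum>is | length is = length js \<and> count_list is = count_list js. iter_partial is f x * ?F)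
      / fact (length js)"
    by (simp add: sum.If_cases Collect_conj_eq flip: sum.inter_filter)
  also have "\<dots> = iter_partial js f x"
  proof -
    consider "js = []" | p where "js = [p]" | p q where "js = [p, q]"
      using js by (metis One_nat_def Suc_1 le_Suc_eq le_zero_eq length_0_conv length_Suc_conv)
    then show ?thesis
    proof cases
      case 1
      then have "{is. length is = length js \<and> count_list is = count_list js} = {[]}"
        by auto
      then show ?thesis
        using 1 by simp
    next
      case (2 p)
      have "{is. length is = length js \<and> count_list is = count_list js} = {[p]}"
        unfolding 2 by (auto simp: length_Suc_conv fun_eq_iff split: if_splits)
      moreover have "?F = (\<Prod>j\<in>(UNIV::'n set). 1)"
        unfolding 2 by (rule prod.cong[OF refl]) simp
      ultimately show ?thesis
        using 2 by simp
    next
      case (3 p q)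
      have sym: "iter_partial [q, p] f x = iter_partial [p, q] f x"
        using symmetric_partials[OF f3] 3 by simp
      have set: "{is. length is = length js \<and> count_list is = count_list js} = {[p, q], [q, p]}"
      proof (intro equalityI subsetI)
        fix "is" assume "is \<in> {is. length is = length js \<and> count_list is = count_list js}"
        then obtain a b where ab: "is = [a, b]" and c: "count_list [a, b] = count_list [p, q]"
          using 3 by (auto simp: length_Suc_conv)
        have "a = p \<or> a = q"
          by (rule ccontr) (use fun_cong[OF c, of a] in \<open>simp split: if_splits\<close>)
        moreover have "b = p \<or> b = q"
          by (rule ccontr) (use fun_cong[OF c, of b] in \<open>simp split: if_splits\<close>)
        moreover have "p = a \<or> p = b"
          by (rule ccontr) (use fun_cong[OF c, of p] in \<open>simp split: if_splits\<close>)
        moreover have "q = a \<or> q = b"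
          by (rule ccontr) (use fun_cong[OF c, of q] in \<open>simp split: if_splits\<close>)
        ultimately show "is \<in> {[p, q], [q, p]}"
          unfolding ab by blast
      qed (auto simp: 3)
      show ?thesis
      proof (cases "p = q")
        case True
        have "?F = (\<Prod>j\<in>UNIV. if j = p then 2 else 1)"
          unfolding 3 by (rule prod.cong) (auto simp: True)
        then show ?thesis
          unfolding set using True 3 by simp
      next
        case False
        have "?F = (\<Prod>j\<in>(UNIV::'n set). 1)"
          unfolding 3 by (rule prod.cong) (use False in auto)
        then show ?thesis
          unfolding set using False 3 sym by simp
      qed
    qed
  qed
  finally show ?thesis .
qed

text \<open>With M = \<open>length js\<close>, the Taylor polynomial of degree M + 1 is reproduced,
  so only its remainder O(H^(M+2)) is seen by basis derivatives of size (\<eta> H)^(-M). The 4^d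
  active nodes times the factor 2^d from the spline bounds give the 8^d in
  \<open>Cint\<close>.\<close>

lemma interp_error:
  assumes js: "length js \<le> 2" and f: "smooth_bdd (length js + 2) B f"
    and f3: "length js = 2 \<Longrightarrow> smooth_bdd 3 B' f"
    and K: "finite K" "\<And>k. k \<notin> K \<Longrightarrow> f (grid_point h k) = 0"
  shows "\<bar>iter_partial js (\<lambda>x. \<Sum>k\<in>K. f (grid_point h k) * basis_deriv h (\<lambda>_. 0) k x) x
      - iter_partial js f x\<bar> \<le> Cint * B * H\<^sup>2"
proof -
  let ?M = "length js" and ?b = "basis_deriv h (count_list js)"
  let ?T = "\<lambda>k. \<Sum>j<?M + 2. taylor_term j f x (grid_point h k - x) / fact j"
  have B: "B \<ge> 0"
    using f smooth_bdd_nonneg by blast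
  have "iter_partial js (\<lambda>x. \<Sum>k\<in>K. f (grid_point h k) * basis_deriv h (\<lambda>_. 0) k x) x - iter_partial js f x
     = (\<Sum>k\<in>near x. ?b k x * (f (x + (grid_point h k - x)) - ?T k))"
    unfolding iter_partial_sum_basis[OF js]
    by (subst sum_near) (use K js in
        \<open>simp_all add: taylor_exact[OF js f f3] count_list_le_2 right_diff_distrib sum_subtractf mult.commute del: sum.lessThan_Suc add_2_eq_Suc'\<close>)
  also have "\<bar>\<dots>\<bar> \<le> (\<Sum>k\<in>near x. (2 ^ CARD('n) / (\<eta> * H) ^ ?M) * (B * (2 * CARD('n) * H) ^ (?M + 2)))"
  proof (rule order_trans[OF sum_abs sum_mono])
    fix k assume k: "k \<in> near x"
    have "\<bar>f (x + (grid_point h k - x)) - ?T k\<bar> \<le> B * l1 (grid_point h k - x) ^ (?M + 2) / fact (?M + 2)"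
      by (rule taylor_smooth_bdd[OF f]) simp
    also have "\<dots> \<le> B * l1 (grid_point h k - x) ^ (?M + 2) / 1"
      using B by (intro divide_left_mono fact_ge_1) auto
    also have "\<dots> \<le> B * (2 * CARD('n) * H) ^ (?M + 2)"
      using B k by (simp only: div_by_1) (intro mult_left_mono power_mono l1_near, auto)
    finally show "\<bar>?b k x * (f (x + (grid_point h k - x)) - ?T k)\<bar>
        \<le> (2 ^ CARD('n) / (\<eta> * H) ^ ?M) * (B * (2 * CARD('n) * H) ^ (?M + 2))"
      unfolding abs_mult using \<eta> H by (intro mult_mono basis_deriv_abs_le js) auto
  qed
  also have "\<dots> = 8 ^ CARD('n) * (2 * CARD('n)) ^ (?M + 2) / \<eta> ^ ?M * B * H\<^sup>2"
  proof -
    have "(8::real) ^ CARD('n) = 4 ^ CARD('n) * 2 ^ CARD('n)"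
      by (simp flip: power_mult_distrib)
    moreover have "(2 * CARD('n) * H) ^ (?M + 2) = (2 * CARD('n)) ^ (?M + 2) * H ^ ?M * H\<^sup>2"
      unfolding power_mult_distrib[of _ H] power_add[of H] by (simp only: mult.assoc of_nat_power)
    ultimately show ?thesis
      using \<eta> H unfolding sum_constant card_near power_mult_distrib[of \<eta> H]
      by (simp only: of_nat_power of_nat_numeral of_nat_mult[of "8 ^ _"]) (simp del: power_Suc power_Suc2 power_add add_2_eq_Suc' of_nat_mult)
  qed
  also have "\<dots> \<le> Cint * B * H\<^sup>2"
  proof -
    have "(2 * real CARD('n)) ^ (?M + 2) \<le> (2 * real CARD('n)) ^ 4"
    proof (rule power_increasing)
      have "1 \<le> real CARD('n)"
        by (simp add: Suc_leI)
      then show "1 \<le> 2 * real CARD('n)"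
        by linarith
    qed (use js in simp)
    then have "8 ^ CARD('n) * (2 * CARD('n)) ^ (?M + 2) / \<eta> ^ ?M \<le> Cint"
      unfolding Cint_def using \<eta> js by (intro frac_le mult_left_mono power_decreasing) auto
    then show ?thesis
      using B by (intro mult_right_mono) auto
  qed
  finally show ?thesis .
qed

lemma smooth_bdd_interp_error:
  assumes "N \<le> 2" and f: "smooth_bdd (N + 2) B f"
    and f3: "N = 2 \<Longrightarrow> smooth_bdd 3 B' f"
    and K: "finite K" "\<And>k. k \<notin> K \<Longrightarrow> f (grid_point h k) = 0"
  shows "smooth_bdd N (Cint * B * H\<^sup>2) (\<lambda>x. (\<Sum>k\<in>K. f (grid_point h k) * basis_deriv h (\<lambda>_. 0) k x) - f x)"
proof -
  let ?P = "\<lambda>x. \<Sum>k\<in>K. f (grid_point h k) * basis_deriv h (\<lambda>_. 0) k x"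
  obtain B1 where P: "smooth_bdd N B1 ?P"
    using smooth_bdd_sum_basis[OF K(1) \<open>N \<le> 2\<close>, of "\<lambda>k. f (grid_point h k)"] by blast
  have d: "iter_partial is ?P differentiable (at x)" "iter_partial is f differentiable (at x)"
    if "length is < N" for "is" x
    using P f that by (auto simp: smooth_bdd_def)
  have eq: "iter_partial is (\<lambda>x. ?P x - f x) = (\<lambda>x. iter_partial is ?P x - iter_partial is f x)"
    if "length is \<le> N" for "is"
    using iter_partial_linear_combination[of UNIV N "\<lambda>b. if b then ?P else f" "is" "\<lambda>b. if b then 1 else -1"]
      d that by (simp add: UNIV_bool)
  show ?thesis
    unfolding smooth_bdd_def
    using d interp_error[OF _ _ f3 K] f \<open>N \<le> 2\<close> by (auto simp: eq intro!: differentiable_diff)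
qed

text \<open>First derivatives of the basis functions sum to zero at each point, so
  \<open>z x\<close> can be subtracted from the nodal values. This version for merely Lipschitz data
  serves the error of the discrete divergence, of which nothing more than a Lipschitz constant is
  estimated.\<close>

lemma interp_lipschitz:
  assumes z: "\<And>x a. \<bar>z (x + a) - z x\<bar> \<le> L * l1 a" and L: "L \<ge> 0"
    and K: "finite K" "\<And>k. k \<notin> K \<Longrightarrow> z (grid_point h k) = 0"
  shows "smooth_bdd 1 (Cint * L) (\<lambda>x. \<Sum>k\<in>K. z (grid_point h k) * basis_deriv h (\<lambda>_. 0) k x)"
  unfolding smooth_bdd_def
proof (intro conjI allI impI)
  let ?P = "\<lambda>x. \<Sum>k\<in>K. z (grid_point h k) * basis_deriv h (\<lambda>_. 0) k x"
  fix "is" :: "'n list" and x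
  show "iter_partial is ?P differentiable at x" if "length is < 1"
    using that by (intro sum_basis_differentiable) simp
  assume len: "length is = 1"
  let ?b = "basis_deriv h (count_list is)"
  have "(\<Sum>k\<in>near x. ?b k x * monomial [] (grid_point h k - x)) = 0"
    using len by (subst moment_lists) (auto simp: fun_eq_iff length_Suc_conv split: if_splits)
  then have zero: "(\<Sum>k\<in>near x. ?b k x) = 0"
    by simp
  have "iter_partial is ?P x = (\<Sum>k\<in>near x. ?b k x * (z (x + (grid_point h k - x)) - z x))"
    using len by (subst iter_partial_sum_basis, simp, subst sum_near) (use K zero in
        \<open>simp_all add: count_list_le_2 right_diff_distrib sum_subtractf mult.commute flip: sum_distrib_left\<close>)
  also have "\<bar>\<dots>\<bar> \<le> (\<Sum>k\<in>near x. (2 ^ CARD('n) / (\<eta> * H)) * (L * (2 * CARD('n) * H)))"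
  proof (rule order_trans[OF sum_abs sum_mono])
    fix k assume k: "k \<in> near x"
    have "\<bar>z (x + (grid_point h k - x)) - z x\<bar> \<le> L * (2 * CARD('n) * H)"
      using z[of x "grid_point h k - x"] mult_left_mono[OF l1_near[OF k] L] by linarith
    then show "\<bar>?b k x * (z (x + (grid_point h k - x)) - z x)\<bar>
        \<le> (2 ^ CARD('n) / (\<eta> * H)) * (L * (2 * CARD('n) * H))"
      unfolding abs_mult using \<eta> H len basis_deriv_abs_le[of "is" k x] by (intro mult_mono) auto
  qed
  also have "\<dots> = 8 ^ CARD('n) * (2 * CARD('n)) / \<eta> * L"
  proof -
    have "(8::real) ^ CARD('n) = 4 ^ CARD('n) * 2 ^ CARD('n)"
      by (simp flip: power_mult_distrib)
    then show ?thesis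
      using \<eta> H by (simp add: card_near)
  qed
  also have "\<dots> \<le> Cint * L"
  proof -
    have "1 \<le> real CARD('n)"
      by (simp add: Suc_leI)
    then have "(2 * real CARD('n)) ^ 1 \<le> (2 * real CARD('n)) ^ 4"
      by (intro power_increasing) linarith+
    moreover have "\<eta>\<^sup>2 \<le> \<eta> ^ 1"
      using \<eta> by (intro power_decreasing) auto
    ultimately have "8 ^ CARD('n) * (2 * CARD('n)) / \<eta> \<le> Cint"
      unfolding Cint_def using \<eta> by (intro frac_le mult_left_mono) auto
    then show ?thesis
      using L by (intro mult_right_mono)
  qed
  finally show "\<bar>iter_partial is ?P x\<bar> \<le> Cint * L" .
qed

end

subsection \<open>Invariance of Lebesgue measure\<close>

lemma nn_integral_lborel_affine_unit:
  fixes t :: "'a::euclidean_space" and c :: real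
  assumes "\<bar>c\<bar> = 1" and [measurable]: "g \<in> borel_measurable borel"
  shows "(\<integral>\<^sup>+x. g (t + c *\<^sub>R x) \<partial>lborel) = (\<integral>\<^sup>+x. g x \<partial>lborel)"
proof -
  have "c \<noteq> 0"
    using assms by auto
  have "(\<integral>\<^sup>+x. g x \<partial>lborel) = (\<integral>\<^sup>+x. g x \<partial>density (distr lborel borel (\<lambda>x. t + c *\<^sub>R x)) (\<lambda>_. \<bar>c\<bar>^DIM('a)))"
    using lborel_affine[OF \<open>c \<noteq> 0\<close>, of t] by simp
  also have "\<dots> = (\<integral>\<^sup>+x. g (t + c *\<^sub>R x) \<partial>lborel)"
    using assms by (simp add: nn_integral_density nn_integral_distr)
  finally show ?thesis ..
qed

text \<open>The uniqueness argument for Haar measure. The unit ball is preserved by \<open>f\<close>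
  and has finite nonzero volume; a double integral over the ball and \<open>A\<close>, rearranged by
  translations and Fubini, equals both products, and the volume of the ball cancels.\<close>

lemma lborel_distr_orthogonal:
  fixes f :: "'a::euclidean_space \<Rightarrow> 'a"
  assumes f: "orthogonal_transformation f"
  shows "distr lborel borel f = lborel"
proof (rule measure_eqI)
  have lin: "linear f"
    using f orthogonal_transformation_linear by blast
  have [measurable]: "f \<in> borel_measurable borel"
    using lin by (intro borel_measurable_continuous_onI linear_continuous_on linear_linear[THEN iffD2])
  obtain g where g: "\<And>y. f (g y) = y"
    using orthogonal_transformation_surj[OF f] by (metis surjD)
  let ?I = "\<lambda>S x. indicator S x :: ennreal" and ?B = "ball (0::'a) 1"
  fix A :: "'a set" assume "A \<in> sets (distr lborel borel f)"
  then have [measurable]: "A \<in> sets borel"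
    by simp
  have [measurable]: "?B \<in> sets borel"
    by simp
  have A: "emeasure (distr lborel borel f) A = (\<integral>\<^sup>+z. ?I A (f z) \<partial>lborel)"
    using nn_integral_distr[of f lborel borel "?I A"] by simp
  have fB: "?I ?B (f z) = ?I ?B z" for z
    using orthogonal_transformation_norm[OF f, of z] by (simp add: indicator_def)
  have "emeasure lborel ?B * emeasure (distr lborel borel f) A
      = (\<integral>\<^sup>+z. (\<integral>\<^sup>+y. ?I A (f z) * ?I ?B y \<partial>lborel) \<partial>lborel)"
    unfolding A by (simp add: nn_integral_cmult nn_integral_multc mult.commute)
  also have "\<dots> = (\<integral>\<^sup>+z. (\<integral>\<^sup>+y. ?I A (f z) * ?I ?B (f z + y) \<partial>lborel) \<partial>lborel)"
  proof (rule nn_integral_cong)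
    fix z
    show "(\<integral>\<^sup>+y. ?I A (f z) * ?I ?B y \<partial>lborel) = (\<integral>\<^sup>+y. ?I A (f z) * ?I ?B (f z + y) \<partial>lborel)"
      using nn_integral_lborel_affine_unit[of 1 "\<lambda>y. ?I A (f z) * ?I ?B y" "f z"] by simp
  qed
  also have "\<dots> = (\<integral>\<^sup>+y. (\<integral>\<^sup>+z. ?I A (f z) * ?I ?B (f z + y) \<partial>lborel) \<partial>lborel)"
    by (rule lborel_pair.Fubini') measurable
  also have "\<dots> = (\<integral>\<^sup>+y. (\<integral>\<^sup>+z. ?I A (f z - y) * ?I ?B (f z) \<partial>lborel) \<partial>lborel)"
  proof (rule nn_integral_cong)
    fix y
    have "f (- g y + z) = f z - y" for z
      using g[of y] linear_diff[OF lin, of z "g y"] by simp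
    then show "(\<integral>\<^sup>+z. ?I A (f z) * ?I ?B (f z + y) \<partial>lborel) = (\<integral>\<^sup>+z. ?I A (f z - y) * ?I ?B (f z) \<partial>lborel)"
      using nn_integral_lborel_affine_unit[of 1 "\<lambda>z. ?I A (f z) * ?I ?B (f z + y)" "- g y"] by simp
  qed
  also have "\<dots> = (\<integral>\<^sup>+z. (\<integral>\<^sup>+y. ?I A (f z - y) * ?I ?B (f z) \<partial>lborel) \<partial>lborel)"
    by (rule lborel_pair.Fubini') measurable
  also have "\<dots> = (\<integral>\<^sup>+z. emeasure lborel A * ?I ?B z \<partial>lborel)"
  proof (rule nn_integral_cong)
    fix z
    show "(\<integral>\<^sup>+y. ?I A (f z - y) * ?I ?B (f z) \<partial>lborel) = emeasure lborel A * ?I ?B z"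
      \<comment> \<open>The substitution sends y to f z - y; this reflection is the reason for
        admitting a factor of modulus 1 in the affine lemma.\<close>
      using nn_integral_lborel_affine_unit[of "-1" "\<lambda>y. ?I A y" "f z"]
      by (simp add: nn_integral_multc fB)
  qed
  also have "\<dots> = emeasure lborel ?B * emeasure lborel A"
    by (simp add: nn_integral_cmult mult.commute)
  finally have eq: "emeasure lborel ?B * emeasure (distr lborel borel f) A = emeasure lborel ?B * emeasure lborel A" .
  have "emeasure lborel ?B \<noteq> 0"
  proof -
    have "ball (0::'a) 1 \<notin> null_sets lborel"
      using open_not_negligible[of "ball (0::'a) 1"]
      by (auto simp: negligible_iff_null_sets null_sets_completionI)
    then show ?thesis
      by (auto simp: null_sets_def)
  qed
  moreover have "emeasure lborel ?B < \<infinity>"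
    using emeasure_bounded_finite[of ?B] by simp
  ultimately show "emeasure (distr lborel borel f) A = emeasure lborel A"
    using eq by (auto simp: ennreal_mult_cancel_left)
qed simp

lemma integral_orthogonal:
  fixes F :: "'a::euclidean_space \<Rightarrow> real" and f :: "'a \<Rightarrow> 'a"
  assumes "orthogonal_transformation f" "F \<in> borel_measurable borel"
  shows "(\<integral>s. F (f s) \<partial>lborel) = (\<integral>s. F s \<partial>lborel)"
proof -
  have "linear f"
    using assms orthogonal_transformation_linear by blast
  then have "f \<in> borel_measurable borel"
    by (intro borel_measurable_continuous_onI linear_continuous_on linear_linear[THEN iffD2])
  then have "(\<integral>s. F s \<partial>distr lborel borel f) = (\<integral>s. F (f s) \<partial>lborel)"
    using assms by (intro integral_distr) auto
  then show ?thesis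
    by (simp only: lborel_distr_orthogonal[OF assms(1)])
qed

text \<open>The amount \<open>a v\<close> is moved from the square of coordinate \<open>q\<close> to
  that of coordinate \<open>p\<close>, so the norm is unchanged. Sign changes, transpositions and
  the diagonal reflection below all have this form.\<close>

lemma orthogonal_transformation_two_coordinates:
  fixes f :: "real^'n::finite \<Rightarrow> real^'n"
  assumes "linear f"
    and "\<And>v i. (f v $ i)\<^sup>2 = (v $ i)\<^sup>2 + (if i = p then a v else 0) - (if i = q then a v else 0)"
  shows "orthogonal_transformation f"
proof -
  have "f v \<bullet> f v = v \<bullet> v" for v
    using assms(2) by (simp add: inner_vec_def power2_eq_square sum.distrib sum_subtractf)
  then show ?thesis
    using assms(1) by (simp add: orthogonal_transformation norm_eq)
qed

subsection \<open>Radial kernels\<close>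

text \<open>Only the second moment is finite; \<kappa> itself may have a non-integrable singularity
  at 0. Every integrand below must therefore be O(|s|^2) near the origin, possibly after
  symmetrisation.\<close>

locale radial_kernel =
  fixes \<kappa> :: "real^'n::finite \<Rightarrow> real" and \<delta> :: real
  assumes \<delta>: "\<delta> > 0"
    and \<kappa>_nonneg: "\<kappa> s \<ge> 0"
    and \<kappa>_radial: "norm s = norm t \<Longrightarrow> \<kappa> s = \<kappa> t"
    and \<kappa>_support: "norm s \<ge> \<delta> \<Longrightarrow> \<kappa> s = 0"
    and \<kappa>_measurable [measurable]: "\<kappa> \<in> borel_measurable borel"
    and \<kappa>_integrable: "integrable lborel (\<lambda>s. \<kappa> s * (norm s)\<^sup>2)"
    and \<kappa>_moment: "(\<integral>s. \<kappa> s * (norm s)\<^sup>2 \<partial>lborel) = CARD('n)"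
begin

lemma kernel_integrable:
  assumes [measurable]: "F \<in> borel_measurable borel"
    and F: "\<And>s. norm s < \<delta> \<Longrightarrow> \<bar>F s\<bar> \<le> C * (norm s)\<^sup>2"
  shows "integrable lborel (\<lambda>s. \<kappa> s * F s)" "\<bar>\<integral>s. \<kappa> s * F s \<partial>lborel\<bar> \<le> C * CARD('n)"
proof -
  have le: "norm (\<kappa> s * F s) \<le> C * (\<kappa> s * (norm s)\<^sup>2)" for s
  proof (cases "norm s < \<delta>")
    case True
    then have "\<kappa> s * \<bar>F s\<bar> \<le> \<kappa> s * (C * (norm s)\<^sup>2)"
      by (intro mult_left_mono F \<kappa>_nonneg)
    then show ?thesis
      by (simp add: abs_mult \<kappa>_nonneg mult_ac)
  qed (simp add: \<kappa>_support)
  have i: "integrable lborel (\<lambda>s. C * (\<kappa> s * (norm s)\<^sup>2))"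
    using \<kappa>_integrable by simp
  show *: "integrable lborel (\<lambda>s. \<kappa> s * F s)"
    by (rule Bochner_Integration.integrable_bound[OF i])
      (measurable, intro AE_I2 order_trans[OF le], simp)
  have "norm (\<integral>s. \<kappa> s * F s \<partial>lborel) \<le> (\<integral>s. C * (\<kappa> s * (norm s)\<^sup>2) \<partial>lborel)"
    by (rule Bochner_Integration.integral_norm_bound_integral[OF * i le])
  also have "\<dots> = C * CARD('n)"
    using \<kappa>_moment by simp
  finally show "\<bar>\<integral>s. \<kappa> s * F s \<partial>lborel\<bar> \<le> C * CARD('n)"
    by simp
qed

lemma kernel_orthogonal:
  assumes "orthogonal_transformation f" and [measurable]: "F \<in> borel_measurable borel"
  shows "(\<integral>s. \<kappa> s * F (f s) \<partial>lborel) = (\<integral>s. \<kappa> s * F s \<partial>lborel)"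
proof -
  have "\<kappa> (f s) = \<kappa> s" for s
    by (intro \<kappa>_radial orthogonal_transformation_norm assms)
  then show ?thesis
    using integral_orthogonal[OF assms(1), of "\<lambda>s. \<kappa> s * F s"] by simp
qed

lemma kernel_minus:
  assumes "F \<in> borel_measurable borel"
  shows "(\<integral>s. \<kappa> s * F (- s) \<partial>lborel) = (\<integral>s. \<kappa> s * F s \<partial>lborel)"
  using kernel_orthogonal[OF _ assms, of uminus]
  by (simp add: orthogonal_transformation_def linear_uminus)

lemma kernel_odd:
  assumes "F \<in> borel_measurable borel" "\<And>s. F (- s) = - F s"
  shows "(\<integral>s. \<kappa> s * F s \<partial>lborel) = 0"
  using kernel_minus[OF assms(1)] by (simp add: assms(2))

section \<open>Orthogonal symmetries and the moments of the kernel\<close>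

definition flip :: "'n \<Rightarrow> real^'n \<Rightarrow> real^'n" where
  "flip p v = (\<chi> i. if i = p then - v $ i else v $ i)"

lemma orthogonal_flip: "orthogonal_transformation (flip p)"
  by (rule orthogonal_transformation_two_coordinates[where a = "\<lambda>_. 0"])
    (auto simp: flip_def linear_iff vec_eq_iff)

definition swap :: "'n \<Rightarrow> 'n \<Rightarrow> real^'n \<Rightarrow> real^'n" where
  "swap p q v = (\<chi> i. if i = p then v $ q else if i = q then v $ p else v $ i)"

lemma orthogonal_swap: "orthogonal_transformation (swap p q)"
  by (rule orthogonal_transformation_two_coordinates[where a = "\<lambda>v. (v $ q)\<^sup>2 - (v $ p)\<^sup>2" and p = p and q = q])
    (auto simp: swap_def linear_iff vec_eq_iff)

text \<open>In the plane of \<open>p\<close> and \<open>q\<close> this is the matrix with rows (1,1)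
  and (1,-1) over sqrt 2. It turns the product of the two coordinates into half the difference of
  their squares.\<close>

definition rotation :: "'n \<Rightarrow> 'n \<Rightarrow> real^'n \<Rightarrow> real^'n" where
  "rotation p q v = (\<chi> i. if i = p then (v $ p + v $ q) / sqrt 2 else if i = q then (v $ p - v $ q) / sqrt 2 else v $ i)"

lemma orthogonal_rotation: "p \<noteq> q \<Longrightarrow> orthogonal_transformation (rotation p q)"
  by (rule orthogonal_transformation_two_coordinates[where p = p and q = q
        and a = "\<lambda>v. (v $ p + v $ q)\<^sup>2 / 2 - (v $ p)\<^sup>2"])
    (auto simp: rotation_def linear_iff vec_eq_iff power_divide power2_eq_square field_simps)

lemma component_mult_le: "\<bar>s $ p * s $ q\<bar> \<le> (norm s)\<^sup>2" for s :: "real^'n"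
  unfolding abs_mult power2_eq_square by (intro mult_mono component_le_norm_cart) auto

lemma second_moment_integrable: "integrable lborel (\<lambda>s. \<kappa> s * (s $ p * s $ q))"
  by (rule kernel_integrable(1)[where C = 1]) (auto simp: component_mult_le)

text \<open>Changing the sign of one coordinate kills the off-diagonal entries, transpositions make
  the diagonal entries equal, and their sum is the prescribed moment d.\<close>

lemma second_moment: "(\<integral>s. \<kappa> s * (s $ p * s $ q) \<partial>lborel) = (if p = q then 1 else 0)"
proof (cases "p = q")
  case False
  have "(\<integral>s. \<kappa> s * (flip p s $ p * flip p s $ q) \<partial>lborel) = (\<integral>s. \<kappa> s * (s $ p * s $ q) \<partial>lborel)"
    by (rule kernel_orthogonal[OF orthogonal_flip]) measurable
  then show ?thesis
    using False by (simp add: flip_def)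
next
  case True
  have eq: "(\<integral>s. \<kappa> s * (s $ i * s $ i) \<partial>lborel) = (\<integral>s. \<kappa> s * (s $ p * s $ p) \<partial>lborel)" for i
    using kernel_orthogonal[OF orthogonal_swap[of p i], of "\<lambda>s. s $ p * s $ p"] by (simp add: swap_def)
  have "real CARD('n) = (\<integral>s. (\<Sum>i\<in>UNIV. \<kappa> s * (s $ i * s $ i)) \<partial>lborel)"
    using \<kappa>_moment by (simp add: power2_norm_eq_inner inner_vec_def sum_distrib_left)
  also have "\<dots> = (\<Sum>i\<in>UNIV. (\<integral>s. \<kappa> s * (s $ i * s $ i) \<partial>lborel))"
    by (intro Bochner_Integration.integral_sum second_moment_integrable)
  also have "\<dots> = real CARD('n) * (\<integral>s. \<kappa> s * (s $ p * s $ p) \<partial>lborel)"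
    by (subst sum.cong[OF refl eq]) simp
  finally show ?thesis
    using True by simp
qed

definition M4 :: "'n \<Rightarrow> 'n \<Rightarrow> 'n \<Rightarrow> 'n \<Rightarrow> real" where
  "M4 i j p q = (\<integral>s. \<kappa> s * (s $ i * s $ j * (s $ p * s $ q) / (norm s)\<^sup>2) \<partial>lborel)"

lemma M4_bound: "\<bar>s $ i * s $ j * (s $ p * s $ q) / (norm s)\<^sup>2\<bar> \<le> 1 * (norm s)\<^sup>2" for s :: "real^'n"
proof (cases "s = 0")
  case False
  have "\<bar>s $ i * s $ j\<bar> * \<bar>s $ p * s $ q\<bar> \<le> (norm s)\<^sup>2 * (norm s)\<^sup>2"
    by (intro mult_mono component_mult_le) auto
  then show ?thesis
    using False by (simp add: abs_mult divide_le_eq)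
qed simp

lemma M4_integrable: "integrable lborel (\<lambda>s. \<kappa> s * (s $ i * s $ j * (s $ p * s $ q) / (norm s)\<^sup>2))"
  by (rule kernel_integrable(1)[OF _ M4_bound]) measurable

lemma M4_orthogonal:
  assumes "orthogonal_transformation f"
  shows "M4 i j p q = (\<integral>s. \<kappa> s * (f s $ i * f s $ j * (f s $ p * f s $ q) / (norm s)\<^sup>2) \<partial>lborel)"
  using kernel_orthogonal[OF assms, of "\<lambda>s. s $ i * s $ j * (s $ p * s $ q) / (norm s)\<^sup>2"]
  by (simp add: M4_def orthogonal_transformation_norm[OF assms])

lemma M4_odd:
  assumes "odd (count_list [i, j, p, q] a)"
  shows "M4 i j p q = 0"
proof -
  have "flip a s $ i * flip a s $ j * (flip a s $ p * flip a s $ q) = - (s $ i * s $ j * (s $ p * s $ q))" for s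
    using assms by (auto simp: flip_def split: if_splits)
  then show ?thesis
    using M4_orthogonal[OF orthogonal_flip[of a], of i j p q] by (simp add: M4_def)
qed

lemma M4_diag_eq: "M4 i i i i = M4 p p p p"
  using M4_orthogonal[OF orthogonal_swap[of p i], of p p p p] by (simp add: M4_def swap_def)

text \<open>Invariance under \<open>rotation\<close> gives 4 M(p,p,q,q) = M(p,p,p,p) + M(q,q,q,q) -
  2 M(p,p,q,q), and the two pure moments agree.\<close>

lemma M4_mixed: "3 * M4 p p q q = M4 p p p p" if "p \<noteq> q"
proof -
  have *: "s $ p * s $ p * (s $ p * s $ p) + s $ q * s $ q * (s $ q * s $ q) - 2 * (s $ p * s $ p * (s $ q * s $ q))
      = 4 * (rotation p q s $ p * rotation p q s $ p * (rotation p q s $ q * rotation p q s $ q))" for s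
    using that by (simp add: rotation_def field_simps)
  then have "4 * M4 p p q q = (\<integral>s. \<kappa> s * (s $ p * s $ p * (s $ p * s $ p) / (norm s)\<^sup>2)
      + \<kappa> s * (s $ q * s $ q * (s $ q * s $ q) / (norm s)\<^sup>2)
      - 2 * (\<kappa> s * (s $ p * s $ p * (s $ q * s $ q) / (norm s)\<^sup>2)) \<partial>lborel)"
    unfolding M4_orthogonal[OF orthogonal_rotation[OF that], of p p q q] integral_mult_right_zero[symmetric]
  proof (intro Bochner_Integration.integral_cong refl)
    fix s
    have "4 * (\<kappa> s * (r / N)) = \<kappa> s * (a / N) + \<kappa> s * (b / N) - 2 * (\<kappa> s * (c / N))"
      if "a + b - 2 * c = 4 * r" for a b c r N :: real
    proof -
      have "4 * (\<kappa> s * (r / N)) = \<kappa> s * ((4 * r) / N)"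
        by simp
      then show ?thesis
        unfolding that[symmetric] by (simp add: add_divide_distrib diff_divide_distrib right_diff_distrib distrib_left)
    qed
    from this[OF *[of s]] show "4 * (\<kappa> s * (rotation p q s $ p * rotation p q s $ p
          * (rotation p q s $ q * rotation p q s $ q) / (norm s)\<^sup>2))
      = \<kappa> s * (s $ p * s $ p * (s $ p * s $ p) / (norm s)\<^sup>2)
      + \<kappa> s * (s $ q * s $ q * (s $ q * s $ q) / (norm s)\<^sup>2)
      - 2 * (\<kappa> s * (s $ p * s $ p * (s $ q * s $ q) / (norm s)\<^sup>2))" .
  qed
  also have "\<dots> = M4 p p p p + M4 q q q q - 2 * M4 p p q q"
    unfolding M4_def
    by (subst Bochner_Integration.integral_diff, intro Bochner_Integration.integrable_add M4_integrable,
        intro integrable_mult_right M4_integrable, subst Bochner_Integration.integral_add)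
      (rule M4_integrable, rule M4_integrable, simp only: integral_mult_right_zero)
  finally show ?thesis
    using M4_diag_eq[of q p] by simp
qed

text \<open>Summing over \<open>q\<close> cancels the division by |s|^2 and leaves a second moment,
  which is 1. By \<open>M4_mixed\<close> the sum is M(p,p,p,p) (1 + (d - 1)/3).\<close>

lemma M4_diag: "M4 p p p p = 3 / (CARD('n) + 2)"
proof -
  have "1 = (\<integral>s. (\<Sum>q\<in>UNIV. \<kappa> s * (s $ p * s $ p * (s $ q * s $ q) / (norm s)\<^sup>2)) \<partial>lborel)"
  proof -
    have "(\<Sum>q\<in>UNIV. \<kappa> s * (s $ p * s $ p * (s $ q * s $ q) / (norm s)\<^sup>2)) = \<kappa> s * (s $ p * s $ p)" for s
    proof -
      have "(\<Sum>q\<in>UNIV. \<kappa> s * (s $ p * s $ p * (s $ q * s $ q) / (norm s)\<^sup>2))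
          = \<kappa> s * (s $ p * s $ p) * ((\<Sum>q\<in>UNIV. s $ q * s $ q) / (norm s)\<^sup>2)"
        by (simp add: sum_distrib_left sum_divide_distrib mult_ac)
      also have "(\<Sum>q\<in>UNIV. s $ q * s $ q) = (norm s)\<^sup>2"
        by (simp add: power2_norm_eq_inner inner_vec_def)
      finally show ?thesis
        by (cases "s = 0") simp_all
    qed
    then show ?thesis
      using second_moment[of p p] by simp
  qed
  also have "\<dots> = (\<Sum>q\<in>UNIV. M4 p p q q)"
    unfolding M4_def by (intro Bochner_Integration.integral_sum M4_integrable)
  also have "\<dots> = (\<Sum>q\<in>UNIV. M4 p p p p / 3 + (if q = p then 2 / 3 * M4 p p p p else 0))"
  proof (intro sum.cong refl)
    fix q
    show "M4 p p q q = M4 p p p p / 3 + (if q = p then 2 / 3 * M4 p p p p else 0)"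
      using M4_mixed[of p q] by (cases "q = p") auto
  qed
  also have "\<dots> = CARD('n) * (M4 p p p p / 3) + 2 / 3 * M4 p p p p"
    by (simp add: sum.distrib)
  finally show ?thesis
    by (simp add: field_simps)
qed

text \<open>The isotropic tensor of rank four. Either the indices pair off or some index occurs an
  odd number of times, and then a sign change makes the moment vanish.\<close>

lemma fourth_moment:
  "M4 i j p q = ((if i = j \<and> p = q then 1 else 0) + (if i = p \<and> j = q then 1 else 0)
     + (if i = q \<and> j = p then 1 else 0)) / (CARD('n) + 2)"
proof -
  consider (1) "i = j" "p = q" "i = p" | (2) "i = j" "p = q" "i \<noteq> p" | (3) "i = p" "j = q" "i \<noteq> j"
    | (4) "i = q" "j = p" "i \<noteq> j" | (5) "\<exists>a. odd (count_list [i, j, p, q] a)"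
      "\<not> (i = j \<and> p = q)" "\<not> (i = p \<and> j = q)" "\<not> (i = q \<and> j = p)"
  proof -
    have "odd (count_list [i, j, p, q] i) \<or> odd (count_list [i, j, p, q] j) \<or> odd (count_list [i, j, p, q] p)"
      if "\<not> (i = j \<and> p = q)" "\<not> (i = p \<and> j = q)" "\<not> (i = q \<and> j = p)"
      using that by (cases "i = j"; cases "i = p"; cases "i = q"; cases "j = p"; cases "j = q"; cases "p = q") simp_all
    then show thesis
      using that by blast
  qed
  then show ?thesis
  proof cases
    case 1
    then show ?thesis by (simp add: M4_diag)
  next
    case 2
    then show ?thesis using M4_mixed[of i p] by (simp add: M4_diag field_simps)
  next
    case 3
    then have "M4 i j p q = M4 i i j j"
      by (simp add: M4_def mult_ac)
    then show ?thesis using 3 M4_mixed[of i j] by (simp add: M4_diag field_simps)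
  next
    case 4
    then have "M4 i j p q = M4 i i j j"
      by (simp add: M4_def mult_ac)
    then show ?thesis using 4 M4_mixed[of i j] by (simp add: M4_diag field_simps)
  next
    case 5
    then have "M4 i j p q = 0"
      using M4_odd by blast
    moreover have "(i = j \<and> p = q) = False" "(i = p \<and> j = q) = False" "(i = q \<and> j = p) = False"
      using 5(2-4) by blast+
    ultimately show ?thesis
      by (simp only:) simp
  qed
qed

end

subsection \<open>Difference operators weighted by a radial kernel\<close>

lemma l1_minus [simp]: "l1 (- s) = l1 s"
  by (simp add: l1_def)

lemma l1_le_power: "l1 (s::real^'n::finite) ^ m \<le> CARD('n) ^ m * norm s ^ m"
  using power_mono[OF l1_le, of s m] by (simp add: power_mult_distrib)

lemma smooth_bdd_measurable:
  assumes "smooth_bdd N B f" "N > 0"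
  shows "f \<in> borel_measurable borel"
  using smooth_bdd_continuous_on[OF assms] by (rule borel_measurable_continuous_onI)

lemma second_difference_bound:
  fixes f :: "real^'n::finite \<Rightarrow> real"
  assumes "smooth_bdd 2 B f"
  shows "\<bar>f (x + s) + f (x - s) - 2 * f x\<bar> \<le> B * (l1 s)\<^sup>2"
  using smooth_bdd_second_difference[OF assms, of x s "- s"] by (simp add: power2_eq_square)

context radial_kernel
begin

text \<open>The common building block of the two first-order operators: the nonlocal divergence is
  the sum of \<open>S i\<close> over the components, and the nonlocal gradient has the entries
  \<open>S i\<close>.\<close>

definition S :: "'n \<Rightarrow> (real^'n \<Rightarrow> real) \<Rightarrow> real^'n \<Rightarrow> real" where
  "S i f x = (\<integral>s. \<kappa> s * (s $ i * (f (x + s) - f x)) \<partial>lborel)"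

text \<open>An entry of the bond operator, symmetrised in \<open>\<plusminus>s\<close>: the integrand is then \<open>O(\<kappa>(s) |s|\<^sup>2)\<close> and the
  principal value becomes an absolutely convergent integral.\<close>

definition Bo :: "'n \<Rightarrow> 'n \<Rightarrow> (real^'n \<Rightarrow> real) \<Rightarrow> real^'n \<Rightarrow> real" where
  "Bo i j f x = (\<integral>s. \<kappa> s * (s $ i * s $ j / (norm s)\<^sup>2 * (f (x + s) + f (x - s) - 2 * f x)) \<partial>lborel) / 2"

lemma
  assumes [measurable]: "f \<in> borel_measurable borel" and f: "\<And>s. \<bar>f (x + s) - f x\<bar> \<le> L * l1 s" and L: "L \<ge> 0"
  shows S_integrable: "integrable lborel (\<lambda>s. \<kappa> s * (s $ i * (f (x + s) - f x)))"
    and S_bound: "\<bar>S i f x\<bar> \<le> L * CARD('n)\<^sup>2"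
proof -
  have *: "\<bar>s $ i * (f (x + s) - f x)\<bar> \<le> L * CARD('n) * (norm s)\<^sup>2" for s
  proof -
    have "\<bar>s $ i\<bar> * \<bar>f (x + s) - f x\<bar> \<le> norm s * (L * (CARD('n) * norm s))"
      by (intro mult_mono component_le_norm_cart order_trans[OF f] mult_left_mono l1_le L) auto
    then show ?thesis
      by (simp add: abs_mult power2_eq_square mult_ac)
  qed
  have [measurable]: "(\<lambda>s. s $ i * (f (x + s) - f x)) \<in> borel_measurable borel"
    by measurable
  show "integrable lborel (\<lambda>s. \<kappa> s * (s $ i * (f (x + s) - f x)))"
    by (rule kernel_integrable(1)[OF _ *]) measurable
  have "\<bar>\<integral>s. \<kappa> s * (s $ i * (f (x + s) - f x)) \<partial>lborel\<bar> \<le> L * CARD('n) * CARD('n)"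
    by (rule kernel_integrable(2)[OF _ *]) measurable
  then show "\<bar>S i f x\<bar> \<le> L * CARD('n)\<^sup>2"
    by (simp add: S_def power2_eq_square mult_ac)
qed

lemma S_integrable': "smooth_bdd 1 L f \<Longrightarrow> integrable lborel (\<lambda>s. \<kappa> s * (s $ i * (f (x + s) - f x)))"
  by (rule S_integrable[of _ _ L])
    (auto intro: smooth_bdd_measurable smooth_bdd_lipschitz simp: smooth_bdd_nonneg)

lemma S_bound': "smooth_bdd 1 L f \<Longrightarrow> \<bar>S i f x\<bar> \<le> L * CARD('n)\<^sup>2"
  by (rule S_bound) (auto intro: smooth_bdd_measurable smooth_bdd_lipschitz simp: smooth_bdd_nonneg)

lemma S_diff:
  assumes "smooth_bdd 1 L f" "smooth_bdd 1 L' g"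
  shows "S i (\<lambda>x. f x - g x) x = S i f x - S i g x"
  unfolding S_def using S_integrable'[OF assms(1), of i x] S_integrable'[OF assms(2), of i x]
  by (subst Bochner_Integration.integral_diff[symmetric]) (simp_all add: algebra_simps)

lemma S_shift: "S i (\<lambda>x. f (x + a)) x = S i f (x + a)"
  by (simp add: S_def add.commute add.left_commute)

lemma S_sum:
  assumes "\<And>k. k \<in> K \<Longrightarrow> smooth_bdd 1 (L k) (f k)"
  shows "S i (\<lambda>x. \<Sum>k\<in>K. c k * f k x) x = (\<Sum>k\<in>K. c k * S i (f k) x)"
proof -
  have "(\<Sum>k\<in>K. c k * S i (f k) x) = (\<integral>s. (\<Sum>k\<in>K. c k * (\<kappa> s * (s $ i * (f k (x + s) - f k x)))) \<partial>lborel)"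
    unfolding S_def using S_integrable'[OF assms] by (subst Bochner_Integration.integral_sum) auto
  also have "\<dots> = S i (\<lambda>x. \<Sum>k\<in>K. c k * f k x) x"
    unfolding S_def
    by (intro Bochner_Integration.integral_cong refl) (simp add: sum_distrib_left sum_subtractf right_diff_distrib mult_ac)
  finally show ?thesis ..
qed

text \<open>After multiplication by \<open>s $ i\<close>, the linear Taylor term integrates to the
  partial derivative by \<open>second_moment\<close> and the quadratic one is odd. The remainder is
  O(|s|^4), and two of these factors are at most \<delta>.\<close>

lemma S_consistency:
  assumes f: "smooth_bdd 3 B f"
  shows "\<bar>S i f x - partial_deriv i f x\<bar> \<le> B * CARD('n) ^ 4 * \<delta>\<^sup>2"
proof -
  have [measurable]: "f \<in> borel_measurable borel"
    using f by (rule smooth_bdd_measurable) simp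
  have B: "B \<ge> 0"
    using f by (rule smooth_bdd_nonneg)
  let ?T1 = "\<lambda>s. \<Sum>p\<in>UNIV. partial_deriv p f x * s $ p"
  let ?T2 = "\<lambda>s. (\<Sum>p\<in>UNIV. \<Sum>q\<in>UNIV. iter_partial [p, q] f x * (s $ p * s $ q)) / 2"
  let ?R = "\<lambda>s. f (x + s) - f x - ?T1 s - ?T2 s"
  have R: "\<bar>?R s\<bar> \<le> B * l1 s ^ 3" for s
  proof -
    have "\<bar>?R s\<bar> \<le> B * l1 s ^ 3 / fact 3"
      using taylor_smooth_bdd[OF f, of x s]
      by (simp add: numeral_3_eq_3 taylor_term_1 taylor_term_2[unfolded numeral_2_eq_2] diff_diff_eq)
    also have "\<dots> \<le> B * l1 s ^ 3 / 1"
      using B by (intro divide_left_mono fact_ge_1) auto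
    finally show ?thesis by simp
  qed
  have R': "\<bar>s $ i * ?R s\<bar> \<le> B * CARD('n) ^ 3 * \<delta>\<^sup>2 * (norm s)\<^sup>2" if "norm s < \<delta>" for s
  proof -
    have "\<bar>s $ i\<bar> * \<bar>?R s\<bar> \<le> norm s * (B * (CARD('n) ^ 3 * norm s ^ 3))"
      by (intro mult_mono component_le_norm_cart order_trans[OF R] mult_left_mono l1_le_power B) auto
    also have "\<dots> = B * CARD('n) ^ 3 * (norm s)\<^sup>2 * (norm s)\<^sup>2"
      by (simp add: power2_eq_square power3_eq_cube mult_ac)
    also have "\<dots> \<le> B * CARD('n) ^ 3 * \<delta>\<^sup>2 * (norm s)\<^sup>2"
      using that B \<delta> by (intro mult_right_mono mult_left_mono power_mono) auto
    finally show ?thesis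
      by (simp only: abs_mult)
  qed
  have iR: "integrable lborel (\<lambda>s. \<kappa> s * (s $ i * ?R s))"
    by (rule kernel_integrable(1)[OF _ R']) measurable
  have iT1: "integrable lborel (\<lambda>s. \<kappa> s * (s $ i * ?T1 s))"
  proof -
    have "integrable lborel (\<lambda>s. \<Sum>p\<in>UNIV. partial_deriv p f x * (\<kappa> s * (s $ i * s $ p)))"
      by (intro Bochner_Integration.integrable_sum integrable_mult_right second_moment_integrable)
    then show ?thesis
      by (simp add: sum_distrib_left mult_ac)
  qed
  have iT2: "integrable lborel (\<lambda>s. \<kappa> s * (s $ i * ?T2 s))"
  proof (rule kernel_integrable(1))
    fix s :: "real^'n" assume s: "norm s < \<delta>"
    have "\<bar>?T2 s\<bar> \<le> (\<Sum>p\<in>UNIV. \<Sum>q\<in>UNIV. \<bar>iter_partial [p, q] f x\<bar> * (norm s)\<^sup>2) / 2"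
    proof -
      have "\<bar>\<Sum>p\<in>UNIV. \<Sum>q\<in>UNIV. iter_partial [p, q] f x * (s $ p * s $ q)\<bar>
          \<le> (\<Sum>p\<in>UNIV. \<Sum>q\<in>UNIV. \<bar>iter_partial [p, q] f x\<bar> * (norm s)\<^sup>2)"
        by (intro order_trans[OF sum_abs] sum_mono)
          (simp only: abs_mult[of "iter_partial _ _ _"], intro mult_left_mono component_mult_le abs_ge_zero)
      then show ?thesis by simp
    qed
    then have "\<bar>s $ i\<bar> * \<bar>?T2 s\<bar> \<le> \<delta> * ((\<Sum>p\<in>UNIV. \<Sum>q\<in>UNIV. \<bar>iter_partial [p, q] f x\<bar> * (norm s)\<^sup>2) / 2)"
      using s component_le_norm_cart[of s i] \<delta> by (intro mult_mono) auto
    then show "\<bar>s $ i * ?T2 s\<bar> \<le> \<delta> * ((\<Sum>p\<in>UNIV. \<Sum>q\<in>UNIV. \<bar>iter_partial [p, q] f x\<bar>) / 2) * (norm s)\<^sup>2"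
      by (simp only: abs_mult[symmetric] sum_distrib_right[symmetric] times_divide_eq_left times_divide_eq_right mult.assoc)
  qed measurable
  have "S i f x = (\<integral>s. \<kappa> s * (s $ i * ?T1 s) + \<kappa> s * (s $ i * ?T2 s) + \<kappa> s * (s $ i * ?R s) \<partial>lborel)"
    unfolding S_def by (intro Bochner_Integration.integral_cong refl) (simp only: distrib_left[symmetric], simp)
  also have "\<dots> = (\<integral>s. \<kappa> s * (s $ i * ?T1 s) \<partial>lborel) + (\<integral>s. \<kappa> s * (s $ i * ?T2 s) \<partial>lborel)
      + (\<integral>s. \<kappa> s * (s $ i * ?R s) \<partial>lborel)"
    by (subst Bochner_Integration.integral_add, intro Bochner_Integration.integrable_add iT1 iT2, rule iR,
        subst Bochner_Integration.integral_add, rule iT1, rule iT2, rule refl)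
  also have "(\<integral>s. \<kappa> s * (s $ i * ?T2 s) \<partial>lborel) = 0"
    by (rule kernel_odd) simp_all
  also have "(\<integral>s. \<kappa> s * (s $ i * ?T1 s) \<partial>lborel) = partial_deriv i f x"
  proof -
    have "(\<integral>s. \<kappa> s * (s $ i * ?T1 s) \<partial>lborel)
        = (\<integral>s. (\<Sum>p\<in>UNIV. partial_deriv p f x * (\<kappa> s * (s $ i * s $ p))) \<partial>lborel)"
      by (simp add: sum_distrib_left mult_ac)
    also have "\<dots> = (\<Sum>p\<in>UNIV. partial_deriv p f x * (if i = p then 1 else 0))"
      by (subst Bochner_Integration.integral_sum, intro integrable_mult_right second_moment_integrable)
        (simp only: integral_mult_right_zero second_moment)
    finally show ?thesis
      by (simp add: if_distrib cong: if_cong)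
  qed
  finally have "S i f x - partial_deriv i f x = (\<integral>s. \<kappa> s * (s $ i * ?R s) \<partial>lborel)"
    by simp
  also have "\<bar>\<dots>\<bar> \<le> B * CARD('n) ^ 3 * \<delta>\<^sup>2 * CARD('n)"
    by (rule kernel_integrable(2)[OF _ R']) measurable
  also have "\<dots> = B * CARD('n) ^ 4 * \<delta>\<^sup>2"
    by (simp add: numeral_eq_Suc)
  finally show ?thesis .
qed

lemma
  assumes [measurable]: "f \<in> borel_measurable borel"
    and f: "\<And>s. \<bar>f (x + s) + f (x - s) - 2 * f x\<bar> \<le> B * (l1 s)\<^sup>2" and B: "B \<ge> 0"
  shows Bo_integrable: "integrable lborel (\<lambda>s. \<kappa> s * (s $ i * s $ j / (norm s)\<^sup>2 * (f (x + s) + f (x - s) - 2 * f x)))"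
    and Bo_bound: "\<bar>Bo i j f x\<bar> \<le> B * CARD('n) ^ 3"
proof -
  have *: "\<bar>s $ i * s $ j / (norm s)\<^sup>2 * (f (x + s) + f (x - s) - 2 * f x)\<bar> \<le> B * CARD('n)\<^sup>2 * (norm s)\<^sup>2" for s
  proof -
    have "\<bar>s $ i * s $ j / (norm s)\<^sup>2\<bar> \<le> 1"
      using component_mult_le[of s i j] by (cases "s = 0") (auto simp: abs_divide divide_le_eq)
    then have "\<bar>s $ i * s $ j / (norm s)\<^sup>2\<bar> * \<bar>f (x + s) + f (x - s) - 2 * f x\<bar> \<le> 1 * (B * (CARD('n)\<^sup>2 * (norm s)\<^sup>2))"
      by (intro mult_mono order_trans[OF f] mult_left_mono l1_le_power B) auto
    then show ?thesis
      by (simp only: abs_mult mult_1 mult.assoc)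
  qed
  show "integrable lborel (\<lambda>s. \<kappa> s * (s $ i * s $ j / (norm s)\<^sup>2 * (f (x + s) + f (x - s) - 2 * f x)))"
    by (rule kernel_integrable(1)[OF _ *]) measurable
  have "\<bar>\<integral>s. \<kappa> s * (s $ i * s $ j / (norm s)\<^sup>2 * (f (x + s) + f (x - s) - 2 * f x)) \<partial>lborel\<bar>
      \<le> B * CARD('n)\<^sup>2 * CARD('n)"
    by (rule kernel_integrable(2)[OF _ *]) measurable
  then show "\<bar>Bo i j f x\<bar> \<le> B * CARD('n) ^ 3"
    by (simp add: Bo_def power2_eq_square power3_eq_cube mult_ac)
qed

lemma Bo_integrable': "smooth_bdd 2 B f \<Longrightarrow>
    integrable lborel (\<lambda>s. \<kappa> s * (s $ i * s $ j / (norm s)\<^sup>2 * (f (x + s) + f (x - s) - 2 * f x)))"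
  by (rule Bo_integrable) (auto intro: smooth_bdd_measurable second_difference_bound smooth_bdd_nonneg)

lemma Bo_bound': "smooth_bdd 2 B f \<Longrightarrow> \<bar>Bo i j f x\<bar> \<le> B * CARD('n) ^ 3"
  by (rule Bo_bound) (auto intro: smooth_bdd_measurable second_difference_bound smooth_bdd_nonneg)

lemma Bo_diff:
  assumes "smooth_bdd 2 B f" "smooth_bdd 2 B' g"
  shows "Bo i j (\<lambda>x. f x - g x) x = Bo i j f x - Bo i j g x"
proof -
  have "(\<integral>s. \<kappa> s * (s $ i * s $ j / (norm s)\<^sup>2 * ((f (x + s) - g (x + s)) + (f (x - s) - g (x - s)) - 2 * (f x - g x))) \<partial>lborel)
    = (\<integral>s. \<kappa> s * (s $ i * s $ j / (norm s)\<^sup>2 * (f (x + s) + f (x - s) - 2 * f x))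
      - \<kappa> s * (s $ i * s $ j / (norm s)\<^sup>2 * (g (x + s) + g (x - s) - 2 * g x)) \<partial>lborel)"
    by (intro Bochner_Integration.integral_cong refl) (simp only: right_diff_distrib[symmetric], simp)
  then show ?thesis
    unfolding Bo_def using Bo_integrable'[OF assms(1), of i j x] Bo_integrable'[OF assms(2), of i j x]
    by (simp add: diff_divide_distrib)
qed

text \<open>The symmetric difference removes the odd Taylor terms, so a fourth-order remainder is
  left. The quadratic term, contracted with \<open>fourth_moment\<close>, yields the Laplacian on
  the diagonal and two mixed derivatives; the 2 in the denominator is the one in
  \<open>Bo\<close>.\<close>

lemma Bo_consistency:
  assumes f: "smooth_bdd 4 B f"
  shows "\<bar>Bo i j f x - ((if i = j then \<Sum>p\<in>UNIV. iter_partial [p, p] f x else 0) + iter_partial [i, j] f x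
      + iter_partial [j, i] f x) / (2 * (CARD('n) + 2))\<bar> \<le> B * CARD('n) ^ 5 * \<delta>\<^sup>2"
proof -
  have [measurable]: "f \<in> borel_measurable borel"
    using f by (rule smooth_bdd_measurable) simp
  have B: "B \<ge> 0"
    using f by (rule smooth_bdd_nonneg)
  let ?D = "\<lambda>s. f (x + s) + f (x - s) - 2 * f x"
  let ?T = "\<lambda>s. (\<Sum>p\<in>UNIV. \<Sum>q\<in>UNIV. iter_partial [p, q] f x * (s $ p * s $ q))"
  let ?w = "\<lambda>s. s $ i * s $ j / (norm s)\<^sup>2"
  have R: "\<bar>?D s - ?T s\<bar> \<le> B * l1 s ^ 4" for s
  proof -
    have e: "(\<Sum>j<4. taylor_term j f x s / fact j) + (\<Sum>j<4. taylor_term j f x (- s) / fact j) = 2 * f x + ?T s"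
      by (simp add: eval_nat_numeral taylor_term_minus taylor_term_2[unfolded numeral_2_eq_2])
    have "\<bar>?D s - ?T s\<bar> = \<bar>(f (x + s) - (\<Sum>j<4. taylor_term j f x s / fact j))
        + (f (x + - s) - (\<Sum>j<4. taylor_term j f x (- s) / fact j))\<bar>"
      using e by (simp add: algebra_simps)
    also have "\<dots> \<le> B * l1 s ^ 4 / fact 4 + B * l1 (- s) ^ 4 / fact 4"
      by (intro order_trans[OF abs_triangle_ineq] add_mono taylor_smooth_bdd[OF f]) simp_all
    also have "\<dots> \<le> B * l1 s ^ 4"
      using B by (simp add: fact_numeral)
    finally show ?thesis .
  qed
  have w: "\<bar>?w s\<bar> \<le> 1" for s
    using component_mult_le[of s i j] by (cases "s = 0") (auto simp: abs_divide divide_le_eq)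
  have R': "\<bar>?w s * (?D s - ?T s)\<bar> \<le> B * CARD('n) ^ 4 * \<delta>\<^sup>2 * (norm s)\<^sup>2" if "norm s < \<delta>" for s
  proof -
    have "\<bar>?w s\<bar> * \<bar>?D s - ?T s\<bar> \<le> 1 * (B * (CARD('n) ^ 4 * norm s ^ 4))"
      by (intro mult_mono w order_trans[OF R] mult_left_mono l1_le_power B) auto
    also have "\<dots> = B * CARD('n) ^ 4 * (norm s)\<^sup>2 * (norm s)\<^sup>2"
      by (simp add: eval_nat_numeral mult_ac)
    also have "\<dots> \<le> B * CARD('n) ^ 4 * \<delta>\<^sup>2 * (norm s)\<^sup>2"
      using that B \<delta> by (intro mult_right_mono mult_left_mono power_mono) auto
    finally show ?thesis
      by (simp only: abs_mult)
  qed
  have iR: "integrable lborel (\<lambda>s. \<kappa> s * (?w s * (?D s - ?T s)))"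
    by (rule kernel_integrable(1)[OF _ R']) measurable
  have T_eq: "\<kappa> s * (?w s * ?T s) = (\<Sum>p\<in>UNIV. \<Sum>q\<in>UNIV. iter_partial [p, q] f x *
      (\<kappa> s * (s $ i * s $ j * (s $ p * s $ q) / (norm s)\<^sup>2)))" for s
    by (simp add: sum_distrib_left mult_ac)
  have iT: "integrable lborel (\<lambda>s. \<kappa> s * (?w s * ?T s))"
    unfolding T_eq by (intro Bochner_Integration.integrable_sum integrable_mult_right M4_integrable)
  have "(\<integral>s. \<kappa> s * (?w s * ?T s) \<partial>lborel) = (\<Sum>p\<in>UNIV. \<Sum>q\<in>UNIV. iter_partial [p, q] f x * M4 i j p q)"
    unfolding T_eq M4_def
    by (subst Bochner_Integration.integral_sum, intro Bochner_Integration.integrable_sum integrable_mult_right M4_integrable,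
        intro sum.cong refl, subst Bochner_Integration.integral_sum, intro integrable_mult_right M4_integrable)
      (simp only: integral_mult_right_zero)
  also have "\<dots> = (\<Sum>p\<in>UNIV. \<Sum>q\<in>UNIV. (if i = j then if p = q then iter_partial [p, q] f x else 0 else 0)
        + (if i = p then if j = q then iter_partial [p, q] f x else 0 else 0)
        + (if j = p then if i = q then iter_partial [p, q] f x else 0 else 0)) / (CARD('n) + 2)"
    unfolding sum_divide_distrib by (intro sum.cong refl) (simp add: fourth_moment)
  also have "\<dots> = ((if i = j then \<Sum>p\<in>UNIV. iter_partial [p, p] f x else 0) + iter_partial [i, j] f x
      + iter_partial [j, i] f x) / (CARD('n) + 2)"
  proof -
    have 1: "(\<Sum>p\<in>UNIV. \<Sum>q\<in>UNIV. if a = p then if b = q then iter_partial [p, q] f x else 0 else 0)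
      = iter_partial [a, b] f x" for a b
    proof -
      have "(\<Sum>p\<in>UNIV. \<Sum>q\<in>UNIV. if a = p then if b = q then iter_partial [p, q] f x else 0 else 0)
        = (\<Sum>p\<in>UNIV. if a = p then iter_partial [p, b] f x else 0)"
        by (intro sum.cong refl) simp
      then show ?thesis by simp
    qed
    show ?thesis
      unfolding sum.distrib 1 by (cases "i = j") simp_all
  qed
  finally have T: "(\<integral>s. \<kappa> s * (?w s * ?T s) \<partial>lborel) = \<dots>" .
  have "Bo i j f x = (\<integral>s. \<kappa> s * (?w s * ?T s) + \<kappa> s * (?w s * (?D s - ?T s)) \<partial>lborel) / 2"
    unfolding Bo_def by (intro arg_cong[of _ _ "\<lambda>x. x / 2"] Bochner_Integration.integral_cong refl)
      (simp only: distrib_left[symmetric], simp)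
  also have "\<dots> = (\<integral>s. \<kappa> s * (?w s * ?T s) \<partial>lborel) / 2 + (\<integral>s. \<kappa> s * (?w s * (?D s - ?T s)) \<partial>lborel) / 2"
    by (subst Bochner_Integration.integral_add[OF iT iR]) (rule add_divide_distrib)
  finally have "Bo i j f x - ((if i = j then \<Sum>p\<in>UNIV. iter_partial [p, p] f x else 0) + iter_partial [i, j] f x
      + iter_partial [j, i] f x) / (2 * (CARD('n) + 2)) = (\<integral>s. \<kappa> s * (?w s * (?D s - ?T s)) \<partial>lborel) / 2"
    unfolding T by (simp add: mult.commute)
  also have "\<bar>\<dots>\<bar> \<le> B * CARD('n) ^ 4 * \<delta>\<^sup>2 * CARD('n)"
  proof -
    have "\<bar>\<integral>s. \<kappa> s * (?w s * (?D s - ?T s)) \<partial>lborel\<bar> \<le> B * CARD('n) ^ 4 * \<delta>\<^sup>2 * CARD('n)"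
      by (rule kernel_integrable(2)[OF _ R']) measurable
    then show ?thesis by simp
  qed
  also have "\<dots> = B * CARD('n) ^ 5 * \<delta>\<^sup>2"
    by (simp add: eval_nat_numeral)
  finally show ?thesis .
qed

end

subsection \<open>The operators of the scheme in terms of a radial kernel\<close>

lemma
  fixes F :: "'a \<Rightarrow> real^'n::finite"
  assumes "\<And>i. integrable M (\<lambda>s. F s $ i)"
  shows integrable_vec: "integrable M F"
    and integral_vec_component: "(\<integral>s. F s \<partial>M) $ i = (\<integral>s. F s $ i \<partial>M)"
proof -
  have "F s = (\<Sum>i\<in>UNIV. F s $ i *\<^sub>R axis i 1)" for s
    using basis_expansion[of "F s"] by (simp add: scalar_mult_eq_scaleR)
  moreover have "integrable M (\<lambda>s. \<Sum>i\<in>UNIV. F s $ i *\<^sub>R axis i (1::real))"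
    using assms by (intro Bochner_Integration.integrable_sum integrable_scaleR_left)
  ultimately show *: "integrable M F"
    by simp
  show "(\<integral>s. F s \<partial>M) $ i = (\<integral>s. F s $ i \<partial>M)"
    using integral_bounded_linear[OF bounded_linear_vec_nth[of i] *] by simp
qed

lemma
  fixes f :: "'a::euclidean_space \<Rightarrow> real"
  assumes c: "c \<noteq> 0" and [measurable]: "f \<in> borel_measurable borel"
  shows integrable_lborel_scale: "integrable lborel (\<lambda>x. f (c *\<^sub>R x)) \<longleftrightarrow> integrable lborel f"
    and integral_lborel_scale: "(\<integral>x. f x \<partial>lborel) = \<bar>c\<bar> ^ DIM('a) * (\<integral>x. f (c *\<^sub>R x) \<partial>lborel)"
proof -
  let ?D = "density (distr lborel borel (\<lambda>x::'a. 0 + c *\<^sub>R x)) (\<lambda>_. ennreal (\<bar>c\<bar> ^ DIM('a)))"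
  have eq: "lborel = ?D"
    by (rule lborel_affine[OF c])
  have "integrable lborel f \<longleftrightarrow> integrable ?D f"
    using eq by simp
  also have "\<dots> \<longleftrightarrow> integrable lborel (\<lambda>x. f (c *\<^sub>R x))"
    using c by (simp add: integrable_density integrable_distr_eq)
  finally show "integrable lborel (\<lambda>x. f (c *\<^sub>R x)) \<longleftrightarrow> integrable lborel f" ..
  have "(\<integral>x. f x \<partial>lborel) = (\<integral>x. f x \<partial>?D)"
    using eq by simp
  also have "\<dots> = \<bar>c\<bar> ^ DIM('a) * (\<integral>x. f (c *\<^sub>R x) \<partial>lborel)"
    by (simp add: integral_density integral_distr)
  finally show "(\<integral>x. f x \<partial>lborel) = \<bar>c\<bar> ^ DIM('a) * (\<integral>x. f (c *\<^sub>R x) \<partial>lborel)" .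
qed

text \<open>The value of \<open>\<rho>\<close> at \<open>0\<close> is irrelevant for the operators and unconstrained by the hypotheses,
  so the origin is removed.\<close>

definition horizon_kernel :: "(real \<Rightarrow> real) \<Rightarrow> real \<Rightarrow> real^'n::finite \<Rightarrow> real" where
  "horizon_kernel \<rho> \<delta> s = indicator (ball 0 \<delta> - {0}) s * scaled_kernel CARD('n) \<rho> \<delta> (norm s)"

text \<open>The exponent d + 2 in \<open>scaled_kernel\<close> makes the second moment invariant:
  \<delta>^d comes from the volume element and \<delta>^2 from |s|^2.\<close>

lemma radial_kernel_horizon:
  assumes \<delta>: "\<delta> > 0"
    and nonneg: "\<And>r. r > 0 \<Longrightarrow> \<rho> r \<ge> 0"
    and int: "set_integrable lborel (ball 0 1) (\<lambda>s::real^'n::finite. \<rho> (norm s) * (norm s)\<^sup>2)"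
    and moment: "(LINT s:ball 0 1|lborel. \<rho> (norm (s::real^'n)) * (norm s)\<^sup>2) = CARD('n)"
  shows "radial_kernel (horizon_kernel \<rho> \<delta> :: real^'n \<Rightarrow> real) \<delta>"
proof
  let ?k = "horizon_kernel \<rho> \<delta> :: real^'n \<Rightarrow> real"
  let ?m = "\<lambda>s. ?k s * (norm s)\<^sup>2"
  let ?g = "\<lambda>s::real^'n. indicator (ball 0 1) s * (\<rho> (norm s) * (norm s)\<^sup>2)"
  have g_int: "integrable lborel ?g" and g_mom: "(\<integral>s. ?g s \<partial>lborel) = CARD('n)"
    using int moment by (simp_all add: set_integrable_def set_lebesgue_integral_def)
  then have [measurable]: "?g \<in> borel_measurable borel"
    by simp
  have m_scale: "?m (\<delta> *\<^sub>R t) = ?g t / \<delta> ^ CARD('n)" for t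
    using \<delta> by (cases "t = 0")
      (auto simp: horizon_kernel_def scaled_kernel_def indicator_def power_mult_distrib power_add power2_eq_square)
  have m_eq: "?m = (\<lambda>s. ?g (s /\<^sub>R \<delta>) / \<delta> ^ CARD('n))"
  proof
    fix s
    show "?m s = ?g (s /\<^sub>R \<delta>) / \<delta> ^ CARD('n)"
      using m_scale[of "s /\<^sub>R \<delta>"] \<delta> by simp
  qed
  have m_meas: "?m \<in> borel_measurable borel"
    unfolding m_eq by (intro borel_measurable_divide measurable_compose[OF _ \<open>?g \<in> borel_measurable borel\<close>]) measurable
  \<comment> \<open>Measurability of the kernel is recovered from that of its second-moment density.
    The division is harmless at 0, where the kernel vanishes and x / 0 = 0.\<close>
  have k_eq: "?k = (\<lambda>s. ?m s / (norm s)\<^sup>2)"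
    by (auto simp: horizon_kernel_def fun_eq_iff)
  show "?k \<in> borel_measurable borel"
    by (subst k_eq) (intro borel_measurable_divide m_meas, measurable)
  show "\<delta> > 0"
    by fact
  show "?k s \<ge> 0" for s
    using nonneg[of "norm s / \<delta>"] \<delta> by (auto simp: horizon_kernel_def scaled_kernel_def indicator_def)
  show "?k s = ?k t" if "norm s = norm t" for s t
    using that by (auto simp: horizon_kernel_def indicator_def)
  show "?k s = 0" if "norm s \<ge> \<delta>" for s
    using that by (simp add: horizon_kernel_def)
  show "integrable lborel ?m"
  proof -
    have "integrable lborel (\<lambda>t. ?m (\<delta> *\<^sub>R t))"
      unfolding m_scale using g_int by simp
    then show ?thesis
      using integrable_lborel_scale[of \<delta> ?m, OF _ m_meas] \<delta> by blast
  qed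
  show "(\<integral>s. ?m s \<partial>lborel) = CARD('n)"
  proof -
    have "(\<integral>t. ?m (\<delta> *\<^sub>R t) \<partial>lborel) = CARD('n) / \<delta> ^ CARD('n)"
      unfolding m_scale using g_mom by simp
    then show ?thesis
      using integral_lborel_scale[of \<delta> ?m, OF _ m_meas] \<delta> by simp
  qed
qed

locale horizon = radial_kernel "horizon_kernel \<rho> \<delta> :: real^'n::finite \<Rightarrow> real" \<delta>
  for \<rho> :: "real \<Rightarrow> real" and \<delta> :: real
begin

abbreviation \<kappa> :: "real^'n \<Rightarrow> real" where "\<kappa> \<equiv> horizon_kernel \<rho> \<delta>"

lemma nonlocal_div_eq:
  fixes u :: "real^'n \<Rightarrow> real^'n"
  assumes "\<And>i. smooth_bdd 1 L (\<lambda>x. u x $ i)"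
  shows "nonlocal_div \<rho> \<delta> u x = (\<Sum>i\<in>UNIV. S i (\<lambda>x. u x $ i) x)"
proof -
  have "nonlocal_div \<rho> \<delta> u x = (\<integral>s. (\<Sum>i\<in>UNIV. \<kappa> s * (s $ i * (u (x + s) $ i - u x $ i))) \<partial>lborel)"
    unfolding nonlocal_div_def set_lebesgue_integral_def
  proof (intro Bochner_Integration.integral_cong refl)
    fix s :: "real^'n"
    show "indicator (ball 0 \<delta>) s *\<^sub>R (scaled_kernel CARD('n) \<rho> \<delta> (norm s) * (s \<bullet> (u (x + s) - u x)))
      = (\<Sum>i\<in>UNIV. \<kappa> s * (s $ i * (u (x + s) $ i - u x $ i)))"
      by (cases "s = 0") (auto simp: horizon_kernel_def indicator_def inner_vec_def sum_distrib_left)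
  qed
  also have "\<dots> = (\<Sum>i\<in>UNIV. S i (\<lambda>x. u x $ i) x)"
    unfolding S_def by (intro Bochner_Integration.integral_sum S_integrable'[OF assms])
  finally show ?thesis .
qed

lemma nonlocal_grad_eq:
  assumes "smooth_bdd 1 L \<theta>"
  shows "nonlocal_grad \<rho> \<delta> \<theta> x $ i = S i \<theta> x"
proof -
  have eq: "(indicator (ball 0 \<delta>) s *\<^sub>R (scaled_kernel CARD('n) \<rho> \<delta> (norm s) * (\<theta> (x + s) - \<theta> x)) *\<^sub>R s) $ i
      = \<kappa> s * (s $ i * (\<theta> (x + s) - \<theta> x))" for s :: "real^'n" and i
    by (cases "s = 0") (auto simp: horizon_kernel_def indicator_def)
  show ?thesis
    unfolding nonlocal_grad_def set_lebesgue_integral_def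
    by (subst integral_vec_component) (simp_all only: eq S_integrable'[OF assms] S_def)
qed

lemma tensor_mult: "tensor s s *v w = (s \<bullet> w) *\<^sub>R s" for s w :: "real^'n"
  by (simp add: vec_eq_iff tensor_def matrix_vector_mult_def inner_vec_def sum_distrib_left mult_ac)

text \<open>Outside the ball of radius \<epsilon> the integrand is integrable, since |s $ i| / |s|^2
  is at most 1/\<epsilon> there. The truncated domain is symmetric, so the integrand can be averaged
  over s and -s; the average is integrable up to the origin and the truncation can be
  removed.\<close>

lemma bond_operator_eq:
  fixes u :: "real^'n \<Rightarrow> real^'n"
  assumes u1: "\<And>i. smooth_bdd 1 L (\<lambda>x. u x $ i)" and u2: "\<And>i. smooth_bdd 2 B (\<lambda>x. u x $ i)"
  shows "bond_operator \<rho> \<delta> u x $ i = (\<Sum>j\<in>UNIV. Bo i j (\<lambda>x. u x $ j) x)"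
proof -
  let ?F = "\<lambda>\<epsilon> s. indicator (ball 0 \<delta> - ball 0 \<epsilon>) s *\<^sub>R
       (scaled_kernel CARD('n) \<rho> \<delta> (norm s) / (norm s)\<^sup>2) *\<^sub>R (tensor s s *v (u (x + s) - u x))"
  let ?I = "\<lambda>\<epsilon> s. indicator {s. \<epsilon> \<le> norm s} s :: real"
  let ?D = "\<lambda>j s. u (x + s) $ j + u (x - s) $ j - 2 * u x $ j"
  let ?g = "\<lambda>i j s. \<kappa> s * (s $ i * s $ j / (norm s)\<^sup>2 * ?D j s)"
  have [measurable]: "(\<lambda>x. u x $ j) \<in> borel_measurable borel" for j
    using u1 by (rule smooth_bdd_measurable) simp
  have L: "L \<ge> 0"
    using u1 smooth_bdd_nonneg by blast
  have g: "integrable lborel (?g i j)" for i j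
    using Bo_integrable'[OF u2] by simp
  have comp: "integrable lborel (\<lambda>s. ?F \<epsilon> s $ i)"
    "(\<integral>s. ?F \<epsilon> s $ i \<partial>lborel) = (\<Sum>j\<in>UNIV. (\<integral>s. ?I \<epsilon> s * ?g i j s \<partial>lborel) / 2)"
    if \<epsilon>: "\<epsilon> > 0" for \<epsilon> i
  proof -
    let ?H = "\<lambda>s. ?I \<epsilon> s * (s $ i / (norm s)\<^sup>2 * (\<Sum>j\<in>UNIV. s $ j * (u (x + s) $ j - u x $ j)))"
    have eq: "?F \<epsilon> s $ i = \<kappa> s * ?H s" for s
      using \<epsilon> by (cases "s = 0") (auto simp: horizon_kernel_def indicator_def tensor_mult inner_vec_def)
    have bound: "\<bar>?H s\<bar> \<le> (L * CARD('n)\<^sup>2 / \<epsilon>) * (norm s)\<^sup>2" for s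
    proof (cases "\<epsilon> \<le> norm s")
      case True
      then have s: "norm s > 0"
        using \<epsilon> by linarith
      have "\<bar>\<Sum>j\<in>UNIV. s $ j * (u (x + s) $ j - u x $ j)\<bar> \<le> (\<Sum>j\<in>(UNIV::'n set). norm s * (L * (CARD('n) * norm s)))"
        unfolding abs_mult
        by (intro order_trans[OF sum_abs] sum_mono)
          (simp only: abs_mult, intro mult_mono component_le_norm_cart
            order_trans[OF smooth_bdd_lipschitz[OF u1[unfolded One_nat_def]]] mult_left_mono l1_le L, auto)
      also have "\<dots> = L * CARD('n)\<^sup>2 * (norm s)\<^sup>2"
        by (simp add: power2_eq_square mult_ac)
      finally have 1: "\<bar>\<Sum>j\<in>UNIV. s $ j * (u (x + s) $ j - u x $ j)\<bar> \<le> L * CARD('n)\<^sup>2 * (norm s)\<^sup>2" .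
      have "\<bar>s $ i / (norm s)\<^sup>2\<bar> \<le> norm s / (norm s)\<^sup>2"
        by (simp add: abs_divide divide_right_mono component_le_norm_cart)
      also have "\<dots> = 1 / norm s"
        by (simp add: power2_eq_square)
      also have "\<dots> \<le> 1 / \<epsilon>"
        using True \<epsilon> s by (intro divide_left_mono) auto
      finally have "\<bar>s $ i / (norm s)\<^sup>2\<bar> * \<bar>\<Sum>j\<in>UNIV. s $ j * (u (x + s) $ j - u x $ j)\<bar>
          \<le> (1 / \<epsilon>) * (L * CARD('n)\<^sup>2 * (norm s)\<^sup>2)"
        using \<epsilon> by (intro mult_mono 1) auto
      then show ?thesis
        using True by (simp add: abs_mult)
    qed (use L \<epsilon> in simp)
    have [measurable]: "?H \<in> borel_measurable borel"
      by measurable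
    show i: "integrable lborel (\<lambda>s. ?F \<epsilon> s $ i)"
      unfolding eq by (rule kernel_integrable(1)[OF _ bound]) measurable
    have H: "integrable lborel (\<lambda>s. \<kappa> s * ?H s)"
      using i unfolding eq .
    have Hm: "integrable lborel (\<lambda>s. \<kappa> s * ?H (- s))"
      by (rule kernel_integrable(1)[where C = "L * CARD('n)\<^sup>2 / \<epsilon>"])
        (measurable, use bound[of "- s" for s] in simp)
    \<comment> \<open>Averaging over s and -s replaces the first difference by the second difference
      \<open>?D\<close>.\<close>
    have "2 * (\<integral>s. \<kappa> s * ?H s \<partial>lborel) = (\<integral>s. \<kappa> s * ?H s \<partial>lborel) + (\<integral>s. \<kappa> s * ?H (- s) \<partial>lborel)"
      using kernel_minus[of ?H] by simp
    also have "\<dots> = (\<integral>s. \<kappa> s * ?H s + \<kappa> s * ?H (- s) \<partial>lborel)"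
      by (rule Bochner_Integration.integral_add[OF H Hm, symmetric])
    also have "\<dots> = (\<integral>s. (\<Sum>j\<in>UNIV. ?I \<epsilon> s * ?g i j s) \<partial>lborel)"
    proof (intro Bochner_Integration.integral_cong refl)
      fix s :: "real^'n"
      have "(\<Sum>j\<in>UNIV. ?I \<epsilon> s * ?g i j s)
          = \<kappa> s * ?I \<epsilon> s * (s $ i / (norm s)\<^sup>2) * (\<Sum>j\<in>UNIV. s $ j * ?D j s)"
        unfolding sum_distrib_left by (intro sum.cong refl) simp
      also have "(\<Sum>j\<in>UNIV. s $ j * ?D j s) = (\<Sum>j\<in>UNIV. s $ j * (u (x + s) $ j - u x $ j))
          + (\<Sum>j\<in>UNIV. s $ j * (u (x - s) $ j - u x $ j))"
        unfolding sum.distrib[symmetric] by (intro sum.cong refl) (simp add: algebra_simps)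
      finally have 1: "(\<Sum>j\<in>UNIV. ?I \<epsilon> s * ?g i j s) = \<kappa> s * ?I \<epsilon> s * (s $ i / (norm s)\<^sup>2)
          * ((\<Sum>j\<in>UNIV. s $ j * (u (x + s) $ j - u x $ j)) + (\<Sum>j\<in>UNIV. s $ j * (u (x - s) $ j - u x $ j)))" .
      have 2: "?H (- s) = ?I \<epsilon> s * (s $ i / (norm s)\<^sup>2 * (\<Sum>j\<in>UNIV. s $ j * (u (x - s) $ j - u x $ j)))"
        by (simp add: indicator_def sum_negf)
      show "\<kappa> s * ?H s + \<kappa> s * ?H (- s) = (\<Sum>j\<in>UNIV. ?I \<epsilon> s * ?g i j s)"
        unfolding 1 2 by (simp only: distrib_left mult.assoc)
    qed
    also have "\<dots> = (\<Sum>j\<in>UNIV. (\<integral>s. ?I \<epsilon> s * ?g i j s \<partial>lborel))"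
      by (intro Bochner_Integration.integral_sum integrable_mult_indicator[OF _ g, unfolded real_scaleR_def]) measurable
    finally show "(\<integral>s. ?F \<epsilon> s $ i \<partial>lborel) = (\<Sum>j\<in>UNIV. (\<integral>s. ?I \<epsilon> s * ?g i j s \<partial>lborel) / 2)"
      unfolding eq sum_divide_distrib[symmetric] by simp
  qed
  have lim: "((\<lambda>\<epsilon>. \<integral>s. ?I \<epsilon> s * ?g i j s \<partial>lborel) \<longlongrightarrow> (\<integral>s. ?g i j s \<partial>lborel)) (at_right 0)" for i j
  proof (rule tendsto_at_right_sequentially[of 0 1])
    fix X :: "nat \<Rightarrow> real" assume X: "\<And>n. 0 < X n" "X \<longlonglongrightarrow> 0"
    show "(\<lambda>n. \<integral>s. ?I (X n) s * ?g i j s \<partial>lborel) \<longlonglongrightarrow> (\<integral>s. ?g i j s \<partial>lborel)"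
    \<comment> \<open>The symmetrised integrand itself dominates all its truncations.\<close>
    proof (rule integral_dominated_convergence[where w = "\<lambda>s. \<bar>?g i j s\<bar>"])
      have gm: "?g i j \<in> borel_measurable lborel"
        using g by simp
      then show "?g i j \<in> borel_measurable lborel" .
      show "(\<lambda>s. ?I (X n) s * ?g i j s) \<in> borel_measurable lborel" for n
        by (intro borel_measurable_times gm) measurable
      show "integrable lborel (\<lambda>s. \<bar>?g i j s\<bar>)"
        by (intro integrable_abs g)
      show "AE s in lborel. (\<lambda>n. ?I (X n) s * ?g i j s) \<longlonglongrightarrow> ?g i j s"
      proof (intro AE_I2)
        fix s :: "real^'n"
        show "(\<lambda>n. ?I (X n) s * ?g i j s) \<longlonglongrightarrow> ?g i j s"
        proof (cases "s = 0")
          case False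
          then have "eventually (\<lambda>n. X n < norm s) sequentially"
            using X(2) by (intro order_tendstoD) auto
          then have "eventually (\<lambda>n. ?I (X n) s * ?g i j s = ?g i j s) sequentially"
            by eventually_elim simp
          then show ?thesis
            by (rule tendsto_eventually)
        qed simp
      qed
      show "AE s in lborel. norm (?I (X n) s * ?g i j s) \<le> \<bar>?g i j s\<bar>" for n
        by (intro AE_I2) (simp add: indicator_def)
    qed
  qed simp
  have "((\<lambda>\<epsilon>. \<integral>s. ?F \<epsilon> s \<partial>lborel) \<longlongrightarrow> (\<chi> i. \<Sum>j\<in>UNIV. Bo i j (\<lambda>x. u x $ j) x)) (at_right 0)"
  proof (rule vec_tendstoI)
    fix i
    have "((\<lambda>\<epsilon>. \<Sum>j\<in>UNIV. (\<integral>s. ?I \<epsilon> s * ?g i j s \<partial>lborel) / 2) \<longlongrightarrow> (\<Sum>j\<in>UNIV. (\<integral>s. ?g i j s \<partial>lborel) / 2)) (at_right 0)"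
      by (intro tendsto_sum tendsto_divide lim tendsto_const) simp
    moreover have "eventually (\<lambda>\<epsilon>. (\<Sum>j\<in>UNIV. (\<integral>s. ?I \<epsilon> s * ?g i j s \<partial>lborel) / 2) = (\<integral>s. ?F \<epsilon> s \<partial>lborel) $ i) (at_right 0)"
      using eventually_at_right_less[of "0::real"]
      by eventually_elim (simp only: integral_vec_component[OF comp(1)] comp(2))
    ultimately have "((\<lambda>\<epsilon>. (\<integral>s. ?F \<epsilon> s \<partial>lborel) $ i) \<longlongrightarrow> (\<Sum>j\<in>UNIV. (\<integral>s. ?g i j s \<partial>lborel) / 2)) (at_right 0)"
      by (rule Lim_transform_eventually)
    then show "((\<lambda>\<epsilon>. (\<integral>s. ?F \<epsilon> s \<partial>lborel) $ i) \<longlongrightarrow> (\<chi> i. \<Sum>j\<in>UNIV. Bo i j (\<lambda>x. u x $ j) x) $ i) (at_right 0)"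
      by (simp add: Bo_def)
  qed
  then have "bond_operator \<rho> \<delta> u x = (\<chi> i. \<Sum>j\<in>UNIV. Bo i j (\<lambda>x. u x $ j) x)"
    unfolding bond_operator_def set_lebesgue_integral_def by (intro tendsto_Lim) simp_all
  then show ?thesis
    by simp
qed

end

subsection \<open>The cubic B-spline as autocorrelation of the hat function\<close>

definition hat :: "real \<Rightarrow> real" where
  "hat t = max 0 (t + 1) - 2 * max 0 t + max 0 (t - 1)"

lemma hat_eq: "hat t = (if \<bar>t\<bar> \<le> 1 then 1 - \<bar>t\<bar> else 0)"
  by (auto simp: hat_def max_def)

lemma isCont_hat [continuous_intros]: "isCont hat t"
  unfolding hat_def by (intro continuous_intros)

lemma hat_measurable [measurable]: "hat \<in> borel_measurable borel"
  unfolding hat_def by measurable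

text \<open>Here \<open>g\<close> is a second antiderivative of the shifted hat. Integration by
  parts against each linear half of the other hat leaves the second central difference of
  \<open>g\<close>; as \<open>g\<close> is itself a second difference of cubic truncated powers, the
  fourth difference defining \<open>bspl 0\<close> appears.\<close>

lemma hat_autocorrelation_0:
  "has_bochner_integral lborel (\<lambda>y. hat y * hat (y + x)) (bspl 0 x)"
proof -
  define g where "g y = (max 0 (y + (x + 1)) ^ 3 - 2 * max 0 (y + x) ^ 3 + max 0 (y + (x - 1)) ^ 3) / 6" for y
  define g1 where "g1 y = (max 0 (y + (x + 1)) ^ 2 - 2 * max 0 (y + x) ^ 2 + max 0 (y + (x - 1)) ^ 2) / 2" for y
  have D3: "((\<lambda>y. max 0 (y + a) ^ 3) has_real_derivative 3 * (max 0 (y + a))\<^sup>2) (at y)" for a y :: real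
    using DERIV_max_power_shift[of a 1 y] by (simp add: numeral_eq_Suc del: power_Suc)
  have D2: "((\<lambda>y. (max 0 (y + a))\<^sup>2) has_real_derivative 2 * max 0 (y + a)) (at y)" for a y :: real
    using DERIV_max_power_shift[of a 0 y] by (simp add: numeral_eq_Suc del: power_Suc)
  have g: "(g has_real_derivative g1 y) (at y)" for y
    unfolding g_def[abs_def]
    by (rule DERIV_cong[OF DERIV_cdivide[OF DERIV_add[OF DERIV_diff[OF D3 DERIV_cmult[OF D3]] D3]]])
      (simp add: g1_def)
  have g1: "(g1 has_real_derivative hat (y + x)) (at y)" for y
    unfolding g1_def[abs_def]
    by (rule DERIV_cong[OF DERIV_cdivide[OF DERIV_add[OF DERIV_diff[OF D2 DERIV_cmult[OF D2]] D2]]])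
      (simp add: hat_def field_simps)
  have c: "isCont (\<lambda>y. hat (y + x)) y" for y
    using isCont_o2[of y "\<lambda>y. y + x" hat] isCont_hat by simp
  have 1: "has_bochner_integral lborel (\<lambda>y. (1 + y) * hat (y + x) * indicator {-1..0} y)
      (((1 + 0) * g1 0 - g 0) - ((1 + -1) * g1 (-1) - g (-1)))"
  proof (rule has_bochner_integral_FTC_Icc_real[where F = "\<lambda>y. (1 + y) * g1 y - g y"])
    show "((\<lambda>y. (1 + y) * g1 y - g y) has_real_derivative (1 + y) * hat (y + x)) (at y)" for y
      using g g1 by (auto intro!: derivative_eq_intros)
  qed (auto intro!: continuous_intros c)
  have 2: "has_bochner_integral lborel (\<lambda>y. (1 - y) * hat (y + x) * indicator {0..1} y)
      (((1 - 1) * g1 1 + g 1) - ((1 - 0) * g1 0 + g 0))"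
  proof (rule has_bochner_integral_FTC_Icc_real[where F = "\<lambda>y. (1 - y) * g1 y + g y"])
    show "((\<lambda>y. (1 - y) * g1 y + g y) has_real_derivative (1 - y) * hat (y + x)) (at y)" for y
      using g g1 by (auto intro!: derivative_eq_intros)
  qed (auto intro!: continuous_intros c)
  have "has_bochner_integral lborel (\<lambda>y. (1 + y) * hat (y + x) * indicator {-1..0} y
      + (1 - y) * hat (y + x) * indicator {0..1} y) (g (-1) - 2 * g 0 + g 1)"
    using has_bochner_integral_add[OF 1 2] by (simp add: algebra_simps)
  moreover have "g (-1) - 2 * g 0 + g 1 = bspl 0 x"
    by (simp add: g_def bspl_def fact_numeral field_simps)
  \<comment> \<open>The two half-intervals share the point 0, where the sum counts the product
    twice.\<close>
  moreover have "AE y in lborel. (1 + y) * hat (y + x) * indicator {-1..0} y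
      + (1 - y) * hat (y + x) * indicator {0..1} y = hat y * hat (y + x)"
    using AE_lborel_singleton[of "0::real"] by eventually_elim (auto simp: hat_eq[of "_ :: real"] indicator_def)
  ultimately show ?thesis
    by (subst has_bochner_integral_cong_AE[symmetric]) auto
qed

lemma hat_autocorrelation:
  "has_bochner_integral lborel (\<lambda>y. hat (y + a) * hat (y + b)) (bspl 0 (b - a))"
proof -
  have "has_bochner_integral lborel (\<lambda>y. hat (a + 1 * y) * hat (a + 1 * y + (b - a)))
      (bspl 0 (b - a) /\<^sub>R \<bar>1\<bar>)"
    using hat_autocorrelation_0[of "b - a"]
    by (subst lborel_has_bochner_integral_real_affine_iff[symmetric]) auto
  then show ?thesis
    by (simp add: algebra_simps)
qed

subsection \<open>A positive definite function on shifts\<close>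

text \<open>The shift \<sigma> is measured in mesh widths, so a displacement \<open>s\<close> enters
  as s_j / h_j. By \<open>multilinear_gram\<close> this is the autocorrelation at lag \<sigma> of
  the multilinear interpolant of \<open>a\<close>.\<close>

definition corr :: "(int^'n::finite) set \<Rightarrow> (int^'n \<Rightarrow> real) \<Rightarrow> real^'n \<Rightarrow> real" where
  "corr K a \<sigma> = (\<Sum>k\<in>K. \<Sum>l\<in>K. a k * a l * (\<Prod>j\<in>UNIV. bspl 0 (of_int (k $ j) - of_int (l $ j) + \<sigma> $ j)))"

text \<open>The argument \<open>y\<close> is a plain function because it ranges over the product
  measure \<open>Pi\<^sub>M\<close>, where integrals of tensor products factor into the
  one-dimensional autocorrelations.\<close>

definition multilinear :: "(int^'n::finite) set \<Rightarrow> (int^'n \<Rightarrow> real) \<Rightarrow> real^'n \<Rightarrow> ('n \<Rightarrow> real) \<Rightarrow> real" where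
  "multilinear K a \<sigma> y = (\<Sum>k\<in>K. a k * (\<Prod>j\<in>UNIV. hat (y j + (\<sigma> $ j - of_int (k $ j)))))"

interpretation lborel_product: product_sigma_finite "\<lambda>_ :: 'i. lborel :: real measure"
  by standard

lemma multilinear_gram:
  fixes K :: "(int^'n::finite) set"
  assumes K: "finite K"
  shows "has_bochner_integral (Pi\<^sub>M UNIV (\<lambda>_. lborel)) (\<lambda>y. multilinear K a \<sigma> y * multilinear K a \<tau> y)
    (corr K a (\<tau> - \<sigma>))"
proof -
  let ?M = "Pi\<^sub>M (UNIV :: 'n set) (\<lambda>_. lborel :: real measure)"
  let ?h = "\<lambda>k l j y. hat (y + (\<sigma> $ j - of_int (k $ j))) * hat (y + (\<tau> $ j - of_int (l $ j)))"
  have h: "has_bochner_integral lborel (?h k l j) (bspl 0 (of_int (k $ j) - of_int (l $ j) + (\<tau> - \<sigma>) $ j))"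
    for k l :: "int^'n" and j
    using hat_autocorrelation[of "\<sigma> $ j - of_int (k $ j)" "\<tau> $ j - of_int (l $ j)"] by (simp add: algebra_simps)
  have p: "has_bochner_integral ?M (\<lambda>y. \<Prod>j\<in>UNIV. ?h k l j (y j))
      (\<Prod>j\<in>UNIV. bspl 0 (of_int (k $ j) - of_int (l $ j) + (\<tau> - \<sigma>) $ j))" for k l :: "int^'n"
    using lborel_product.product_integrable_prod[of UNIV "?h k l"] lborel_product.product_integral_prod[of UNIV "?h k l"] h
    by (simp add: has_bochner_integral_iff)
  have "has_bochner_integral ?M (\<lambda>y. \<Sum>k\<in>K. \<Sum>l\<in>K. a k * a l * (\<Prod>j\<in>UNIV. ?h k l j (y j))) (corr K a (\<tau> - \<sigma>))"
    unfolding corr_def by (intro has_bochner_integral_sum has_bochner_integral_mult_right p)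
  then show ?thesis
    by (simp add: multilinear_def sum_product prod.distrib mult_ac)
qed

lemma multilinear_difference:
  assumes K: "finite K"
  shows "has_bochner_integral (Pi\<^sub>M UNIV (\<lambda>_. lborel)) (\<lambda>y. (multilinear K a \<tau> y - multilinear K a \<sigma> y)\<^sup>2)
    (2 * corr K a 0 - 2 * corr K a (\<tau> - \<sigma>))"
proof -
  have "has_bochner_integral (Pi\<^sub>M UNIV (\<lambda>_. lborel)) (\<lambda>y. multilinear K a \<tau> y * multilinear K a \<tau> y
      + multilinear K a \<sigma> y * multilinear K a \<sigma> y - 2 * (multilinear K a \<sigma> y * multilinear K a \<tau> y))
    (corr K a 0 + corr K a 0 - 2 * corr K a (\<tau> - \<sigma>))"
    using multilinear_gram[OF K, of a]
    by (intro has_bochner_integral_add has_bochner_integral_diff has_bochner_integral_mult_right)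
      (metis diff_self)+
  then show ?thesis
    by (simp add: power2_eq_square algebra_simps)
qed

text \<open>The telescoping sum \<open>\<Sum>\<^sub>i (A (\<cdot> + (i+1) \<sigma>) - A (\<cdot> + i \<sigma>))\<close> bounds a long shift of the multilinear
  interpolant by short ones; a shift out of the support makes the correlation vanish.\<close>

lemma corr_telescope:
  assumes K: "finite K"
  shows "corr K a 0 - corr K a (real n *\<^sub>R \<sigma>) \<le> (real n)\<^sup>2 * (corr K a 0 - corr K a \<sigma>)"
proof -
  let ?M = "Pi\<^sub>M UNIV (\<lambda>_. lborel :: real measure)"
  let ?A = "\<lambda>i y. multilinear K a (real i *\<^sub>R \<sigma>) y"
  have 1: "has_bochner_integral ?M (\<lambda>y. (?A n y - ?A 0 y)\<^sup>2) (2 * corr K a 0 - 2 * corr K a (real n *\<^sub>R \<sigma>))"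
    using multilinear_difference[OF K, of a "real n *\<^sub>R \<sigma>" "real 0 *\<^sub>R \<sigma>"] by simp
  have 2: "has_bochner_integral ?M (\<lambda>y. real n * (\<Sum>i<n. (?A (Suc i) y - ?A i y)\<^sup>2))
      (real n * (\<Sum>i<n. 2 * corr K a 0 - 2 * corr K a \<sigma>))"
  proof (intro has_bochner_integral_mult_right has_bochner_integral_sum)
    fix i
    have "real (Suc i) *\<^sub>R \<sigma> - real i *\<^sub>R \<sigma> = \<sigma>"
      by (simp add: algebra_simps)
    then show "has_bochner_integral ?M (\<lambda>y. (?A (Suc i) y - ?A i y)\<^sup>2) (2 * corr K a 0 - 2 * corr K a \<sigma>)"
      using multilinear_difference[OF K, of a "real (Suc i) *\<^sub>R \<sigma>" "real i *\<^sub>R \<sigma>"] by simp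
  qed
  have "(?A n y - ?A 0 y)\<^sup>2 \<le> real n * (\<Sum>i<n. (?A (Suc i) y - ?A i y)\<^sup>2)" for y
  proof -
    have "?A n y - ?A 0 y = (\<Sum>i<n. 1 * (?A (Suc i) y - ?A i y))"
      using sum_lessThan_telescope[of "\<lambda>i. ?A i y" n] by simp
    \<comment> \<open>Cauchy-Schwarz costs one factor \<open>n\<close>; the second one comes from
      \<open>n\<close> differences with the same integral.\<close>
    also have "\<dots>\<^sup>2 \<le> (\<Sum>i<n. 1\<^sup>2) * (\<Sum>i<n. (?A (Suc i) y - ?A i y)\<^sup>2)"
      by (rule Cauchy_Schwarz_ineq_sum)
    finally show ?thesis
      by simp
  qed
  then have "integral\<^sup>L ?M (\<lambda>y. (?A n y - ?A 0 y)\<^sup>2) \<le> integral\<^sup>L ?M (\<lambda>y. real n * (\<Sum>i<n. (?A (Suc i) y - ?A i y)\<^sup>2))"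
    using 1 2 by (intro integral_mono) (auto simp: has_bochner_integral_iff)
  then show ?thesis
    using 1 2 by (simp add: has_bochner_integral_iff power2_eq_square algebra_simps)
qed

lemma bspl_int: "bspl 0 (of_int m) = (if m = 0 then 2/3 else if \<bar>m\<bar> = 1 then 1/6 else 0)"
proof (cases "\<bar>m\<bar> \<ge> 2")
  case True
  then show ?thesis
    by (simp add: bspl_eq_0)
next
  case False
  then have "m = 0 \<or> m = 1 \<or> m = -1"
    by linarith
  then show ?thesis
    by (auto simp: bspl_def fact_numeral)
qed

text \<open>A Gram factorisation \<open>b(k - l) = \<Sum>\<^sub>z G z k * G z l\<close> of the samples of the spline. The diagonal part
  \<open>\<delta>\<^sub>k\<^sub>l / 3\<close> of the factorisation survives in the tensor product and yields coercivity of the mass matrix.\<close>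

definition gram :: "int \<times> bool \<Rightarrow> int \<Rightarrow> real" where
  "gram z k = (if snd z then if fst z = k then 1 / sqrt 3 else 0
     else if fst z = k \<or> fst z = k + 1 then 1 / sqrt 6 else 0)"

text \<open>The value 2/3 at 0 splits as 1/3 + 1/6 + 1/6. Neighbouring indices share exactly one
  label of weight 1/6, which accounts for the values at distance 1.\<close>

lemma gram_factorisation:
  assumes "finite Z" "k \<in> Z" "k + 1 \<in> Z" "l \<in> Z" "l + 1 \<in> Z"
  shows "(\<Sum>z\<in>Z \<times> UNIV. gram z k * gram z l) = bspl 0 (of_int (k - l))"
proof -
  have "(\<Sum>z\<in>Z \<times> UNIV. gram z k * gram z l) = (\<Sum>z\<in>Z. gram (z, True) k * gram (z, True) l)
      + (\<Sum>z\<in>Z. gram (z, False) k * gram (z, False) l)"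
    by (simp add: sum.cartesian_product' UNIV_bool sum.distrib)
  also have "(\<Sum>z\<in>Z. gram (z, True) k * gram (z, True) l) = (\<Sum>z\<in>Z. if z = k then (if k = l then 1/3 else 0) else 0)"
    by (intro sum.cong refl) (auto simp: gram_def)
  also have "\<dots> = (if k = l then 1/3 else 0)"
    using assms by simp
  also have "(\<Sum>z\<in>Z. gram (z, False) k * gram (z, False) l)
      = (\<Sum>z\<in>Z. (if z = k then (if k = l \<or> k = l + 1 then 1/6 else 0) else 0)
          + (if z = k + 1 then (if k + 1 = l \<or> k = l then 1/6 else 0) else 0))"
    by (intro sum.cong refl) (auto simp: gram_def)
  also have "\<dots> = (if k = l \<or> k = l + 1 then 1/6 else 0) + (if k + 1 = l \<or> k = l then 1/6 else 0)"
    using assms by (simp add: sum.distrib)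
  also have "(if k = l then 1/3 else 0) + \<dots> = bspl 0 (of_int (k - l))"
    by (subst bspl_int) auto
  finally show ?thesis .
qed

text \<open>Through the Gram factorisation in each coordinate the form becomes a sum of squares
  indexed by label vectors \<zeta>. Discarding some of the squares gives a lower bound.\<close>

lemma mass_coercive:
  fixes K :: "(int^'n::finite) set"
  assumes K: "finite K"
  shows "(\<Sum>k\<in>K. (a k)\<^sup>2) / 3 ^ CARD('n) \<le> corr K a 0"
proof -
  define Z where "Z = (\<Union>k\<in>K. \<Union>j\<in>UNIV. {k $ j, k $ j + 1})"
  have Z: "finite Z" and KZ: "k $ j \<in> Z" "k $ j + 1 \<in> Z" if "k \<in> K" for k j
    using that K by (auto simp: Z_def)
  have fin: "finite Z"
    using K by (auto simp: Z_def)
  define X where "X = {\<zeta> :: (int \<times> bool)^'n. \<forall>j. \<zeta> $ j \<in> Z \<times> UNIV}"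
  have X: "finite X"
    unfolding X_def using fin by (intro finite_vec_box) auto
  define P where "P \<zeta> k = (\<Prod>j\<in>UNIV. gram (\<zeta> $ j) (k $ j))" for \<zeta> :: "(int \<times> bool)^'n" and k :: "int^'n"
  have "corr K a 0 = (\<Sum>k\<in>K. \<Sum>l\<in>K. a k * a l * (\<Sum>\<zeta>\<in>X. P \<zeta> k * P \<zeta> l))"
    unfolding corr_def
  proof (intro sum.cong refl arg_cong2[of _ _ _ _ "(*)"])
    fix k l assume kl: "k \<in> K" "l \<in> K"
    have "(\<Prod>j\<in>UNIV. bspl 0 (of_int (k $ j) - of_int (l $ j) + 0 $ j))
        = (\<Prod>j\<in>UNIV. \<Sum>z\<in>Z \<times> UNIV. gram z (k $ j) * gram z (l $ j))"
      by (intro prod.cong refl) (simp add: gram_factorisation[OF fin] KZ kl)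
    also have "\<dots> = (\<Sum>\<zeta>\<in>X. \<Prod>j\<in>UNIV. gram (\<zeta> $ j) (k $ j) * gram (\<zeta> $ j) (l $ j))"
      unfolding X_def
      by (rule sum_vec_prod[of "\<lambda>_. Z \<times> UNIV" "\<lambda>j z. gram z (k $ j) * gram z (l $ j)", symmetric]) (use fin in auto)
    finally show "(\<Prod>j\<in>UNIV. bspl 0 (of_int (k $ j) - of_int (l $ j) + 0 $ j)) = (\<Sum>\<zeta>\<in>X. P \<zeta> k * P \<zeta> l)"
      by (simp add: P_def prod.distrib)
  qed
  also have "\<dots> = (\<Sum>k\<in>K. \<Sum>l\<in>K. \<Sum>\<zeta>\<in>X. (a k * P \<zeta> k) * (a l * P \<zeta> l))"
    by (simp add: sum_distrib_left mult_ac)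
  also have "\<dots> = (\<Sum>\<zeta>\<in>X. \<Sum>k\<in>K. \<Sum>l\<in>K. (a k * P \<zeta> k) * (a l * P \<zeta> l))"
    by (subst sum.swap[of _ X], subst sum.swap[of _ X], rule refl)
  also have "\<dots> = (\<Sum>\<zeta>\<in>X. (\<Sum>k\<in>K. a k * P \<zeta> k)\<^sup>2)"
    by (simp add: power2_eq_square sum_product)
  \<comment> \<open>Only the purely diagonal labels are kept. Each of them sees a single node, with
    weight (1 / sqrt 3)^d.\<close>
  also have "\<dots> \<ge> (\<Sum>\<zeta>\<in>(\<lambda>k. \<chi> j. (k $ j, True)) ` K. (\<Sum>k\<in>K. a k * P \<zeta> k)\<^sup>2)"
    using KZ by (intro sum_mono2 X) (auto simp: X_def)
  also have "(\<Sum>\<zeta>\<in>(\<lambda>k. \<chi> j. (k $ j, True)) ` K. (\<Sum>k\<in>K. a k * P \<zeta> k)\<^sup>2)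
      = (\<Sum>k\<in>K. (a k)\<^sup>2 / 3 ^ CARD('n))"
  proof (subst sum.reindex)
    show "inj_on (\<lambda>k. \<chi> j. (k $ j, True)) K"
      by (auto simp: inj_on_def vec_eq_iff)
    show "sum ((\<lambda>\<zeta>. (\<Sum>k\<in>K. a k * P \<zeta> k)\<^sup>2) \<circ> (\<lambda>k. \<chi> j. (k $ j, True))) K = (\<Sum>k\<in>K. (a k)\<^sup>2 / 3 ^ CARD('n))"
    proof (intro sum.cong refl)
      fix k assume k: "k \<in> K"
      have "P (\<chi> j. (k $ j, True)) l = (if l = k then (1 / sqrt 3) ^ CARD('n) else 0)" for l
      proof (cases "l = k")
        case False
        then obtain j where "l $ j \<noteq> k $ j"
          by (auto simp: vec_eq_iff)
        then show ?thesis
          using False by (simp add: P_def gram_def) metis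
      qed (simp add: P_def gram_def)
      then have "(\<Sum>l\<in>K. a l * P (\<chi> j. (k $ j, True)) l) = (\<Sum>l\<in>K. if l = k then a k * (1 / sqrt 3) ^ CARD('n) else 0)"
        by (intro sum.cong refl) (simp only: mult_zero_right split: if_split, simp)
      then have "(\<Sum>l\<in>K. a l * P (\<chi> j. (k $ j, True)) l) = a k * (1 / sqrt 3) ^ CARD('n)"
        using K k by simp
      then show "((\<lambda>\<zeta>. (\<Sum>k\<in>K. a k * P \<zeta> k)\<^sup>2) \<circ> (\<lambda>k. \<chi> j. (k $ j, True))) k = (a k)\<^sup>2 / 3 ^ CARD('n)"
      proof -
        assume "(\<Sum>l\<in>K. a l * P (\<chi> j. (k $ j, True)) l) = a k * (1 / sqrt 3) ^ CARD('n)"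
        moreover have "((1 / sqrt 3) ^ CARD('n))\<^sup>2 = ((1 / sqrt 3)\<^sup>2) ^ CARD('n)"
          by (simp only: power_mult[symmetric] mult.commute)
        ultimately show ?thesis
          by (simp add: power_mult_distrib power_divide)
      qed
    qed
  qed
  finally show ?thesis
    by (simp add: sum_divide_distrib)
qed

lemma corr_minus: "corr K a (- \<sigma>) = corr K a \<sigma>"
proof -
  have "bspl 0 (of_int (k $ j) - of_int (l $ j) + (- \<sigma>) $ j) = bspl 0 (of_int (l $ j) - of_int (k $ j) + \<sigma> $ j)"
    for k l :: "int^'a" and j
    using bspl_even[of "of_int (l $ j) - of_int (k $ j) + \<sigma> $ j"] by (simp add: algebra_simps)
  then show ?thesis
    unfolding corr_def by (subst sum.swap) (simp add: mult_ac)
qed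

lemma exists_large_component:
  fixes s :: "real^'n::finite"
  shows "\<exists>j. norm s \<le> CARD('n) * \<bar>s $ j\<bar>"
proof (rule ccontr)
  assume "\<not> ?thesis"
  then have "CARD('n) * \<bar>s $ j\<bar> < norm s" for j
    by (auto simp: not_le)
  then have "\<bar>s $ j\<bar> < norm s / CARD('n)" for j
    by (simp add: field_simps)
  then have "(\<Sum>j\<in>(UNIV::'n set). \<bar>s $ j\<bar>) < (\<Sum>j\<in>(UNIV::'n set). norm s / CARD('n))"
    by (intro sum_strict_mono) auto
  then show False
    using norm_le_l1_cart[of s] by simp
qed

context grid
begin

text \<open>Some coordinate of \<open>s\<close> has size at least |s|/d. After \<open>n\<close>
  shifts the displacement there is at least 2 (R + H), which exceeds the spread 2 R of the nodes by
  the support radius of the spline, so the correlation is 0. Then \<open>corr_telescope\<close> and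
  \<open>mass_coercive\<close> combine.\<close>

lemma corr_coercive:
  assumes K: "finite K" and R: "\<And>k. k \<in> K \<Longrightarrow> norm (grid_point h k) \<le> R"
    and s: "s \<noteq> 0" "norm s \<le> r"
  shows "(norm s)\<^sup>2 * (\<Sum>k\<in>K. (a k)\<^sup>2) / (3 ^ CARD('n) * (2 * (R + H) * CARD('n) + r)\<^sup>2)
      \<le> corr K a 0 - corr K a (\<chi> j. s $ j / h $ j)"
proof (cases "K = {}")
  case True
  then show ?thesis
    by (simp add: corr_def)
next
  case False
  then have "R \<ge> 0"
    using R norm_ge_zero order_trans by blast
  let ?Q = "2 * (R + H) * CARD('n) + r" and ?\<sigma> = "\<chi> j. s $ j / h $ j"
  \<comment> \<open>The least number of shifts that suffices. Rounding up costs at most one more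
    \<open>norm s\<close>, which is the summand \<open>r\<close> in the denominator of the
    claim.\<close>
  define n where "n = nat \<lceil>2 * (R + H) * CARD('n) / norm s\<rceil>"
  have pos: "2 * (R + H) * CARD('n) / norm s > 0"
    using \<open>R \<ge> 0\<close> H s by (simp add: add_nonneg_pos)
  have n: "2 * (R + H) * CARD('n) / norm s \<le> real n" "real n \<le> 2 * (R + H) * CARD('n) / norm s + 1"
    using pos unfolding n_def by linarith+
  have nQ: "real n * norm s \<le> ?Q"
  proof -
    have "real n * norm s \<le> (2 * (R + H) * CARD('n) / norm s + 1) * norm s"
      by (intro mult_right_mono n) auto
    also have "\<dots> = 2 * (R + H) * CARD('n) + norm s"
      using s by (simp add: field_simps)
    finally show ?thesis
      using s by linarith
  qed
  have "corr K a (real n *\<^sub>R ?\<sigma>) = 0"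
    unfolding corr_def
  proof (intro sum.neutral ballI)
    fix k l assume kl: "k \<in> K" "l \<in> K"
    obtain j where j: "norm s \<le> CARD('n) * \<bar>s $ j\<bar>"
      using exists_large_component by blast
    have "CARD('n) * (2 * (R + H)) \<le> real n * norm s"
      using n(1) s by (simp add: field_simps)
    also have "\<dots> \<le> real n * (CARD('n) * \<bar>s $ j\<bar>)"
      by (intro mult_left_mono j) auto
    finally have "CARD('n) * (2 * (R + H)) \<le> CARD('n) * (real n * \<bar>s $ j\<bar>)"
      by (simp add: mult_ac)
    then have ns: "2 * (R + H) \<le> \<bar>real n * s $ j\<bar>"
      by (simp add: abs_mult)
    have "\<bar>of_int (k $ j) * h $ j\<bar> \<le> R" "\<bar>of_int (l $ j) * h $ j\<bar> \<le> R"
      using R[OF kl(1)] R[OF kl(2)] component_le_norm_cart[of "grid_point h k" j]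
        component_le_norm_cart[of "grid_point h l" j] by (simp_all add: grid_point_def)
    then have "2 * h $ j \<le> \<bar>of_int (k $ j) * h $ j - of_int (l $ j) * h $ j + real n * s $ j\<bar>"
    proof -
      have "2 * x \<le> \<bar>A - B + C\<bar>" if "\<bar>A\<bar> \<le> R" "\<bar>B\<bar> \<le> R" "2 * (R + H) \<le> \<bar>C\<bar>" "x \<le> H" for A B C x
        using that by (auto simp: abs_if split: if_splits)
      then show ?thesis
        using \<open>\<bar>of_int (k $ j) * h $ j\<bar> \<le> R\<close> \<open>\<bar>of_int (l $ j) * h $ j\<bar> \<le> R\<close> ns h_bounds(2)[of j] by blast
    qed
    also have "of_int (k $ j) * h $ j - of_int (l $ j) * h $ j + real n * s $ j
        = (of_int (k $ j) - of_int (l $ j) + (real n *\<^sub>R ?\<sigma>) $ j) * h $ j"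
      using h_pos[of j] by (simp add: field_simps)
    finally have "2 \<le> \<bar>of_int (k $ j) - of_int (l $ j) + (real n *\<^sub>R ?\<sigma>) $ j\<bar>"
      using h_pos[of j] by (simp only: abs_mult abs_of_pos mult_le_cancel_right_pos)
    then have "bspl 0 (of_int (k $ j) - of_int (l $ j) + (real n *\<^sub>R ?\<sigma>) $ j) = 0"
      by (intro bspl_eq_0) auto
    then have "(\<Prod>j\<in>UNIV. bspl 0 (of_int (k $ j) - of_int (l $ j) + (real n *\<^sub>R ?\<sigma>) $ j)) = 0"
      by (intro prod_zero) auto
    then show "a k * a l * (\<Prod>j\<in>UNIV. bspl 0 (of_int (k $ j) - of_int (l $ j) + (real n *\<^sub>R ?\<sigma>) $ j)) = 0"
      by simp
  qed
  then have "corr K a 0 \<le> (real n)\<^sup>2 * (corr K a 0 - corr K a ?\<sigma>)"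
    using corr_telescope[OF K, of a n ?\<sigma>] by simp
  then have le: "(\<Sum>k\<in>K. (a k)\<^sup>2) / 3 ^ CARD('n) \<le> (real n)\<^sup>2 * (corr K a 0 - corr K a ?\<sigma>)"
    using mass_coercive[OF K, of a] by linarith
  have "(norm s)\<^sup>2 * ((\<Sum>k\<in>K. (a k)\<^sup>2) / 3 ^ CARD('n)) \<le> (norm s)\<^sup>2 * ((real n)\<^sup>2 * (corr K a 0 - corr K a ?\<sigma>))"
    by (intro mult_left_mono le) auto
  also have "\<dots> = (real n * norm s)\<^sup>2 * (corr K a 0 - corr K a ?\<sigma>)"
    by (simp add: power_mult_distrib)
  also have "\<dots> \<le> ?Q\<^sup>2 * (corr K a 0 - corr K a ?\<sigma>)"
  proof (intro mult_right_mono power_mono nQ)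
    have "0 \<le> (\<Sum>k\<in>K. (a k)\<^sup>2) / 3 ^ CARD('n)"
      by (simp add: sum_nonneg)
    then have "0 \<le> (real n)\<^sup>2 * (corr K a 0 - corr K a ?\<sigma>)"
      using le by linarith
    moreover have "real n > 0"
      using n pos by linarith
    ultimately show "0 \<le> corr K a 0 - corr K a ?\<sigma>"
      by (simp add: zero_le_mult_iff)
  qed simp
  finally have main: "(norm s)\<^sup>2 * ((\<Sum>k\<in>K. (a k)\<^sup>2) / 3 ^ CARD('n)) \<le> ?Q\<^sup>2 * (corr K a 0 - corr K a ?\<sigma>)" .
  have "0 < real n * norm s"
    using n pos s by (intro mult_pos_pos) auto
  then have "?Q > 0"
    using nQ by linarith
  then show ?thesis
    using main by (simp add: divide_le_eq mult_ac)
qed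

end

subsection \<open>Stability of the scheme\<close>

lemma rk_interp_finite:
  assumes "finite K" "{k. c k \<noteq> 0} \<subseteq> K" "\<And>j. h $ j > 0"
  shows "rk_interp h c x = (\<Sum>k\<in>K. basis_deriv h (\<lambda>_. 0) k x *\<^sub>R c k)"
proof -
  have "rk_interp h c x = (\<Sum>\<^sub>\<infinity>k\<in>K. rk_basis h k x *\<^sub>R c k)"
    unfolding rk_interp_def using assms by (intro infsum_cong_neutral) auto
  then show ?thesis
    using assms by (simp add: rk_basis_eq)
qed

locale scheme = grid h \<eta> H + horizon \<rho> \<delta>
  for h :: "real^'n::finite" and \<eta> H :: real and \<rho> :: "real \<Rightarrow> real" and \<delta> :: real
begin

abbreviation b :: "int^'n \<Rightarrow> real^'n \<Rightarrow> real" where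
  "b \<equiv> basis_deriv h (\<lambda>_. 0)"

lemma smooth_bdd_basis: "N \<le> 2 \<Longrightarrow> smooth_bdd N (2 ^ CARD('n) / (\<eta> * H) ^ N) (b k)"
  using smooth_bdd_sum_basis[of "{k}" N "\<lambda>_. 1"] by simp

lemma basis_at_node:
  "b k (grid_point h l + s) = (\<Prod>j\<in>UNIV. bspl 0 (of_int (l $ j) - of_int (k $ j) + s $ j / h $ j))"
  unfolding basis_deriv_def
proof (intro prod.cong refl)
  fix j
  have "(grid_point h l + s) $ j / h $ j - of_int (k $ j) = of_int (l $ j) - of_int (k $ j) + s $ j / h $ j"
    using h_pos[of j] by (simp add: grid_point_def field_simps)
  then show "bspl 0 ((grid_point h l + s) $ j / h $ j - of_int (k $ j)) / h $ j ^ 0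
      = bspl 0 (of_int (l $ j) - of_int (k $ j) + s $ j / h $ j)"
    by (simp only: power_0 div_by_1)
qed

lemma basis_at_node_swap: "b k (grid_point h l - s) = b l (grid_point h k + s)"
proof -
  have "b k (grid_point h l - s) = b k (grid_point h l + (- s))"
    by simp
  also have "\<dots> = b l (grid_point h k + s)"
    unfolding basis_at_node
  proof (intro prod.cong refl)
    fix j
    show "bspl 0 (of_int (l $ j) - of_int (k $ j) + (- s) $ j / h $ j) = bspl 0 (of_int (k $ j) - of_int (l $ j) + s $ j / h $ j)"
      using bspl_even[of "of_int (k $ j) - of_int (l $ j) + s $ j / h $ j"] by (simp add: algebra_simps)
  qed
  finally show ?thesis .
qed

text \<open>The discrete gradient is the negative transpose of the discrete divergence.\<close>

lemma S_basis_antisym: "S i (b k) (grid_point h l) = - S i (b l) (grid_point h k)"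
proof -
  have [measurable]: "b l \<in> borel_measurable borel"
    by (rule smooth_bdd_measurable[OF smooth_bdd_basis[of 1]]) auto
  have [measurable]: "b k \<in> borel_measurable borel"
    by (rule smooth_bdd_measurable[OF smooth_bdd_basis[of 1]]) auto
  have "S i (b k) (grid_point h l)
      = (\<integral>s. \<kappa> s * ((- s) $ i * (b k (grid_point h l + - s) - b k (grid_point h l))) \<partial>lborel)"
    unfolding S_def by (rule kernel_minus[symmetric]) measurable
  also have "\<dots> = (\<integral>s. - (\<kappa> s * (s $ i * (b l (grid_point h k + s) - b l (grid_point h k)))) \<partial>lborel)"
    using basis_at_node_swap[of k l] basis_at_node_swap[of k l 0] by (simp add: algebra_simps)
  finally show ?thesis
    by (simp add: S_def)
qed

text \<open>The discrete divergence reaches nodes beyond \<open>K\<close>, and beyond the domain, by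
  about \<delta> plus the spline support. The interpolation inside the scheme uses all of them, and
  exactly this completes the square in \<open>grad_div_semidefinite\<close>.\<close>

definition halo :: "(int^'n) set \<Rightarrow> (int^'n) set" where
  "halo K = {l. \<exists>k\<in>K. \<exists>i. S i (b k) (grid_point h l) \<noteq> 0}"

lemma S_basis_far:
  assumes "\<bar>of_int (l $ j) - of_int (k $ j)\<bar> \<ge> 2 + \<delta> / h $ j"
  shows "S i (b k) (grid_point h l) = 0"
proof -
  have "\<kappa> s * (s $ i * (b k (grid_point h l + s) - b k (grid_point h l))) = 0" for s
  proof (cases "norm s < \<delta>")
    case True
    then have "\<bar>s $ j\<bar> / h $ j \<le> \<delta> / h $ j"
      using component_le_norm_cart[of s j] h_pos[of j] by (intro divide_right_mono) auto
    then have sj: "\<bar>s $ j / h $ j\<bar> \<le> \<delta> / h $ j"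
      using h_pos[of j] by (simp add: abs_divide)
    have zero: "b k (grid_point h l + t) = 0" if "\<bar>t $ j / h $ j\<bar> \<le> \<delta> / h $ j" for t
    proof -
      have "bspl 0 (of_int (l $ j) - of_int (k $ j) + t $ j / h $ j) = 0"
        using assms that by (intro bspl_eq_0) linarith+
      then show ?thesis
        unfolding basis_at_node by (intro prod_zero) auto
    qed
    show ?thesis
      using zero[OF sj] zero[of 0] \<delta> h_pos[of j] by simp
  qed (simp add: \<kappa>_support)
  then show ?thesis
    by (simp only: S_def Bochner_Integration.integral_zero)
qed

lemma finite_halo:
  assumes "finite K"
  shows "finite (halo K)"
proof (rule finite_subset)
  let ?m = "\<lambda>j. \<lceil>2 + \<delta> / h $ j\<rceil>"
  show "halo K \<subseteq> (\<Union>k\<in>K. {l. \<forall>j. l $ j \<in> {k $ j - ?m j..k $ j + ?m j}})"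
  proof
    fix l assume "l \<in> halo K"
    then obtain k i where k: "k \<in> K" "S i (b k) (grid_point h l) \<noteq> 0"
      by (auto simp: halo_def)
    have "l $ j \<in> {k $ j - ?m j..k $ j + ?m j}" for j
    proof -
      have "\<bar>real_of_int (l $ j) - of_int (k $ j)\<bar> < 2 + \<delta> / h $ j"
        using S_basis_far[of j l k i] k by (meson not_less)
      then show ?thesis
        by simp linarith
    qed
    then show "l \<in> (\<Union>k\<in>K. {l. \<forall>j. l $ j \<in> {k $ j - ?m j..k $ j + ?m j}})"
      using k by auto
  qed
  show "finite (\<Union>k\<in>K. {l. \<forall>j. l $ j \<in> {k $ j - ?m j..k $ j + ?m j}})"
    using assms by (intro finite_UN_I finite_vec_box) auto
qed

lemma Bo_sum_basis: "Bo i j (\<lambda>x. \<Sum>k\<in>K. c k * b k x) x = (\<Sum>k\<in>K. c k * Bo i j (b k) x)"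
proof -
  have "(\<Sum>k\<in>K. c k * Bo i j (b k) x) = (\<integral>s. (\<Sum>k\<in>K. c k * (\<kappa> s * (s $ i * s $ j / (norm s)\<^sup>2
      * (b k (x + s) + b k (x - s) - 2 * b k x)))) \<partial>lborel) / 2"
    unfolding Bo_def
    by (subst Bochner_Integration.integral_sum, intro integrable_mult_right Bo_integrable'[OF smooth_bdd_basis[OF order_refl]])
      (simp only: sum_divide_distrib integral_mult_right_zero times_divide_eq_right)
  also have "\<dots> = Bo i j (\<lambda>x. \<Sum>k\<in>K. c k * b k x) x"
    unfolding Bo_def
    by (intro arg_cong[of _ _ "\<lambda>x. x / 2"] Bochner_Integration.integral_cong refl)
      (simp add: sum_distrib_left sum_subtractf sum.distrib distrib_left right_diff_distrib mult_ac
        sum_divide_distrib add_divide_distrib diff_divide_distrib)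
  finally show ?thesis ..
qed

lemma S_sum_basis: "S i (\<lambda>x. \<Sum>k\<in>K. c k * b k x) x = (\<Sum>k\<in>K. c k * S i (b k) x)"
  using smooth_bdd_basis[of 1] by (intro S_sum) auto

lemma rk_interp_component:
  assumes "finite K" "{k. e k \<noteq> 0} \<subseteq> K"
  shows "rk_interp h e x $ i = (\<Sum>k\<in>K. e k $ i * b k x)"
  by (simp add: rk_interp_finite[OF assms h_pos] mult.commute)

definition node_div :: "(int^'n) set \<Rightarrow> (int^'n \<Rightarrow> real^'n) \<Rightarrow> int^'n \<Rightarrow> real" where
  "node_div K e l = (\<Sum>p\<in>UNIV. \<Sum>k\<in>K. e k $ p * S p (b k) (grid_point h l))"

lemma node_div_outside_halo: "l \<notin> halo K \<Longrightarrow> node_div K e l = 0"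
  unfolding node_div_def halo_def by (intro sum.neutral) auto

lemma nonlocal_div_node:
  assumes "finite K" "{k. e k \<noteq> 0} \<subseteq> K"
  shows "nonlocal_div \<rho> \<delta> (rk_interp h e) (grid_point h l) = node_div K e l"
proof -
  let ?L = "\<lambda>i. \<Sum>k\<in>K. \<bar>e k $ i\<bar> * (2 ^ CARD('n) / (\<eta> * H) ^ 1)"
  have "smooth_bdd 1 (Max (range ?L)) (\<lambda>x. rk_interp h e x $ i)" for i
    unfolding rk_interp_component[OF assms]
    by (rule smooth_bdd_mono[OF smooth_bdd_sum_basis[OF assms(1)]]) auto
  from nonlocal_div_eq[OF this] show ?thesis
    by (simp add: rk_interp_component[OF assms] S_sum_basis node_div_def)
qed

lemma discrete_operator_eq:
  assumes K: "finite K" "{k. e k \<noteq> 0} \<subseteq> K"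
  shows "discrete_operator lam \<mu> \<rho> \<delta> h (rk_interp h e) x $ i =
     (C_alpha CARD('n) * \<mu> / CARD('n)) * (\<Sum>j\<in>UNIV. \<Sum>k\<in>K. e k $ j * Bo i j (b k) x)
     + (C_beta CARD('n) * (lam - \<mu>) / CARD('n)) * (\<Sum>l\<in>halo K. node_div K e l * S i (b l) x)"
proof -
  let ?v = "rk_interp h e"
  let ?L = "\<lambda>N i. \<Sum>k\<in>K. \<bar>e k $ i\<bar> * (2 ^ CARD('n) / (\<eta> * H) ^ N)"
  have v: "smooth_bdd N (Max (range (?L N))) (\<lambda>x. ?v x $ i)" if "N \<le> 2" for N i
    unfolding rk_interp_component[OF K]
    by (rule smooth_bdd_mono[OF smooth_bdd_sum_basis[OF K(1) that]]) auto
  have "bond_operator \<rho> \<delta> ?v x $ i = (\<Sum>j\<in>UNIV. Bo i j (\<lambda>x. ?v x $ j) x)"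
    using v[of 1] v[of 2] by (intro bond_operator_eq) auto
  then have 1: "bond_operator \<rho> \<delta> ?v x $ i = (\<Sum>j\<in>UNIV. \<Sum>k\<in>K. e k $ j * Bo i j (b k) x)"
    by (simp add: rk_interp_component[OF K] Bo_sum_basis)
  have r: "grid_restriction h (nonlocal_div \<rho> \<delta> ?v) l = node_div K e l" for l
    using nonlocal_div_node[OF K] by (simp add: grid_restriction_def)
  have P: "rk_projection h (nonlocal_div \<rho> \<delta> ?v) = (\<lambda>x. \<Sum>l\<in>halo K. node_div K e l * b l x)"
  proof
    fix x
    have "rk_interp h (grid_restriction h (nonlocal_div \<rho> \<delta> ?v)) x
        = (\<Sum>l\<in>halo K. b l x *\<^sub>R grid_restriction h (nonlocal_div \<rho> \<delta> ?v) l)"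
      using node_div_outside_halo by (intro rk_interp_finite[OF finite_halo[OF K(1)] _ h_pos]) (auto simp: r)
    then show "rk_projection h (nonlocal_div \<rho> \<delta> ?v) x = (\<Sum>l\<in>halo K. node_div K e l * b l x)"
      by (simp add: rk_projection_def r mult.commute)
  qed
  have "nonlocal_grad \<rho> \<delta> (rk_projection h (nonlocal_div \<rho> \<delta> ?v)) x $ i = (\<Sum>l\<in>halo K. node_div K e l * S i (b l) x)"
    unfolding P by (subst nonlocal_grad_eq[OF smooth_bdd_sum_basis[OF finite_halo[OF K(1)]]]) (simp_all add: S_sum_basis)
  with 1 show ?thesis
    by (simp add: discrete_operator_def)
qed

lemma discrete_operator_diff:
  assumes K: "finite K" "{k. e k \<noteq> 0} \<subseteq> K" "{k. e' k \<noteq> 0} \<subseteq> K"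
  shows "discrete_operator lam \<mu> \<rho> \<delta> h (rk_interp h (\<lambda>k. e k - e' k)) x =
     discrete_operator lam \<mu> \<rho> \<delta> h (rk_interp h e) x - discrete_operator lam \<mu> \<rho> \<delta> h (rk_interp h e') x"
proof -
  have supp: "{k. e k - e' k \<noteq> 0} \<subseteq> K"
  proof
    fix k assume "k \<in> {k. e k - e' k \<noteq> 0}"
    then have "e k \<noteq> 0 \<or> e' k \<noteq> 0"
      by auto
    then show "k \<in> K"
      using K(2,3) by blast
  qed
  have "node_div K (\<lambda>k. e k - e' k) l = node_div K e l - node_div K e' l" for l
    by (simp add: node_div_def left_diff_distrib sum_subtractf)
  then show ?thesis
    unfolding vec_eq_iff vector_minus_component discrete_operator_eq[OF K(1,2)] discrete_operator_eq[OF K(1,3)]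
      discrete_operator_eq[OF K(1) supp] \<open>\<And>l. node_div K (\<lambda>k. e k - e' k) l = node_div K e l - node_div K e' l\<close>
    by (simp add: left_diff_distrib sum_subtractf right_diff_distrib diff_divide_distrib)
qed

text \<open>By \<open>S_basis_antisym\<close> the sum over \<open>K\<close> of \<open>e\<close>
  against the discrete gradient is minus that of its divergence against the same nodal values, so
  the form is minus the sum of squares of \<open>node_div\<close> over the halo.\<close>

lemma grad_div_semidefinite:
  assumes "finite K"
  shows "(\<Sum>k\<in>K. \<Sum>i\<in>UNIV. e k $ i * (\<Sum>l\<in>halo K. node_div K e l * S i (b l) (grid_point h k))) \<le> 0"
proof -
  have "(\<Sum>k\<in>K. \<Sum>i\<in>UNIV. e k $ i * (\<Sum>l\<in>halo K. node_div K e l * S i (b l) (grid_point h k)))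
     = (\<Sum>k\<in>K. \<Sum>i\<in>UNIV. \<Sum>l\<in>halo K. - (node_div K e l * (e k $ i * S i (b k) (grid_point h l))))"
  proof -
    have "e k $ i * (node_div K e l * S i (b l) (grid_point h k))
        = - (node_div K e l * (e k $ i * S i (b k) (grid_point h l)))" for k i l
      using S_basis_antisym[of i l k] by simp
    then show ?thesis
      by (simp only: sum_distrib_left)
  qed
  also have "\<dots> = (\<Sum>l\<in>halo K. \<Sum>i\<in>UNIV. \<Sum>k\<in>K. - (node_div K e l * (e k $ i * S i (b k) (grid_point h l))))"
    by (subst sum.swap[of _ UNIV K], subst sum.swap[of _ "halo K" K], subst sum.swap[of _ "halo K" UNIV], rule refl)
  also have "\<dots> = (\<Sum>l\<in>halo K. - (node_div K e l * node_div K e l))"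
    by (simp add: node_div_def[of K e] sum_negf sum_distrib_left)
  also have "\<dots> \<le> 0"
    by (simp add: sum_nonneg sum_negf)
  finally show ?thesis .
qed

text \<open>The constant of \<open>corr_coercive\<close> with \<open>r\<close> = \<delta>, since
  only displacements shorter than \<delta> carry weight.\<close>

definition c_stab :: "real \<Rightarrow> real" where
  "c_stab R = 1 / (3 ^ CARD('n) * (2 * (R + H) * CARD('n) + \<delta>)\<^sup>2)"

text \<open>A fixed \<open>s\<close> sees the coefficients only through their components along
  \<open>s\<close>. The left side is -2 \<kappa>(s) / |s|^2 times \<open>corr K a 0\<close> minus
  the correlation at lag s/h, and coercivity returns the factor |s|^2.\<close>

lemma bond_pointwise:
  assumes K: "finite K" and R: "\<And>k. k \<in> K \<Longrightarrow> norm (grid_point h k) \<le> R"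
  shows "(\<Sum>k\<in>K. \<Sum>i\<in>UNIV. \<Sum>j\<in>UNIV. \<Sum>l\<in>K. e k $ i * e l $ j * (\<kappa> s * (s $ i * s $ j / (norm s)\<^sup>2
        * (b l (grid_point h k + s) + b l (grid_point h k - s) - 2 * b l (grid_point h k)))))
     \<le> - 2 * c_stab R * (\<Sum>k\<in>K. \<Sum>i\<in>UNIV. \<Sum>j\<in>UNIV. e k $ i * e k $ j * (\<kappa> s * (s $ i * s $ j)))"
    (is "?lhs \<le> ?rhs")
proof (cases "s = 0 \<or> norm s \<ge> \<delta>")
  case True
  then show ?thesis
    by (auto simp: \<kappa>_support)
next
  case False
  define a where "a k = (\<Sum>i\<in>UNIV. e k $ i * s $ i)" for k
  have aa: "a k * a l = (\<Sum>i\<in>UNIV. \<Sum>j\<in>UNIV. e k $ i * e l $ j * (s $ i * s $ j))" for k l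
    unfolding a_def sum_product by (intro sum.cong refl) simp
  let ?\<sigma> = "\<chi> j. s $ j / h $ j"
  have corr: "corr K a (\<chi> j. t $ j / h $ j) = (\<Sum>k\<in>K. \<Sum>l\<in>K. a k * a l * b l (grid_point h k + t))" for t
    unfolding corr_def basis_at_node by simp
  have "(\<Sum>i\<in>UNIV. \<Sum>j\<in>UNIV. \<Sum>l\<in>K. e k $ i * e l $ j * (\<kappa> s * (s $ i * s $ j / (norm s)\<^sup>2 * D l)))
      = \<kappa> s / (norm s)\<^sup>2 * (\<Sum>l\<in>K. a k * a l * D l)" for k D
  proof -
    have "\<kappa> s / (norm s)\<^sup>2 * (\<Sum>l\<in>K. a k * a l * D l)
        = (\<Sum>l\<in>K. \<Sum>i\<in>UNIV. \<Sum>j\<in>UNIV. e k $ i * e l $ j * (\<kappa> s * (s $ i * s $ j / (norm s)\<^sup>2 * D l)))"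
      unfolding aa sum_distrib_left sum_distrib_right by (intro sum.cong refl) (simp add: mult_ac)
    also have "\<dots> = (\<Sum>i\<in>UNIV. \<Sum>j\<in>UNIV. \<Sum>l\<in>K. e k $ i * e l $ j * (\<kappa> s * (s $ i * s $ j / (norm s)\<^sup>2 * D l)))"
      by (subst sum.swap[of _ UNIV K], subst sum.swap[of _ UNIV K], rule refl)
    finally show ?thesis ..
  qed
  then have "?lhs = \<kappa> s / (norm s)\<^sup>2 * (\<Sum>k\<in>K. \<Sum>l\<in>K. a k * a l *
      (b l (grid_point h k + s) + b l (grid_point h k - s) - 2 * b l (grid_point h k)))"
    by (simp only: sum_distrib_left)
  also have "(\<Sum>k\<in>K. \<Sum>l\<in>K. a k * a l * (b l (grid_point h k + s) + b l (grid_point h k - s) - 2 * b l (grid_point h k)))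
      = corr K a ?\<sigma> + corr K a (- ?\<sigma>) - 2 * corr K a 0"
  proof -
    have m: "- ?\<sigma> = (\<chi> j. (- s) $ j / h $ j)" "(0 :: real^'n) = (\<chi> j. 0 $ j / h $ j)"
      by (simp_all add: vec_eq_iff)
    show ?thesis
      unfolding m(1) by (subst m(2)) (unfold corr, simp add: sum.distrib sum_subtractf sum_distrib_left algebra_simps)
  qed
  also have "\<kappa> s / (norm s)\<^sup>2 * \<dots> = - 2 * (\<kappa> s / (norm s)\<^sup>2 * (corr K a 0 - corr K a ?\<sigma>))"
    by (simp add: corr_minus algebra_simps)
  also have "\<dots> \<le> - 2 * (\<kappa> s / (norm s)\<^sup>2 * (c_stab R * ((norm s)\<^sup>2 * (\<Sum>k\<in>K. (a k)\<^sup>2))))"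
  proof -
    have "c_stab R * ((norm s)\<^sup>2 * (\<Sum>k\<in>K. (a k)\<^sup>2)) \<le> corr K a 0 - corr K a ?\<sigma>"
      using corr_coercive[OF K R, of s \<delta> a] False by (simp add: c_stab_def)
    then have "\<kappa> s / (norm s)\<^sup>2 * (c_stab R * ((norm s)\<^sup>2 * (\<Sum>k\<in>K. (a k)\<^sup>2))) \<le> \<kappa> s / (norm s)\<^sup>2 * (corr K a 0 - corr K a ?\<sigma>)"
      using \<kappa>_nonneg[of s] by (intro mult_left_mono) auto
    then show ?thesis
      by linarith
  qed
  also have "\<dots> = - 2 * c_stab R * (\<kappa> s * (\<Sum>k\<in>K. (a k)\<^sup>2))"
    using False by simp
  also have "\<kappa> s * (\<Sum>k\<in>K. (a k)\<^sup>2) = (\<Sum>k\<in>K. \<Sum>i\<in>UNIV. \<Sum>j\<in>UNIV. e k $ i * e k $ j * (\<kappa> s * (s $ i * s $ j)))"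
    unfolding power2_eq_square aa sum_distrib_left by (intro sum.cong refl) (simp add: mult_ac)
  finally show ?thesis .
qed

text \<open>Each displacement controls one direction only. After integration the second moment
  matrix, the identity, weighs all directions equally and restores the full norm of the
  coefficients.\<close>

lemma bond_coercive:
  assumes K: "finite K" and R: "\<And>k. k \<in> K \<Longrightarrow> norm (grid_point h k) \<le> R"
  shows "(\<Sum>k\<in>K. \<Sum>i\<in>UNIV. e k $ i * (\<Sum>j\<in>UNIV. \<Sum>l\<in>K. e l $ j * Bo i j (b l) (grid_point h k)))
     \<le> - c_stab R * (\<Sum>k\<in>K. (norm (e k))\<^sup>2)"
proof -
  let ?f = "\<lambda>k i j l s. \<kappa> s * (s $ i * s $ j / (norm s)\<^sup>2
        * (b l (grid_point h k + s) + b l (grid_point h k - s) - 2 * b l (grid_point h k)))"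
  have f: "has_bochner_integral lborel (?f k i j l) (2 * Bo i j (b l) (grid_point h k))" for k i j l
    using Bo_integrable'[OF smooth_bdd_basis[of 2]] by (simp add: has_bochner_integral_iff Bo_def)
  have m: "has_bochner_integral lborel (\<lambda>s. \<kappa> s * (s $ i * s $ j)) (if i = j then 1 else 0)" for i j
    using second_moment_integrable second_moment by (simp add: has_bochner_integral_iff)
  have 1: "has_bochner_integral lborel (\<lambda>s. \<Sum>k\<in>K. \<Sum>i\<in>UNIV. \<Sum>j\<in>UNIV. \<Sum>l\<in>K. e k $ i * e l $ j * ?f k i j l s)
     (\<Sum>k\<in>K. \<Sum>i\<in>UNIV. \<Sum>j\<in>UNIV. \<Sum>l\<in>K. e k $ i * e l $ j * (2 * Bo i j (b l) (grid_point h k)))"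
    by (intro has_bochner_integral_sum has_bochner_integral_mult_right f)
  have 2: "has_bochner_integral lborel (\<lambda>s. - 2 * c_stab R * (\<Sum>k\<in>K. \<Sum>i\<in>UNIV. \<Sum>j\<in>UNIV. e k $ i * e k $ j * (\<kappa> s * (s $ i * s $ j))))
     (- 2 * c_stab R * (\<Sum>k\<in>K. \<Sum>i\<in>UNIV. \<Sum>j\<in>UNIV. e k $ i * e k $ j * (if i = j then 1 else 0)))"
    by (intro has_bochner_integral_sum has_bochner_integral_mult_right m)
  have "(\<Sum>k\<in>K. \<Sum>i\<in>UNIV. \<Sum>j\<in>UNIV. \<Sum>l\<in>K. e k $ i * e l $ j * (2 * Bo i j (b l) (grid_point h k)))
      \<le> - 2 * c_stab R * (\<Sum>k\<in>K. \<Sum>i\<in>UNIV. \<Sum>j\<in>UNIV. e k $ i * e k $ j * (if i = j then 1 else 0))"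
    using integral_mono[OF 1[unfolded has_bochner_integral_iff, THEN conjunct1]
        2[unfolded has_bochner_integral_iff, THEN conjunct1] bond_pointwise[OF K R]]
    unfolding 1[unfolded has_bochner_integral_iff, THEN conjunct2] 2[unfolded has_bochner_integral_iff, THEN conjunct2] .
  moreover have "(\<Sum>k\<in>K. \<Sum>i\<in>UNIV. \<Sum>j\<in>UNIV. e k $ i * e k $ j * (if i = j then 1 else 0)) = (\<Sum>k\<in>K. (norm (e k))\<^sup>2)"
    by (simp add: power2_norm_eq_inner inner_vec_def if_distrib cong: if_cong)
  moreover have "(\<Sum>k\<in>K. \<Sum>i\<in>UNIV. \<Sum>j\<in>UNIV. \<Sum>l\<in>K. e k $ i * e l $ j * (2 * Bo i j (b l) (grid_point h k)))
      = 2 * (\<Sum>k\<in>K. \<Sum>i\<in>UNIV. e k $ i * (\<Sum>j\<in>UNIV. \<Sum>l\<in>K. e l $ j * Bo i j (b l) (grid_point h k)))"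
    by (simp add: sum_distrib_left mult_ac)
  ultimately show ?thesis
    by simp
qed

theorem stability:
  assumes K: "finite K" "{k. e k \<noteq> 0} \<subseteq> K" and R: "\<And>k. k \<in> K \<Longrightarrow> norm (grid_point h k) \<le> R"
    and Lame: "\<mu> > 0" "lam \<ge> \<mu>"
  shows "(\<Sum>k\<in>K. e k \<bullet> discrete_operator lam \<mu> \<rho> \<delta> h (rk_interp h e) (grid_point h k))
     \<le> - (C_alpha CARD('n) * \<mu> / CARD('n)) * (c_stab R * (\<Sum>k\<in>K. (norm (e k))\<^sup>2))"
proof -
  let ?\<alpha> = "C_alpha CARD('n) * \<mu> / CARD('n)" and ?\<beta> = "C_beta CARD('n) * (lam - \<mu>) / CARD('n)"
  have \<alpha>: "?\<alpha> \<ge> 0" and \<beta>: "?\<beta> \<ge> 0"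
    using Lame by (simp_all add: C_alpha_def C_beta_def)
  have "(\<Sum>k\<in>K. e k \<bullet> discrete_operator lam \<mu> \<rho> \<delta> h (rk_interp h e) (grid_point h k))
     = ?\<alpha> * (\<Sum>k\<in>K. \<Sum>i\<in>UNIV. e k $ i * (\<Sum>j\<in>UNIV. \<Sum>l\<in>K. e l $ j * Bo i j (b l) (grid_point h k)))
     + ?\<beta> * (\<Sum>k\<in>K. \<Sum>i\<in>UNIV. e k $ i * (\<Sum>l\<in>halo K. node_div K e l * S i (b l) (grid_point h k)))"
    unfolding inner_vec_def discrete_operator_eq[OF K] inner_real_def distrib_left sum.distrib
      mult.left_commute[of "e _ $ _"]
    by (simp only: sum_distrib_left)
  also have "\<dots> \<le> ?\<alpha> * (- c_stab R * (\<Sum>k\<in>K. (norm (e k))\<^sup>2)) + ?\<beta> * 0"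
    by (intro add_mono mult_left_mono bond_coercive grad_div_semidefinite K R \<alpha> \<beta>)
  finally show ?thesis
    by simp
qed

end

subsection \<open>Consistency of the scheme\<close>

lemma local_operator_component:
  "local_operator lam \<mu> u x $ i = \<mu> * (\<Sum>p\<in>UNIV. iter_partial [p, p] (\<lambda>x. u x $ i) x)
     + (\<mu> + lam) * partial_deriv i (divergence u) x"
  by (simp add: local_operator_def divergence_def[of "gradient _"] gradient_def)

context scheme
begin

text \<open>The error splits as \<open>S p\<close> of (P - U) plus the consistency error of
  \<open>S p\<close> on U. Applied to a translation difference, the first part uses second
  derivatives of P - U, and the second uses third derivatives of the difference, that is, fourth
  derivatives of U.\<close>

lemma div_lipschitz:
  fixes M B :: real
  assumes P: "smooth_bdd 1 LP P" and PU: "smooth_bdd 2 M (\<lambda>x. P x - U x)"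
    and U1: "smooth_bdd 1 LU U" and U4: "smooth_bdd 4 B U"
  shows "\<bar>(S p P (x + a) - partial_deriv p U (x + a)) - (S p P x - partial_deriv p U x)\<bar>
     \<le> (CARD('n)\<^sup>2 * M + CARD('n) ^ 4 * \<delta>\<^sup>2 * B) * l1 a"
proof -
  let ?W = "\<lambda>x. P x - U x"
  let ?VW = "\<lambda>x. ?W (x + a) - ?W x" and ?VU = "\<lambda>x. U (x + a) - U x"
  have W1: "smooth_bdd 1 (LP + LU) ?W"
    by (rule smooth_bdd_diff[OF P U1])
  have "S p ?VW x = S p ?W (x + a) - S p ?W x"
    using S_diff[OF smooth_bdd_shift[OF W1] W1, of p a x] by (simp add: S_shift[of p ?W a x])
  also have "\<dots> = (S p P (x + a) - S p U (x + a)) - (S p P x - S p U x)"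
    by (simp add: S_diff[OF P U1])
  finally have 1: "S p ?VW x = (S p P (x + a) - S p U (x + a)) - (S p P x - S p U x)" .
  have "smooth_bdd 1 (M * l1 a) ?VW"
    using smooth_bdd_difference[of 1 M ?W a] PU by (simp add: numeral_2_eq_2)
  from S_bound'[OF this, of p x] have 2: "\<bar>S p ?VW x\<bar> \<le> M * l1 a * CARD('n)\<^sup>2" .
  have 3: "S p ?VU x = S p U (x + a) - S p U x"
    using S_diff[OF smooth_bdd_shift[OF U1] U1, of p a x] by (simp add: S_shift[of p U a x])
  have 4: "partial_deriv p ?VU x = partial_deriv p U (x + a) - partial_deriv p U x"
    using iter_partial_diff[OF smooth_bdd_shift[OF U1, of a] U1, of "[p]"] iter_partial_shift[of "[p]" U a] by simp
  have "smooth_bdd 3 (B * l1 a) ?VU"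
    using smooth_bdd_difference[of 3 B U a] U4 by simp
  from S_consistency[OF this, of p x] have 5: "\<bar>S p ?VU x - partial_deriv p ?VU x\<bar> \<le> B * l1 a * CARD('n) ^ 4 * \<delta>\<^sup>2" .
  have "(S p P (x + a) - partial_deriv p U (x + a)) - (S p P x - partial_deriv p U x)
      = S p ?VW x + (S p ?VU x - partial_deriv p ?VU x)"
    unfolding 1 3 4 by simp
  also have "\<bar>\<dots>\<bar> \<le> M * l1 a * CARD('n)\<^sup>2 + B * l1 a * CARD('n) ^ 4 * \<delta>\<^sup>2"
    using 2 5 by linarith
  also have "\<dots> = (CARD('n)\<^sup>2 * M + CARD('n) ^ 4 * \<delta>\<^sup>2 * B) * l1 a"
    by (simp add: algebra_simps)
  finally show ?thesis .
qed

definition C_bond :: "real \<Rightarrow> real" where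
  "C_bond B = real CARD('n) ^ 4 * Cint * B + real CARD('n) ^ 6 * B"

text \<open>The bracket, multiplied by \<open>Cint\<close>, comes from interpolating the error of
  the discrete divergence; the next summand from interpolating the exact divergence; the last from
  replacing the nonlocal by the local gradient.\<close>

definition C_div :: "real \<Rightarrow> real" where
  "C_div B = Cint * (real CARD('n) ^ 5 * Cint * B + real CARD('n) ^ 7 * B)
     + real CARD('n) ^ 3 * Cint * B + real CARD('n) ^ 5 * B"

context
  fixes U :: "real^'n \<Rightarrow> real^'n" and B :: real and K :: "(int^'n) set"
  assumes U: "\<And>i N. 1 \<le> N \<Longrightarrow> N \<le> 4 \<Longrightarrow> smooth_bdd N B (\<lambda>x. U x $ i)"
    and K: "finite K" and UK: "\<And>k. k \<notin> K \<Longrightarrow> U (grid_point h k) = 0"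
    and divK: "\<And>k. k \<notin> K \<Longrightarrow> divergence U (grid_point h k) = 0"
begin

private abbreviation (input) e where "e \<equiv> grid_restriction h U"
private abbreviation (input) P where "P j x \<equiv> \<Sum>k\<in>K. e k $ j * b k x"

lemma B_nonneg: "B \<ge> 0"
  using U[of 1] smooth_bdd_nonneg by fastforce

lemma e_support: "{k. e k \<noteq> 0} \<subseteq> K"
  using UK by (auto simp: grid_restriction_def)

lemma P_smooth: "N \<le> 2 \<Longrightarrow> \<exists>L. smooth_bdd N L (P j)"
  using smooth_bdd_sum_basis[OF K, of N "\<lambda>k. e k $ j"] by blast

lemma P_error: "smooth_bdd 2 (Cint * B * H\<^sup>2) (\<lambda>x. P j x - U x $ j)"
  unfolding grid_restriction_def
  by (rule smooth_bdd_interp_error[where B' = B]) (use U K UK in auto)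

lemma div_smooth: "1 \<le> N \<Longrightarrow> N \<le> 3 \<Longrightarrow> smooth_bdd N (CARD('n) * B) (divergence U)"
  using smooth_bdd_sum[of UNIV N "\<lambda>_. B" "\<lambda>p. partial_deriv p (\<lambda>x. U x $ p)"]
    smooth_bdd_partial_deriv[OF U] by (simp add: divergence_def[abs_def])

lemma grad_div: "partial_deriv i (divergence U) x = (\<Sum>j\<in>UNIV. iter_partial [i, j] (\<lambda>x. U x $ j) x)"
proof -
  have "iter_partial [i] (\<lambda>x. \<Sum>j\<in>UNIV. 1 * partial_deriv j (\<lambda>x. U x $ j) x)
      = (\<lambda>x. \<Sum>j\<in>UNIV. 1 * iter_partial [i] (partial_deriv j (\<lambda>x. U x $ j)) x)"
  proof (rule iter_partial_linear_combination[where N = 1])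
    fix j and "is" :: "'n list" and x
    assume "length is < 1"
    then show "iter_partial is (partial_deriv j (\<lambda>x. U x $ j)) differentiable at x"
      using smooth_bdd_partial_deriv[OF U[of "Suc 1" j], of j] by (intro smooth_bdd_less) auto
  qed simp
  then show ?thesis
    by (simp add: divergence_def[abs_def])
qed

text \<open>Interpolation errors enter through \<open>Bo_bound'\<close> with their second
  derivatives. Summing the limits of the entries over \<open>j\<close> gives the Laplacian once and,
  by symmetry of mixed derivatives, the gradient of the divergence twice.\<close>

lemma bond_consistency:
  "\<bar>(\<Sum>j\<in>UNIV. Bo i j (P j) x) - ((\<Sum>p\<in>UNIV. iter_partial [p, p] (\<lambda>x. U x $ i) x)
      + 2 * partial_deriv i (divergence U) x) / (2 * (CARD('n) + 2))\<bar> \<le> C_bond B * (H\<^sup>2 + \<delta>\<^sup>2)"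
proof -
  let ?E = "\<lambda>j. ((if i = j then \<Sum>p\<in>UNIV. iter_partial [p, p] (\<lambda>x. U x $ j) x else 0)
      + iter_partial [i, j] (\<lambda>x. U x $ j) x + iter_partial [j, i] (\<lambda>x. U x $ j) x) / (2 * (CARD('n) + 2))"
  have one: "\<bar>Bo i j (P j) x - ?E j\<bar> \<le> Cint * B * H\<^sup>2 * CARD('n) ^ 3 + B * CARD('n) ^ 5 * \<delta>\<^sup>2" for j
  proof -
    obtain L where "smooth_bdd 2 L (P j)"
      using P_smooth by blast
    then have "Bo i j (\<lambda>x. P j x - U x $ j) x = Bo i j (P j) x - Bo i j (\<lambda>x. U x $ j) x"
      using U[of 2 j] by (intro Bo_diff) auto
    then have 1: "\<bar>Bo i j (P j) x - Bo i j (\<lambda>x. U x $ j) x\<bar> \<le> Cint * B * H\<^sup>2 * CARD('n) ^ 3"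
      using Bo_bound'[OF P_error, of i j j x] by simp
    have 2: "\<bar>Bo i j (\<lambda>x. U x $ j) x - ?E j\<bar> \<le> B * CARD('n) ^ 5 * \<delta>\<^sup>2"
      using U[of 4 j] by (intro Bo_consistency) auto
    show ?thesis
      using 1 2 by linarith
  qed
  have "(\<Sum>j\<in>UNIV. ?E j) = ((\<Sum>p\<in>UNIV. iter_partial [p, p] (\<lambda>x. U x $ i) x)
      + 2 * partial_deriv i (divergence U) x) / (2 * (CARD('n) + 2))"
  proof -
    have "iter_partial [j, i] (\<lambda>x. U x $ j) x = iter_partial [i, j] (\<lambda>x. U x $ j) x" for j
      using U[of 3 j] by (intro symmetric_partials) auto
    then show ?thesis
      unfolding sum_divide_distrib[symmetric] sum.distrib grad_div by simp
  qed
  then have "\<bar>(\<Sum>j\<in>UNIV. Bo i j (P j) x) - ((\<Sum>p\<in>UNIV. iter_partial [p, p] (\<lambda>x. U x $ i) x)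
      + 2 * partial_deriv i (divergence U) x) / (2 * (CARD('n) + 2))\<bar> = \<bar>\<Sum>j\<in>UNIV. Bo i j (P j) x - ?E j\<bar>"
    by (simp only: sum_subtractf)
  also have "\<dots> \<le> (\<Sum>j\<in>(UNIV::'n set). Cint * B * H\<^sup>2 * CARD('n) ^ 3 + B * CARD('n) ^ 5 * \<delta>\<^sup>2)"
    by (intro order_trans[OF sum_abs] sum_mono one)
  also have "\<dots> = CARD('n) ^ 4 * Cint * B * H\<^sup>2 + CARD('n) ^ 6 * B * \<delta>\<^sup>2"
    by (simp add: eval_nat_numeral algebra_simps)
  also have "\<dots> \<le> C_bond B * (H\<^sup>2 + \<delta>\<^sup>2)"
    using B_nonneg Cint_nonneg by (simp add: C_bond_def distrib_left distrib_right)
  finally show ?thesis .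
qed

text \<open>The discrete divergence \<open>z\<close> is not smooth enough for
  \<open>interp_error\<close>, whereas the exact divergence is. So z - div U is interpolated as
  Lipschitz data with a small constant, and div U as a smooth function.\<close>

lemma div_consistency:
  "\<bar>(\<Sum>l\<in>halo K. node_div K e l * S i (b l) x) - partial_deriv i (divergence U) x\<bar> \<le> C_div B * (H\<^sup>2 + \<delta>\<^sup>2)"
proof -
  \<comment> \<open>The nodal values of \<open>z\<close> vanish off the halo and those of
    \<open>?w\<close> off \<open>K\<close>; the union serves both interpolants.\<close>
  let ?w = "divergence U" and ?K = "halo K \<union> K"
  define z where "z x = (\<Sum>p\<in>UNIV. S p (P p) x)" for x
  define L where "L = CARD('n) * (CARD('n)\<^sup>2 * (Cint * B * H\<^sup>2) + CARD('n) ^ 4 * \<delta>\<^sup>2 * B)"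
  have L: "L \<ge> 0"
    using B_nonneg Cint_nonneg by (simp add: L_def)
  have K': "finite ?K"
    using K finite_halo by simp
  have z_node: "z (grid_point h l) = node_div K e l" for l
    by (simp add: z_def node_div_def S_sum_basis)
  have lip: "\<bar>(z (x + a) - ?w (x + a)) - (z x - ?w x)\<bar> \<le> L * l1 a" for x a
  proof -
    have eq: "(z (x + a) - ?w (x + a)) - (z x - ?w x)
        = (\<Sum>p\<in>UNIV. (S p (P p) (x + a) - partial_deriv p (\<lambda>x. U x $ p) (x + a))
            - (S p (P p) x - partial_deriv p (\<lambda>x. U x $ p) x))"
      by (simp add: z_def divergence_def sum_subtractf)
    have "\<bar>(z (x + a) - ?w (x + a)) - (z x - ?w x)\<bar>
        \<le> (\<Sum>p\<in>(UNIV::'n set). (CARD('n)\<^sup>2 * (Cint * B * H\<^sup>2) + CARD('n) ^ 4 * \<delta>\<^sup>2 * B) * l1 a)"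
      unfolding eq
    proof (intro order_trans[OF sum_abs] sum_mono)
      fix p
      obtain LP where "smooth_bdd 1 LP (P p)"
        using P_smooth[of 1 p] by auto
      then show "\<bar>S p (P p) (x + a) - partial_deriv p (\<lambda>x. U x $ p) (x + a)
            - (S p (P p) x - partial_deriv p (\<lambda>x. U x $ p) x)\<bar>
          \<le> (CARD('n)\<^sup>2 * (Cint * B * H\<^sup>2) + CARD('n) ^ 4 * \<delta>\<^sup>2 * B) * l1 a"
        using U[of 1 p] U[of 4 p] by (intro div_lipschitz[OF _ P_error]) auto
    qed
    also have "\<dots> = L * l1 a"
      by (simp add: L_def)
    finally show ?thesis .
  qed
  let ?\<Pi> = "\<lambda>f x. \<Sum>l\<in>?K. f (grid_point h l) * b l x"
  have sb: "smooth_bdd 1 (Cint * L) (?\<Pi> (\<lambda>x. z x - ?w x))"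
    by (rule interp_lipschitz[OF lip L K']) (auto simp: z_node node_div_outside_halo divK)
  have sw: "smooth_bdd 1 (Cint * (CARD('n) * B) * H\<^sup>2) (\<lambda>x. ?\<Pi> ?w x - ?w x)"
    by (rule smooth_bdd_interp_error) (use K' div_smooth[of 3] divK in \<open>auto simp: numeral_3_eq_3\<close>)
  obtain LW where LW: "smooth_bdd 1 LW (?\<Pi> ?w)"
    using smooth_bdd_sum_basis[OF K', of 1] by fastforce
  have "(\<Sum>l\<in>halo K. node_div K e l * S i (b l) x) = (\<Sum>l\<in>?K. z (grid_point h l) * S i (b l) x)"
    unfolding z_node by (intro sum.mono_neutral_left K') (auto simp: node_div_outside_halo)
  also have "\<dots> = S i (?\<Pi> (\<lambda>x. z x - ?w x)) x + S i (?\<Pi> ?w) x"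
    unfolding S_sum_basis by (simp add: left_diff_distrib sum_subtractf)
  also have "S i (?\<Pi> ?w) x = S i (\<lambda>x. ?\<Pi> ?w x - ?w x) x + S i ?w x"
    using S_diff[OF LW div_smooth[of 1], of i x] by simp
  finally have eq: "(\<Sum>l\<in>halo K. node_div K e l * S i (b l) x) - partial_deriv i ?w x
      = S i (?\<Pi> (\<lambda>x. z x - ?w x)) x + S i (\<lambda>x. ?\<Pi> ?w x - ?w x) x + (S i ?w x - partial_deriv i ?w x)"
    by simp
  have 1: "\<bar>S i (?\<Pi> (\<lambda>x. z x - ?w x)) x\<bar> \<le> Cint * L * CARD('n)\<^sup>2"
    by (rule S_bound'[OF sb])
  have 2: "\<bar>S i (\<lambda>x. ?\<Pi> ?w x - ?w x) x\<bar> \<le> Cint * (CARD('n) * B) * H\<^sup>2 * CARD('n)\<^sup>2"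
    by (rule S_bound'[OF sw])
  have 3: "\<bar>S i ?w x - partial_deriv i ?w x\<bar> \<le> CARD('n) * B * CARD('n) ^ 4 * \<delta>\<^sup>2"
    by (rule S_consistency) (use div_smooth[of 3] in simp)
  have "\<bar>(\<Sum>l\<in>halo K. node_div K e l * S i (b l) x) - partial_deriv i ?w x\<bar>
      \<le> Cint * L * CARD('n)\<^sup>2 + Cint * (CARD('n) * B) * H\<^sup>2 * CARD('n)\<^sup>2 + CARD('n) * B * CARD('n) ^ 4 * \<delta>\<^sup>2"
    unfolding eq using 1 2 3 by linarith
  also have "\<dots> = Cint * (CARD('n) ^ 5 * Cint * B) * H\<^sup>2 + Cint * (CARD('n) ^ 7 * B) * \<delta>\<^sup>2
      + CARD('n) ^ 3 * Cint * B * H\<^sup>2 + CARD('n) ^ 5 * B * \<delta>\<^sup>2"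
    by (simp add: L_def eval_nat_numeral algebra_simps)
  also have "\<dots> \<le> C_div B * (H\<^sup>2 + \<delta>\<^sup>2)"
    using B_nonneg Cint_nonneg by (simp add: C_div_def distrib_left distrib_right)
  finally show ?thesis .
qed

theorem consistency:
  assumes dim: "CARD('n) = 2 \<or> CARD('n) = 3" and Lame: "\<mu> > 0" "lam \<ge> \<mu>"
  shows "norm (discrete_operator lam \<mu> \<rho> \<delta> h (rk_interp h e) x - local_operator lam \<mu> U x)
    \<le> CARD('n) * (30 * \<mu> * C_bond B + (lam - \<mu>) * C_div B) * (H\<^sup>2 + \<delta>\<^sup>2)"
proof -
  let ?d = "real CARD('n)"
  have comp: "\<bar>(discrete_operator lam \<mu> \<rho> \<delta> h (rk_interp h e) x - local_operator lam \<mu> U x) $ i\<bar>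
      \<le> (30 * \<mu> * C_bond B + (lam - \<mu>) * C_div B) * (H\<^sup>2 + \<delta>\<^sup>2)" for i
  proof -
    define A where "A = (\<Sum>j\<in>UNIV. Bo i j (P j) x)"
    define T where "T = (\<Sum>l\<in>halo K. node_div K e l * S i (b l) x)"
    define D where "D = (\<Sum>p\<in>UNIV. iter_partial [p, p] (\<lambda>x. U x $ i) x)"
    define G where "G = partial_deriv i (divergence U) x"
    have A: "\<bar>A - (D + 2 * G) / (2 * (?d + 2))\<bar> \<le> C_bond B * (H\<^sup>2 + \<delta>\<^sup>2)"
      using bond_consistency[of i x] by (simp add: A_def D_def G_def add.commute)
    have T: "\<bar>T - G\<bar> \<le> C_div B * (H\<^sup>2 + \<delta>\<^sup>2)"
      using div_consistency[of i x] by (simp add: T_def G_def)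
    have "(discrete_operator lam \<mu> \<rho> \<delta> h (rk_interp h e) x) $ i = (C_alpha CARD('n) * \<mu> / ?d) * A
        + (C_beta CARD('n) * (lam - \<mu>) / ?d) * T"
      unfolding discrete_operator_eq[OF K e_support] A_def T_def by (simp add: Bo_sum_basis)
    moreover have "local_operator lam \<mu> U x $ i = \<mu> * D + (\<mu> + lam) * G"
      by (simp add: local_operator_component D_def G_def)
    \<comment> \<open>For both dimensions C_alpha / d = 2 (d + 2) and C_beta / d = 1. The limits are
      thus \<mu> (D + 2 G) and (lam - \<mu>) G, and their sum is \<mu> D + (\<mu> + lam) G.\<close>
    ultimately have "(discrete_operator lam \<mu> \<rho> \<delta> h (rk_interp h e) x - local_operator lam \<mu> U x) $ i
        = (C_alpha CARD('n) * \<mu> / ?d) * (A - (D + 2 * G) / (2 * (?d + 2))) + (lam - \<mu>) * (T - G)"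
      using dim by (auto simp: C_alpha_def C_beta_def field_simps)
    also have "\<bar>\<dots>\<bar> \<le> (30 * \<mu>) * (C_bond B * (H\<^sup>2 + \<delta>\<^sup>2)) + (lam - \<mu>) * (C_div B * (H\<^sup>2 + \<delta>\<^sup>2))"
    proof (rule order_trans[OF abs_triangle_ineq], rule add_mono)
      have "C_alpha CARD('n) * \<mu> / ?d \<le> 30 * \<mu>" "C_alpha CARD('n) * \<mu> / ?d \<ge> 0"
        using dim Lame by (auto simp: C_alpha_def)
      then show "\<bar>C_alpha CARD('n) * \<mu> / ?d * (A - (D + 2 * G) / (2 * (?d + 2)))\<bar> \<le> 30 * \<mu> * (C_bond B * (H\<^sup>2 + \<delta>\<^sup>2))"
        using A Lame unfolding abs_mult by (intro mult_mono) auto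
      show "\<bar>(lam - \<mu>) * (T - G)\<bar> \<le> (lam - \<mu>) * (C_div B * (H\<^sup>2 + \<delta>\<^sup>2))"
        using T Lame unfolding abs_mult by (intro mult_mono) auto
    qed
    finally show ?thesis
      by (simp add: algebra_simps)
  qed
  have "norm (discrete_operator lam \<mu> \<rho> \<delta> h (rk_interp h e) x - local_operator lam \<mu> U x)
    \<le> (\<Sum>i\<in>(UNIV::'n set). (30 * \<mu> * C_bond B + (lam - \<mu>) * C_div B) * (H\<^sup>2 + \<delta>\<^sup>2))"
    by (rule order_trans[OF norm_le_l1_cart sum_mono[OF comp]])
  then show ?thesis
    by (simp add: mult_ac)
qed

lemma interp_error_norm: "norm (rk_interp h e x - U x) \<le> CARD('n) * (Cint * B * H\<^sup>2)"
proof -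
  have "\<bar>(rk_interp h e x - U x) $ i\<bar> \<le> Cint * B * H\<^sup>2" for i
    using interp_error[of "[]" B "\<lambda>x. U x $ i" _ K x] U[of 2 i] K UK
    by (simp add: rk_interp_component[OF K e_support] grid_restriction_def numeral_2_eq_2)
  from order_trans[OF norm_le_l1_cart sum_mono[OF this]] show ?thesis
    by simp
qed

end

end

subsection \<open>Regularity of the zero extension\<close>

text \<open>\<open>frechet_derivative\<close> is a choice from the relation
  \<open>has_derivative\<close>, and local agreement makes the relations equal. The chosen values
  then coincide even where no derivative exists, so iteration requires no smoothness.\<close>

lemma partial_deriv_cong_open:
  assumes "open T" "x \<in> T" "\<And>y. y \<in> T \<Longrightarrow> f y = g y"
  shows "partial_deriv p f x = partial_deriv p g x"
proof -
  have "(f has_derivative D) (at x) \<longleftrightarrow> (g has_derivative D) (at x)" for D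
    using assms has_derivative_transform_within_open[of f D x UNIV T g]
      has_derivative_transform_within_open[of g D x UNIV T f] by auto
  then show ?thesis
    by (simp add: partial_deriv_def frechet_derivative_def)
qed

lemma iter_partial_cong_open:
  assumes "open T" "\<And>y. y \<in> T \<Longrightarrow> f y = g y" "x \<in> T"
  shows "iter_partial is f x = iter_partial is g x"
  using assms(3)
proof (induction "is" arbitrary: x)
  case (Cons p "is")
  have "partial_deriv p (iter_partial is f) x = partial_deriv p (iter_partial is g) x"
    by (rule partial_deriv_cong_open[OF assms(1)]) (use Cons in auto)
  then show ?case
    by simp
qed (simp add: assms)

text \<open>Regularity is assumed for a vector field, while the analysis is carried out on scalar
  components; this passes from one to the other.\<close>

lemma
  fixes f :: "real^'m::finite \<Rightarrow> real^'n::finite"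
  assumes T: "open T" and f: "\<And>js x. length js < N \<Longrightarrow> x \<in> T \<Longrightarrow> iter_partial js f differentiable (at x)"
  shows iter_partial_component: "length is \<le> N \<Longrightarrow> x \<in> T \<Longrightarrow> iter_partial is (\<lambda>x. f x $ i) x = iter_partial is f x $ i"
    and iter_partial_component_differentiable:
      "length is < N \<Longrightarrow> x \<in> T \<Longrightarrow> iter_partial is (\<lambda>x. f x $ i) differentiable (at x)"
proof -
  have comp: "((\<lambda>x. iter_partial is f x $ i) has_derivative (\<lambda>v. frechet_derivative (iter_partial is f) (at x) v $ i)) (at x)"
    if "length is < N" "x \<in> T" for "is" x
    using f[OF that] by (intro bounded_linear.has_derivative[OF bounded_linear_vec_nth]) (simp add: frechet_derivative_works)
  show eq: "iter_partial is (\<lambda>x. f x $ i) x = iter_partial is f x $ i" if "length is \<le> N" "x \<in> T" for "is" x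
    using that
  proof (induction "is" arbitrary: x)
    case (Cons p "is")
    have "partial_deriv p (iter_partial is (\<lambda>x. f x $ i)) x = partial_deriv p (\<lambda>x. iter_partial is f x $ i) x"
      using Cons by (intro partial_deriv_cong_open[OF T]) auto
    also have "\<dots> = partial_deriv p (iter_partial is f) x $ i"
      using partial_deriv_eq[OF comp] Cons.prems by (simp add: partial_deriv_def)
    finally show ?case
      by simp
  qed simp
  show "iter_partial is (\<lambda>x. f x $ i) differentiable (at x)" if "length is < N" "x \<in> T" for "is" x
  proof -
    have "(iter_partial is (\<lambda>x. f x $ i) has_derivative
        (\<lambda>v. frechet_derivative (iter_partial is f) (at x) v $ i)) (at x)"
      by (rule has_derivative_transform_within_open[OF comp[OF that] T \<open>x \<in> T\<close>])
        (simp add: eq[of "is"] that(1) less_imp_le)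
    then show ?thesis
      by (auto simp: differentiable_def)
  qed
qed

text \<open>Two open sets cover the space: the neighbourhood \<open>W\<close> of the closure of
  \<Omega>, where \<open>U\<close> is \<open>u0\<close>, and the complement of that closure, where
  \<open>U\<close> is 0. On \<open>W\<close> the derivatives have continuous extensions to a compact
  set, hence a common bound.\<close>

lemma zero_extension_smooth:
  fixes \<Omega> :: "(real^'n::finite) set" and u0 :: "real^'n \<Rightarrow> real^'n"
  defines "U \<equiv> \<lambda>x. if x \<in> \<Omega> then u0 x else 0"
  assumes \<Omega>: "open \<Omega>" "bounded \<Omega>" "\<Omega> \<noteq> {}" and \<delta>0: "\<delta>0 > 0"
    and zero: "\<And>x. x \<in> interaction_domain \<Omega> \<delta>0 \<Longrightarrow> u0 x = 0"
    and smooth: "Ck_closure 4 (extended_domain \<Omega> \<delta>0) u0"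
  shows "\<exists>B. \<forall>i N. N \<le> 4 \<longrightarrow> smooth_bdd N B (\<lambda>x. U x $ i)"
proof -
  let ?S = "extended_domain \<Omega> \<delta>0"
  define W where "W = {x. infdist x \<Omega> < 2 * \<delta>0}"
  have W: "open W"
    unfolding W_def by (intro open_Collect_less continuous_intros)
  have WS: "W \<subseteq> interior ?S"
    using W by (intro interior_maximal) (auto simp: W_def extended_domain_def interaction_domain_def)
  have UW: "U x = u0 x" if "x \<in> W" for x
    using that zero[of x] by (auto simp: U_def W_def interaction_domain_def)
  have UV: "U x = 0" if "x \<in> - closure \<Omega>" for x
    using that closure_subset[of \<Omega>] by (auto simp: U_def)
  have V: "open (- closure \<Omega>)"
    by auto
  have cover: "x \<in> W \<or> x \<in> - closure \<Omega>" for x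
    using in_closure_iff_infdist_zero[OF \<Omega>(3), of x] \<delta>0 by (auto simp: W_def)
  have d: "iter_partial js u0 differentiable (at x)" if "length js < 4" "x \<in> W" for js x
    using smooth that WS unfolding Ck_closure_def
    by (meson differentiable_on_eq_differentiable_at open_interior subsetD)
  have "bounded ?S"
  proof -
    obtain a where a: "\<And>x. x \<in> \<Omega> \<Longrightarrow> norm x \<le> a"
      using \<Omega>(2) by (auto simp: bounded_iff)
    have "norm x \<le> a + (2 * \<delta>0 + 1)" if "x \<in> ?S" for x
    proof -
      have "infdist x \<Omega> < 2 * \<delta>0 + 1"
        using that \<delta>0 by (auto simp: extended_domain_def interaction_domain_def)
      then obtain y where "y \<in> \<Omega>" "dist x y < 2 * \<delta>0 + 1"
        using cInf_lessD[of "dist x ` \<Omega>" "2 * \<delta>0 + 1"] \<Omega>(3) by (auto simp: infdist_notempty)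
      then show ?thesis
        using a[of y] norm_triangle_sub[of x y] by (simp add: dist_norm)
    qed
    then show ?thesis
      by (auto simp: bounded_iff)
  qed
  then have comp: "compact (closure ?S)"
    by (simp add: compact_closure)
  have "\<exists>M. \<forall>x\<in>W. norm (iter_partial is u0 x) \<le> M" if "length is \<le> 4" for "is"
  proof -
    obtain g where g: "continuous_on (closure ?S) g" "\<forall>x\<in>interior ?S. g x = iter_partial is u0 x"
      using smooth \<open>length is \<le> 4\<close> by (auto simp: Ck_closure_def)
    have "bounded (g ` closure ?S)"
      by (intro compact_imp_bounded compact_continuous_image g comp)
    then obtain M where M: "\<forall>x\<in>closure ?S. norm (g x) \<le> M"
      by (auto simp: bounded_iff)
    have "norm (iter_partial is u0 x) \<le> M" if "x \<in> W" for x
    proof -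
      have "x \<in> interior ?S" "x \<in> closure ?S"
        using that WS interior_subset closure_subset by blast+
      then show ?thesis
        using M g(2) by force
    qed
    then show ?thesis
      by blast
  qed
  then obtain M where M: "\<And>is x. length is \<le> 4 \<Longrightarrow> x \<in> W \<Longrightarrow> norm (iter_partial is u0 x) \<le> M is"
    by metis
  define B where "B = (\<Sum>is | length is \<le> 4. \<bar>M is\<bar>)"
  have fin: "finite {is :: 'n list. length is \<le> 4}"
    using finite_lists_length_le[of "UNIV :: 'n set" 4] by simp
  have B: "\<bar>M is\<bar> \<le> B" if "length is \<le> 4" for "is"
    unfolding B_def using fin that by (intro member_le_sum) auto
  have "B \<ge> 0"
    by (simp add: B_def sum_nonneg)
  have bound: "\<bar>iter_partial is (\<lambda>x. U x $ i) x\<bar> \<le> B" if "length is \<le> 4" for "is" i x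
    using cover[of x]
  proof
    assume x: "x \<in> W"
    have "iter_partial is (\<lambda>x. U x $ i) x = iter_partial is (\<lambda>x. u0 x $ i) x"
      by (rule iter_partial_cong_open[OF W _ x]) (simp add: UW)
    also have "\<dots> = iter_partial is u0 x $ i"
      by (rule iter_partial_component[OF W d that x])
    also have "\<bar>\<dots>\<bar> \<le> M is"
      using component_le_norm_cart[of "iter_partial is u0 x" i] M[OF that x] by linarith
    also have "\<dots> \<le> B"
      using B[OF that] by linarith
    finally show ?thesis .
  next
    assume x: "x \<in> - closure \<Omega>"
    have "iter_partial is (\<lambda>x. U x $ i) x = iter_partial is (\<lambda>x. 0 :: real) x"
      by (rule iter_partial_cong_open[OF V _ x]) (simp add: UV)
    then show ?thesis
      using \<open>B \<ge> 0\<close> by simp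
  qed
  have diff: "iter_partial is (\<lambda>x. U x $ i) differentiable (at x)" if "length is < 4" for "is" i x
    using cover[of x]
  proof
    assume x: "x \<in> W"
    have "iter_partial is (\<lambda>x. u0 x $ i) differentiable (at x)"
      by (rule iter_partial_component_differentiable[OF W d that x])
    moreover have "iter_partial is (\<lambda>x. u0 x $ i) y = iter_partial is (\<lambda>x. U x $ i) y" if "y \<in> W" for y
      by (rule iter_partial_cong_open[OF W _ that]) (simp add: UW)
    ultimately show ?thesis
      unfolding differentiable_def using has_derivative_transform_within_open[OF _ W x] by blast
  next
    assume x: "x \<in> - closure \<Omega>"
    have "(\<lambda>x. 0) differentiable (at x)"
      by simp
    moreover have "0 = iter_partial is (\<lambda>x. U x $ i) y" if "y \<in> - closure \<Omega>" for y
      using iter_partial_cong_open[OF V _ that, of "\<lambda>x. U x $ i" "\<lambda>x. 0" "is"] by (simp add: UV)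
    ultimately show ?thesis
      unfolding differentiable_def using has_derivative_transform_within_open[OF _ V x] by blast
  qed
  have "smooth_bdd N B (\<lambda>x. U x $ i)" if "N \<le> 4" for N i
    unfolding smooth_bdd_def using bound diff that by auto
  then show ?thesis
    by blast
qed

lemma local_operator_cong_open:
  fixes u v :: "real^'n::finite \<Rightarrow> real^'n"
  assumes T: "open T" "x \<in> T" and uv: "\<And>y. y \<in> T \<Longrightarrow> u y = v y"
  shows "local_operator lam \<mu> u x = local_operator lam \<mu> v x"
proof -
  have "divergence u y = divergence v y" if "y \<in> T" for y
    unfolding divergence_def by (intro sum.cong refl partial_deriv_cong_open[OF T(1) that]) (simp add: uv)
  then have "partial_deriv i (divergence u) x = partial_deriv i (divergence v) x" for i
    by (rule partial_deriv_cong_open[OF T])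
  moreover have "iter_partial [p, p] (\<lambda>x. u x $ i) x = iter_partial [p, p] (\<lambda>x. v x $ i) x" for p i
    by (rule iter_partial_cong_open[OF T(1) _ T(2)]) (simp add: uv)
  ultimately show ?thesis
    by (simp add: vec_eq_iff local_operator_component)
qed

text \<open>Bounds the right-hand side of the scheme at the nodes, for the case of coarse
  meshes.\<close>

lemma local_operator_bound:
  fixes U :: "real^'n::finite \<Rightarrow> real^'n" and B :: real
  assumes U: "\<And>i. smooth_bdd 2 B (\<lambda>x. U x $ i)" and Lame: "\<mu> > 0" "lam \<ge> \<mu>"
  shows "norm (local_operator lam \<mu> U x) \<le> CARD('n) * ((2 * \<mu> + lam) * (CARD('n) * B))"
proof -
  have "\<bar>local_operator lam \<mu> U x $ i\<bar> \<le> (2 * \<mu> + lam) * (CARD('n) * B)" for i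
  proof -
    have "\<bar>\<Sum>p\<in>(UNIV::'n set). iter_partial [p, p] (\<lambda>x. U x $ i) x\<bar> \<le> (\<Sum>p\<in>(UNIV::'n set). B)"
    proof (intro order_trans[OF sum_abs] sum_mono)
      fix p
      show "\<bar>iter_partial [p, p] (\<lambda>x. U x $ i) x\<bar> \<le> B"
        using U[of i] unfolding smooth_bdd_def by (metis length_Cons list.size(3) numeral_2_eq_2)
    qed
    then have 1: "\<bar>\<mu> * (\<Sum>p\<in>UNIV. iter_partial [p, p] (\<lambda>x. U x $ i) x)\<bar> \<le> \<mu> * (CARD('n) * B)"
      using Lame unfolding abs_mult by (intro mult_mono) auto
    have "smooth_bdd 1 (\<Sum>p\<in>(UNIV::'n set). B) (divergence U)"
      unfolding divergence_def[abs_def]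
      by (intro smooth_bdd_sum smooth_bdd_partial_deriv) (use U in \<open>simp add: numeral_2_eq_2\<close>)
    then have "\<bar>iter_partial [i] (divergence U) x\<bar> \<le> (\<Sum>p\<in>(UNIV::'n set). B)"
      unfolding smooth_bdd_def by (simp del: iter_partial.simps sum_constant)
    then have "\<bar>iter_partial [i] (divergence U) x\<bar> \<le> CARD('n) * B"
      by simp
    then have 2: "\<bar>(\<mu> + lam) * partial_deriv i (divergence U) x\<bar> \<le> (\<mu> + lam) * (CARD('n) * B)"
      using Lame unfolding abs_mult by (intro mult_mono) auto
    show ?thesis
      unfolding local_operator_component using 1 2 by (simp add: algebra_simps)
  qed
  from order_trans[OF norm_le_l1_cart sum_mono[OF this]] show ?thesis
    by simp
qed

subsection \<open>Error of the coefficients and of the interpolant\<close>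

context scheme
begin

text \<open>The energy estimate: stability tested with \<open>e\<close> itself, then Cauchy-Schwarz
  twice, with 1 as a lower bound for C_alpha / d. The residual bound is asked only where e_k is
  nonzero, because the scheme holds at nodes of the domain and not on all of \<open>K\<close>. The
  free majorant \<open>Q\<close> serves fine and coarse meshes alike.\<close>

lemma coefficient_bound:
  assumes K: "finite K" "{k. e k \<noteq> 0} \<subseteq> K" and R: "\<And>k. k \<in> K \<Longrightarrow> norm (grid_point h k) \<le> R" and "R \<ge> 0"
    and Lame: "\<mu> > 0" "lam \<ge> \<mu>" and dim: "CARD('n) = 2 \<or> CARD('n) = 3"
    and T: "\<And>k. e k \<noteq> 0 \<Longrightarrow> norm (discrete_operator lam \<mu> \<rho> \<delta> h (rk_interp h e) (grid_point h k)) \<le> T"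
    and Q: "2 * (R + H) * CARD('n) + \<delta> \<le> Q"
  shows "(\<Sum>k\<in>K. (norm (e k))\<^sup>2) \<le> card K * (T * (3 ^ CARD('n) * Q\<^sup>2) / \<mu>)\<^sup>2"
proof (cases "\<forall>k\<in>K. e k = 0")
  case True
  then show ?thesis
    by simp
next
  case False
  then obtain k0 where "k0 \<in> K" "e k0 \<noteq> 0"
    by blast
  then have "T \<ge> 0"
    using T norm_ge_zero order_trans by blast
  let ?E = "\<Sum>k\<in>K. (norm (e k))\<^sup>2" and ?Q = "2 * (R + H) * CARD('n) + \<delta>"
  let ?L = "\<lambda>k. discrete_operator lam \<mu> \<rho> \<delta> h (rk_interp h e) (grid_point h k)"
  have "?Q > 0"
    using \<open>R \<ge> 0\<close> H \<delta> by (intro add_nonneg_pos mult_nonneg_nonneg) auto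
  have E: "?E > 0"
    using K \<open>k0 \<in> K\<close> \<open>e k0 \<noteq> 0\<close> by (intro sum_pos2[of _ k0]) auto
  have c: "c_stab R > 0"
    using \<open>?Q > 0\<close> by (simp add: c_stab_def)
  have "\<mu> * c_stab R * ?E \<le> (C_alpha CARD('n) * \<mu> / CARD('n)) * (c_stab R * ?E)"
  proof -
    have "\<mu> \<le> C_alpha CARD('n) * \<mu> / CARD('n)"
      using dim Lame by (auto simp: C_alpha_def)
    then show ?thesis
      using c E by (simp only: mult.assoc) (intro mult_right_mono, auto)
  qed
  also have "\<dots> \<le> - (\<Sum>k\<in>K. e k \<bullet> ?L k)"
    using stability[OF K R Lame] by simp
  also have "\<dots> \<le> (\<Sum>k\<in>K. norm (e k) * T)"
    unfolding sum_negf[symmetric]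
  proof (rule sum_mono)
    fix k
    show "- (e k \<bullet> ?L k) \<le> norm (e k) * T"
    proof (cases "e k = 0")
      case False
      have "- (e k \<bullet> ?L k) \<le> norm (e k) * norm (?L k)"
        using Cauchy_Schwarz_ineq2[of "e k" "?L k"] by linarith
      also have "\<dots> \<le> norm (e k) * T"
        using T[OF False] by (intro mult_left_mono) auto
      finally show ?thesis .
    qed simp
  qed
  also have "\<dots> = T * (\<Sum>k\<in>K. norm (e k))"
    by (simp add: sum_distrib_left mult.commute)
  finally have "(\<mu> * c_stab R * ?E)\<^sup>2 \<le> (T * (\<Sum>k\<in>K. norm (e k)))\<^sup>2"
    using c E Lame by (intro power_mono) auto
  also have "\<dots> \<le> T\<^sup>2 * (card K * ?E)"
  proof -
    have "(\<Sum>k\<in>K. 1 * norm (e k))\<^sup>2 \<le> (\<Sum>k\<in>K. 1\<^sup>2) * ?E"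
      by (rule Cauchy_Schwarz_ineq_sum)
    then show ?thesis
      by (simp add: power_mult_distrib mult_left_mono)
  qed
  finally have "((\<mu> * c_stab R)\<^sup>2 * ?E) * ?E \<le> (T\<^sup>2 * card K) * ?E"
    by (simp add: power2_eq_square mult_ac)
  then have "(\<mu> * c_stab R)\<^sup>2 * ?E \<le> T\<^sup>2 * card K"
    using E by (simp only: mult_le_cancel_right_pos)
  moreover have "(\<mu> * c_stab R)\<^sup>2 > 0"
    using c Lame by simp
  ultimately have "?E \<le> T\<^sup>2 * card K / (\<mu> * c_stab R)\<^sup>2"
    by (simp add: pos_le_divide_eq mult.commute)
  also have "\<dots> = card K * (T * (3 ^ CARD('n) * ?Q\<^sup>2) / \<mu>)\<^sup>2"
    by (simp add: c_stab_def power_divide power_mult_distrib mult_ac)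
  also have "\<dots> \<le> card K * (T * (3 ^ CARD('n) * Q\<^sup>2) / \<mu>)\<^sup>2"
    using \<open>T \<ge> 0\<close> \<open>?Q > 0\<close> Q Lame by (intro mult_left_mono power_mono divide_right_mono) auto
  finally show ?thesis .
qed

section \<open>From nodal coefficients to the L2 norm\<close>

lemma basis_nonneg: "b k x \<ge> 0" and basis_le_1: "b k x \<le> 1"
  by (auto simp: basis_deriv_def intro!: prod_nonneg prod_le_1 bspl_bounds)

lemma basis_le_indicator:
  "b k x \<le> indicator (cbox (grid_point h k - 2 *\<^sub>R h) (grid_point h k + 2 *\<^sub>R h)) x"
proof (cases "x \<in> cbox (grid_point h k - 2 *\<^sub>R h) (grid_point h k + 2 *\<^sub>R h)")
  case False
  then obtain j where j: "\<not> (of_int (k $ j) * h $ j - 2 * h $ j \<le> x $ j \<and> x $ j \<le> of_int (k $ j) * h $ j + 2 * h $ j)"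
    by (auto simp: mem_box_cart grid_point_def)
  have "x $ j / h $ j < of_int (k $ j) - 2 \<or> x $ j / h $ j > of_int (k $ j) + 2"
    using j h_pos[of j] by (auto simp: field_simps)
  then have "bspl 0 (x $ j / h $ j - of_int (k $ j)) = 0"
    by (intro bspl_eq_0) auto
  then have "b k x = 0"
    unfolding basis_deriv_def by (intro prod_zero) auto
  then show ?thesis
    by simp
qed (simp add: basis_le_1)

lemma partition_of_unity_le:
  assumes "finite K"
  shows "(\<Sum>k\<in>K. b k x) \<le> 1"
proof -
  have c0: "count_list [] = (\<lambda>_::'n. 0)"
    by (rule ext) simp
  have "(\<Sum>k\<in>near x. b k x) = 1"
    using moment_lists[of "[]" "[]" x] by (simp add: c0)
  moreover have "(\<Sum>k\<in>K. b k x) = (\<Sum>k\<in>K \<inter> near x. b k x)"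
    using assms by (intro sum.mono_neutral_right) (auto simp: basis_deriv_eq_0)
  moreover have "(\<Sum>k\<in>K \<inter> near x. b k x) \<le> (\<Sum>k\<in>near x. b k x)"
    by (intro sum_mono2) (auto simp: basis_nonneg)
  ultimately show ?thesis
    by simp
qed

text \<open>Jensen's inequality for nonnegative weights of total mass at most 1, obtained by
  splitting each weight into two square roots.\<close>

lemma interp_square_le:
  assumes K: "finite K" "{k. e k \<noteq> 0} \<subseteq> K"
  shows "(norm (rk_interp h e x))\<^sup>2 \<le> (\<Sum>k\<in>K. b k x * (norm (e k))\<^sup>2)"
proof -
  have "norm (rk_interp h e x) \<le> (\<Sum>k\<in>K. b k x * norm (e k))"
    unfolding rk_interp_finite[OF K h_pos]
    by (rule order_trans[OF norm_sum]) (simp add: basis_nonneg)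
  also have "\<dots> = (\<Sum>k\<in>K. sqrt (b k x) * (sqrt (b k x) * norm (e k)))"
    by (simp add: basis_nonneg flip: mult.assoc)
  finally have "(norm (rk_interp h e x))\<^sup>2 \<le> (\<Sum>k\<in>K. sqrt (b k x) * (sqrt (b k x) * norm (e k)))\<^sup>2"
    by (intro power_mono) auto
  also have "\<dots> \<le> (\<Sum>k\<in>K. (sqrt (b k x))\<^sup>2) * (\<Sum>k\<in>K. (sqrt (b k x) * norm (e k))\<^sup>2)"
    by (rule Cauchy_Schwarz_ineq_sum)
  also have "\<dots> = (\<Sum>k\<in>K. b k x) * (\<Sum>k\<in>K. b k x * (norm (e k))\<^sup>2)"
    by (simp add: basis_nonneg power_mult_distrib)
  also have "\<dots> \<le> 1 * (\<Sum>k\<in>K. b k x * (norm (e k))\<^sup>2)"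
    by (intro mult_right_mono partition_of_unity_le K sum_nonneg mult_nonneg_nonneg basis_nonneg) auto
  finally show ?thesis
    by simp
qed

definition nodes_in_ball :: "real \<Rightarrow> (int^'n) set" where
  "nodes_in_ball R = {k. norm (grid_point h k) \<le> R}"

lemma nodes_in_ball_box:
  "nodes_in_ball R \<subseteq> {k. \<forall>j. k $ j \<in> {- \<lfloor>R / h $ j\<rfloor>..\<lfloor>R / h $ j\<rfloor>}}"
proof
  fix k assume k: "k \<in> nodes_in_ball R"
  have "k $ j \<in> {- \<lfloor>R / h $ j\<rfloor>..\<lfloor>R / h $ j\<rfloor>}" for j
  proof -
    have "\<bar>of_int (k $ j) * h $ j\<bar> \<le> R"
      using k component_le_norm_cart[of "grid_point h k" j] by (simp add: nodes_in_ball_def grid_point_def)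
    then have "\<bar>real_of_int (k $ j)\<bar> \<le> R / h $ j"
      using h_pos[of j] by (simp add: abs_mult pos_le_divide_eq)
    then have "k $ j \<le> \<lfloor>R / h $ j\<rfloor>" "- k $ j \<le> \<lfloor>R / h $ j\<rfloor>"
      by (simp_all add: le_floor_iff)
    then show ?thesis
      by simp
  qed
  then show "k \<in> {k. \<forall>j. k $ j \<in> {- \<lfloor>R / h $ j\<rfloor>..\<lfloor>R / h $ j\<rfloor>}}"
    by simp
qed

lemma finite_nodes_in_ball: "finite (nodes_in_ball R)"
  by (rule finite_subset[OF nodes_in_ball_box]) (intro finite_vec_box, simp)

lemma card_nodes_in_ball:
  assumes "R \<ge> 0"
  shows "card (nodes_in_ball R) \<le> (\<Prod>j\<in>(UNIV::'n set). 2 * R / h $ j + 1)"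
proof -
  let ?B = "\<lambda>j. {- \<lfloor>R / h $ j\<rfloor>..\<lfloor>R / h $ j\<rfloor>}"
  have "card (nodes_in_ball R) \<le> card {k :: int^'n. \<forall>j. k $ j \<in> ?B j}"
    by (intro card_mono nodes_in_ball_box finite_vec_box) auto
  also have "\<dots> = (\<Prod>j\<in>(UNIV::'n set). card (?B j))"
    by (rule card_vec_box) auto
  finally have "real (card (nodes_in_ball R)) \<le> (\<Prod>j\<in>(UNIV::'n set). real (card (?B j)))"
    by (simp only: of_nat_le_iff of_nat_prod[symmetric])
  also have "\<dots> \<le> (\<Prod>j\<in>(UNIV::'n set). 2 * R / h $ j + 1)"
  proof (intro prod_mono conjI)
    fix j
    have "0 \<le> \<lfloor>R / h $ j\<rfloor>"
      using assms h_pos[of j] by simp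
    then have "real (card (?B j)) = 2 * real_of_int \<lfloor>R / h $ j\<rfloor> + 1"
      by simp
    also have "\<dots> \<le> 2 * (R / h $ j) + 1"
      by (intro add_mono mult_left_mono of_int_floor_le) auto
    finally show "real (card (?B j)) \<le> 2 * R / h $ j + 1"
      by simp
  qed simp
  finally show ?thesis .
qed

text \<open>The pointwise part \<open>A\<close> is integrated over \<Omega>. Each basis function is
  at most 1 and lives in a box of side 4 h_j, which gives the factor 4^d times the cell
  volume.\<close>

lemma set_integral_square_le:
  assumes \<Omega>: "\<Omega> \<in> sets borel" "emeasure lborel \<Omega> < \<infinity>" and K: "finite K" and E: "\<And>k. E k \<ge> 0"
    and f: "\<And>x. x \<in> \<Omega> \<Longrightarrow> (norm (f x))\<^sup>2 \<le> A + (\<Sum>k\<in>K. b k x * E k)" and A: "A \<ge> 0"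
  shows "(LINT x:\<Omega>|lborel. (norm (f x))\<^sup>2) \<le> A * measure lborel \<Omega> + 4 ^ CARD('n) * (\<Prod>j\<in>UNIV. h $ j) * (\<Sum>k\<in>K. E k)"
proof -
  let ?C = "\<lambda>k. cbox (grid_point h k - 2 *\<^sub>R h) (grid_point h k + 2 *\<^sub>R h)"
  have vol: "measure lborel (?C k) = 4 ^ CARD('n) * (\<Prod>j\<in>UNIV. h $ j)" for k
  proof -
    have "measure lborel (?C k) = (\<Prod>j\<in>UNIV. 4 * h $ j)"
      using h_pos by (subst content_cbox_cart) (auto simp: box_ne_empty inner_axis mem_box_cart set_eq_iff
        less_imp_le intro!: exI[of _ "grid_point h k"] prod.cong)
    then show ?thesis
      by (simp add: prod.distrib)
  qed
  have int: "has_bochner_integral lborel (\<lambda>x. A * indicator \<Omega> x + (\<Sum>k\<in>K. E k * indicator (?C k) x))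
     (A * measure lborel \<Omega> + (\<Sum>k\<in>K. E k * measure lborel (?C k)))"
    using \<Omega> emeasure_bounded_finite[OF bounded_cbox]
    by (intro has_bochner_integral_add has_bochner_integral_sum has_bochner_integral_mult_right
        has_bochner_integral_real_indicator) auto
  have "(LINT x:\<Omega>|lborel. (norm (f x))\<^sup>2) \<le> (\<integral>x. A * indicator \<Omega> x + (\<Sum>k\<in>K. E k * indicator (?C k) x) \<partial>lborel)"
    unfolding set_lebesgue_integral_def
  \<comment> \<open>Integrability is required of the majorant only; a non-integrable function on the
    left would have integral 0.\<close>
  proof (rule integral_mono')
    show "integrable lborel (\<lambda>x. A * indicator \<Omega> x + (\<Sum>k\<in>K. E k * indicator (?C k) x))"
      using int by (simp add: has_bochner_integral_iff)
    fix x :: "real^'n"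
    have "(\<Sum>k\<in>K. b k x * E k) \<le> (\<Sum>k\<in>K. E k * indicator (?C k) x)"
      by (intro sum_mono) (subst mult.commute, intro mult_left_mono basis_le_indicator E)
    moreover have "0 \<le> (\<Sum>k\<in>K. E k * indicator (?C k) x)"
      by (intro sum_nonneg mult_nonneg_nonneg E) auto
    ultimately show "indicator \<Omega> x *\<^sub>R (norm (f x))\<^sup>2 \<le> A * indicator \<Omega> x + (\<Sum>k\<in>K. E k * indicator (?C k) x)"
      "0 \<le> A * indicator \<Omega> x + (\<Sum>k\<in>K. E k * indicator (?C k) x)"
      using f[of x] A by (auto simp: indicator_def)
  qed
  also have "\<dots> = A * measure lborel \<Omega> + 4 ^ CARD('n) * (\<Prod>j\<in>UNIV. h $ j) * (\<Sum>k\<in>K. E k)"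
    using int unfolding has_bochner_integral_iff vol sum_distrib_right[symmetric] by (simp add: mult_ac)
  finally show ?thesis .
qed

end

theorem theorem4p10:
  fixes \<Omega> :: "(real^'n::finite) set"
    and \<delta>0 lam \<mu> :: real
    and \<rho> :: "real \<Rightarrow> real"
    and hhat :: "real^'n"
    and u0 f0 :: "real^'n \<Rightarrow> real^'n"
  assumes dim: "CARD('n) = 2 \<or> CARD('n) = 3"
    and delta0: "\<delta>0 > 0"
    and Omega: "open \<Omega>" "bounded \<Omega>"
    and Lame: "\<mu> > 0" "lam \<ge> \<mu>"
    and kernel_nonneg: "\<And>r. r > 0 \<Longrightarrow> \<rho> r \<ge> 0"
    and kernel_noninc: "\<And>r s. 0 < r \<Longrightarrow> r \<le> s \<Longrightarrow> \<rho> s \<le> \<rho> r"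
    and kernel_support: "\<And>r. r > 1 \<Longrightarrow> \<rho> r = 0"
    and kernel_integrable:
      "set_integrable lborel (ball 0 1) (\<lambda>s::real^'n. \<rho> (norm s) * (norm s)\<^sup>2)"
    and kernel_moment:
      "(LINT s:ball 0 1|lborel. \<rho> (norm (s::real^'n)) * (norm s)\<^sup>2) = CARD('n)"
    and grid_shape: "\<And>j. hhat $ j > 0" "Max (range (\<lambda>j. hhat $ j)) = 1"
    and local_eq: "\<And>x. x \<in> \<Omega> \<Longrightarrow> - local_operator lam \<mu> u0 x = f0 x"
    and local_bc: "\<And>x. x \<in> frontier \<Omega> \<Longrightarrow> u0 x = 0"
    and zero_extension:
      "\<And>\<delta> x. 0 < \<delta> \<Longrightarrow> \<delta> \<le> \<delta>0 \<Longrightarrow> x \<in> interaction_domain \<Omega> \<delta> \<Longrightarrow> u0 x = 0"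
    and smooth: "\<And>\<delta>. 0 < \<delta> \<Longrightarrow> \<delta> \<le> \<delta>0 \<Longrightarrow> Ck_closure 4 (extended_domain \<Omega> \<delta>) u0"
  shows "\<exists>C. \<forall>hmax \<delta> u. 0 < hmax \<longrightarrow> 0 < \<delta> \<longrightarrow> \<delta> \<le> \<delta>0 \<longrightarrow>
           numerical_solution lam \<mu> \<rho> \<Omega> f0 \<delta> (hmax *\<^sub>R hhat) u \<longrightarrow>
           L2_norm_on \<Omega> (\<lambda>x. u0 x - u x) \<le> C * (hmax\<^sup>2 + \<delta>\<^sup>2)"
proof (cases "\<Omega> = {}")
  \<comment> \<open>For the empty set \<open>infdist\<close> is constantly 0, so the neighbourhoods
    behind \<open>zero_extension_smooth\<close> lose their meaning.\<close>
  case True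
  then show ?thesis
    by (intro exI[of _ 0]) (simp add: L2_norm_on_def set_lebesgue_integral_def)
next
  case False
  define U where "U = (\<lambda>x. if x \<in> \<Omega> then u0 x else 0)"
  \<comment> \<open>The extension is taken once, at the largest horizon \<delta>0; this makes
    \<open>B\<close> independent of \<delta>.\<close>
  obtain B where U: "\<And>i N. N \<le> 4 \<Longrightarrow> smooth_bdd N B (\<lambda>x. U x $ i)"
    using zero_extension_smooth[OF Omega False delta0 zero_extension[OF delta0 order_refl] smooth[OF delta0 order_refl]]
    unfolding U_def by blast
  have B: "B \<ge> 0"
    using U[of 0] smooth_bdd_nonneg by blast
  obtain R0 where R0: "\<And>x. x \<in> \<Omega> \<Longrightarrow> norm x \<le> R0"
    using Omega(2) by (auto simp: bounded_iff)
  define R where "R = max R0 0"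
  have R: "R \<ge> 0" and \<Omega>R: "\<And>x. x \<in> \<Omega> \<Longrightarrow> norm x \<le> R"
    using R0 by (auto simp: R_def le_max_iff_disj)
  define \<eta> where "\<eta> = Min (range (\<lambda>j. hhat $ j))"
  have hhat: "\<eta> \<le> hhat $ j" "hhat $ j \<le> 1" for j
    using grid_shape(2) Max_ge[of "range (\<lambda>j. hhat $ j)" "hhat $ j"] by (auto simp: \<eta>_def)
  have "\<eta> > 0"
    using grid_shape(1) by (simp add: \<eta>_def)
  have "\<eta> \<le> 1"
    using hhat order_trans by blast
  let ?n = "real CARD('n)"
  define vol where "vol = measure lborel \<Omega>"
  have fin: "emeasure lborel \<Omega> < \<infinity>"
    using emeasure_bounded_finite[OF Omega(2)] by simp
  \<comment> \<open>\<open>CI\<close> and \<open>Ct\<close> spell out \<open>Cint\<close> and the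
    constant of \<open>consistency\<close> outside the locale, because they have to be fixed before
    the mesh and the horizon.\<close>
  define CI where "CI = 8 ^ CARD('n) * (2 * ?n) ^ 4 / \<eta>\<^sup>2"
  define F where "F = ?n * ((2 * \<mu> + lam) * (?n * B))"
  \<comment> \<open>Majorises the length in \<open>c_stab\<close> for all \<delta> up to \<delta>0
    when hmax is at most 1. For hmax at least 1 the majorant is \<open>Q1 * hmax\<close>.\<close>
  define Q1 where "Q1 = 2 * (R + 1) * ?n + \<delta>0"
  define Ct where "Ct = ?n * (30 * \<mu> * (?n ^ 4 * CI * B + ?n ^ 6 * B)
     + (lam - \<mu>) * (CI * (?n ^ 5 * CI * B + ?n ^ 7 * B) + ?n ^ 3 * CI * B + ?n ^ 5 * B))"
  define G where "G = 3 ^ CARD('n) * Q1\<^sup>2 / \<mu>"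
  define D1 where "D1 = 2 * (?n * (CI * B))\<^sup>2 * vol + 2 * 4 ^ CARD('n) * (2 * R + 1) ^ CARD('n) * (Ct * G)\<^sup>2"
  define D2 where "D2 = (2 * (?n * B)\<^sup>2 + 2 * F\<^sup>2 * (2 * R / \<eta> + 1) ^ CARD('n) * G\<^sup>2) * vol"
  have D: "D1 \<ge> 0" "D2 \<ge> 0"
    using R \<open>\<eta> > 0\<close> by (auto simp: D1_def D2_def vol_def intro!: add_nonneg_nonneg mult_nonneg_nonneg)
  have "L2_norm_on \<Omega> (\<lambda>x. u0 x - u x) \<le> (sqrt D1 + sqrt D2) * (hmax\<^sup>2 + \<delta>\<^sup>2)"
    if hmax: "0 < hmax" and horizon: "0 < \<delta>" "\<delta> \<le> \<delta>0"
      and num: "numerical_solution lam \<mu> \<rho> \<Omega> f0 \<delta> (hmax *\<^sub>R hhat) u" for hmax \<delta> u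
  proof -
    let ?h = "hmax *\<^sub>R hhat" and ?r = "hmax\<^sup>2 + \<delta>\<^sup>2"
    have grid: "grid ?h \<eta> hmax"
      using hmax hhat \<open>\<eta> > 0\<close> \<open>\<eta> \<le> 1\<close> by unfold_locales (auto simp: mult_left_le)
    have "radial_kernel (horizon_kernel \<rho> \<delta> :: real^'n \<Rightarrow> real) \<delta>"
      by (rule radial_kernel_horizon[OF horizon(1) kernel_nonneg kernel_integrable kernel_moment])
    then interpret scheme ?h \<eta> hmax \<rho> \<delta>
      by (intro scheme.intro horizon.intro grid)
    have CI: "Cint = CI"
      by (simp add: Cint_def CI_def)
    have Ct: "?n * (30 * \<mu> * C_bond B + (lam - \<mu>) * C_div B) = Ct"
      by (simp add: Ct_def C_bond_def C_div_def CI)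
    obtain c where u: "u = rk_interp ?h c" and c: "\<And>k. grid_point ?h k \<notin> \<Omega> \<Longrightarrow> c k = 0"
      using num by (auto simp: numerical_solution_def trial_space_def)
    \<comment> \<open>The nodes of a closed ball containing \<Omega>, not of \<Omega> alone: off
      this ball a node has a neighbourhood missing \<Omega>, so both \<open>U\<close> and its
      divergence vanish there.\<close>
    define K where "K = nodes_in_ball R"
    have K: "finite K"
      unfolding K_def by (rule finite_nodes_in_ball)
    have KR: "\<And>k. k \<in> K \<Longrightarrow> norm (grid_point ?h k) \<le> R"
      by (simp add: K_def nodes_in_ball_def)
    have \<Omega>K: "k \<in> K" if "grid_point ?h k \<in> \<Omega>" for k
      using \<Omega>R[OF that] by (simp add: K_def nodes_in_ball_def)
    define e where "e = grid_restriction ?h U"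
    have UK: "U (grid_point ?h k) = 0" if "k \<notin> K" for k
      using that \<Omega>K by (auto simp: U_def)
    have divK: "divergence U (grid_point ?h k) = 0" if "k \<notin> K" for k
    proof -
      have "closure \<Omega> \<subseteq> cball 0 R"
        using \<Omega>R by (intro closure_minimal) auto
      then have x: "grid_point ?h k \<in> - closure \<Omega>"
        using that by (auto simp: K_def nodes_in_ball_def)
      have "partial_deriv p (\<lambda>y. U y $ p) (grid_point ?h k) = partial_deriv p (\<lambda>y. 0 :: real) (grid_point ?h k)" for p
        by (rule partial_deriv_cong_open[OF _ x]) (use closure_subset[of \<Omega>] in \<open>auto simp: U_def\<close>)
      then show ?thesis
        by (simp add: divergence_def partial_deriv_def)
    qed
    have c_supp: "{k. c k \<noteq> 0} \<subseteq> K" and e_supp: "{k. e k \<noteq> 0} \<subseteq> K"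
      using c \<Omega>K UK by (auto simp: e_def grid_restriction_def)
    have L_u: "discrete_operator lam \<mu> \<rho> \<delta> ?h u (grid_point ?h k) = local_operator lam \<mu> U (grid_point ?h k)"
      if "grid_point ?h k \<in> \<Omega>" for k
    proof -
      have "- discrete_operator lam \<mu> \<rho> \<delta> ?h u (grid_point ?h k) = - local_operator lam \<mu> u0 (grid_point ?h k)"
        using num that local_eq[OF that] by (simp add: numerical_solution_def grid_restriction_def)
      moreover have "local_operator lam \<mu> u0 (grid_point ?h k) = local_operator lam \<mu> U (grid_point ?h k)"
        by (rule local_operator_cong_open[OF Omega(1) that]) (simp add: U_def)
      ultimately show ?thesis
        by simp
    qed
    have "(LINT x:\<Omega>|lborel. (norm (u0 x - u x))\<^sup>2) \<le> (D1 + D2) * ?r\<^sup>2"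
    proof (cases "hmax \<le> 1")
      case True
      let ?d = "\<lambda>k. e k - c k"
      have d_supp: "{k. ?d k \<noteq> 0} \<subseteq> K"
      proof
        fix k assume "k \<in> {k. ?d k \<noteq> 0}"
        then have "e k \<noteq> 0 \<or> c k \<noteq> 0"
          by auto
        then show "k \<in> K"
          using c_supp e_supp by blast
      qed
      \<comment> \<open>At nodes of \<Omega> the scheme and the local equation have the same
        right-hand side, so the residual of the coefficient error is the truncation error.\<close>
      have d: "(\<Sum>k\<in>K. (norm (?d k))\<^sup>2) \<le> card K * (Ct * ?r * (3 ^ CARD('n) * Q1\<^sup>2) / \<mu>)\<^sup>2"
      proof (rule coefficient_bound[OF K d_supp KR R Lame dim])
        fix k assume "?d k \<noteq> 0"
        then have k: "grid_point ?h k \<in> \<Omega>"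
          using c[of k] by (auto simp: e_def grid_restriction_def U_def split: if_splits)
        have "discrete_operator lam \<mu> \<rho> \<delta> ?h (rk_interp ?h ?d) (grid_point ?h k)
            = discrete_operator lam \<mu> \<rho> \<delta> ?h (rk_interp ?h e) (grid_point ?h k) - local_operator lam \<mu> U (grid_point ?h k)"
          using discrete_operator_diff[OF K e_supp c_supp] L_u[OF k] by (simp add: u)
        then show "norm (discrete_operator lam \<mu> \<rho> \<delta> ?h (rk_interp ?h ?d) (grid_point ?h k)) \<le> Ct * ?r"
          using consistency[OF U K UK divK dim Lame, of "grid_point ?h k"] unfolding Ct e_def by simp
      next
        show "2 * (R + hmax) * real CARD('n) + \<delta> \<le> Q1"
          unfolding Q1_def using True horizon R by (intro add_mono mult_right_mono mult_left_mono) auto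
      qed
      have "(LINT x:\<Omega>|lborel. (norm (u0 x - u x))\<^sup>2) \<le> 2 * (?n * (CI * B * hmax\<^sup>2))\<^sup>2 * measure lborel \<Omega>
          + 4 ^ CARD('n) * (\<Prod>j\<in>UNIV. ?h $ j) * (\<Sum>k\<in>K. 2 * (norm (?d k))\<^sup>2)"
      proof (rule set_integral_square_le[OF _ fin K])
        fix x assume x: "x \<in> \<Omega>"
        have "rk_interp ?h ?d x = rk_interp ?h e x - u x"
          unfolding u rk_interp_finite[OF K d_supp h_pos] rk_interp_finite[OF K e_supp h_pos]
            rk_interp_finite[OF K c_supp h_pos] by (simp add: scaleR_diff_right sum_subtractf)
        then have "u0 x - u x = (U x - rk_interp ?h e x) + rk_interp ?h ?d x"
          using x by (simp add: U_def)
        then have "norm (u0 x - u x) \<le> norm (rk_interp ?h e x - U x) + norm (rk_interp ?h ?d x)"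
          by (metis norm_minus_commute norm_triangle_ineq)
        then have "(norm (u0 x - u x))\<^sup>2 \<le> (norm (rk_interp ?h e x - U x) + norm (rk_interp ?h ?d x))\<^sup>2"
          by (intro power_mono) auto
        also have "\<dots> \<le> 2 * (norm (rk_interp ?h e x - U x))\<^sup>2 + 2 * (norm (rk_interp ?h ?d x))\<^sup>2"
          using sum_squares_bound[of "norm (rk_interp ?h e x - U x)" "norm (rk_interp ?h ?d x)"]
          by (simp add: power2_sum)
        also have "\<dots> \<le> 2 * (?n * (CI * B * hmax\<^sup>2))\<^sup>2 + 2 * (\<Sum>k\<in>K. b k x * (norm (?d k))\<^sup>2)"
          using interp_error_norm[OF U K UK divK, of x] interp_square_le[OF K d_supp, of x]
          unfolding CI e_def by (intro add_mono mult_left_mono power_mono) auto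
        finally show "(norm (u0 x - u x))\<^sup>2 \<le> 2 * (?n * (CI * B * hmax\<^sup>2))\<^sup>2 + (\<Sum>k\<in>K. b k x * (2 * (norm (?d k))\<^sup>2))"
          by (simp add: sum_distrib_left mult_ac)
      qed (use Omega in auto)
      also have "\<dots> = 2 * (?n * (CI * B))\<^sup>2 * vol * (hmax\<^sup>2)\<^sup>2
          + 2 * 4 ^ CARD('n) * ((\<Prod>j\<in>UNIV. ?h $ j) * (\<Sum>k\<in>K. (norm (?d k))\<^sup>2))"
        by (simp add: vol_def power_mult_distrib sum_distrib_left[symmetric])
      also have "\<dots> \<le> 2 * (?n * (CI * B))\<^sup>2 * vol * ?r\<^sup>2
          + 2 * 4 ^ CARD('n) * ((2 * R + 1) ^ CARD('n) * (Ct * G * ?r)\<^sup>2)"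
      proof (intro add_mono mult_left_mono power_mono)
        have "(\<Prod>j\<in>UNIV. ?h $ j) * (\<Sum>k\<in>K. (norm (?d k))\<^sup>2)
            \<le> (\<Prod>j\<in>UNIV. ?h $ j) * (card K * (Ct * ?r * (3 ^ CARD('n) * Q1\<^sup>2) / \<mu>)\<^sup>2)"
          by (intro mult_left_mono d prod_nonneg) (use h_pos less_imp_le in auto)
        also have "\<dots> = ((\<Prod>j\<in>UNIV. ?h $ j) * card K) * (Ct * G * ?r)\<^sup>2"
          by (simp add: G_def mult_ac)
        \<comment> \<open>Cell volume times number of nodes stays bounded: each coordinate
          contributes h_j (2 R / h_j + 1) = 2 R + h_j, at most 2 R + 1 as the mesh is fine.\<close>
        also have "\<dots> \<le> (2 * R + 1) ^ CARD('n) * (Ct * G * ?r)\<^sup>2"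
        proof (intro mult_right_mono)
          have "(\<Prod>j\<in>UNIV. ?h $ j) * card K \<le> (\<Prod>j\<in>UNIV. ?h $ j) * (\<Prod>j\<in>UNIV. 2 * R / ?h $ j + 1)"
            unfolding K_def by (intro mult_left_mono card_nodes_in_ball R prod_nonneg) (use h_pos less_imp_le in auto)
          also have "\<dots> = (\<Prod>j\<in>UNIV. 2 * R + ?h $ j)"
            unfolding prod.distrib[symmetric]
          proof (intro prod.cong refl)
            fix j
            show "?h $ j * (2 * R / ?h $ j + 1) = 2 * R + ?h $ j"
              using h_pos[of j] nonzero_mult_div_cancel_left[of "?h $ j" "2 * R"]
              by (simp only: distrib_left times_divide_eq_right mult_1_right)
          qed
          also have "\<dots> \<le> (\<Prod>j\<in>(UNIV::'n set). 2 * R + 1)"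
            using h_pos h_bounds(2) True R by (intro prod_mono) (auto simp: less_imp_le intro: order_trans)
          finally show "(\<Prod>j\<in>UNIV. ?h $ j) * card K \<le> (2 * R + 1) ^ CARD('n)"
            by simp
        qed simp
        finally show "(\<Prod>j\<in>UNIV. ?h $ j) * (\<Sum>k\<in>K. (norm (?d k))\<^sup>2) \<le> (2 * R + 1) ^ CARD('n) * (Ct * G * ?r)\<^sup>2" .
      qed (auto simp: vol_def)
      also have "\<dots> = D1 * ?r\<^sup>2"
        by (simp add: D1_def power_mult_distrib distrib_right)
      also have "\<dots> \<le> (D1 + D2) * ?r\<^sup>2"
        using D by (intro mult_right_mono) auto
      finally show ?thesis .
    next
      case False
      then have h1: "1 \<le> hmax"
        by simp
      \<comment> \<open>No truncation error is used here. The residual of \<open>c\<close> is the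
        bounded right-hand side, and the squared majorant \<open>Q1 * hmax\<close> contributes the
        factor hmax^2.\<close>
      have c_bd: "(\<Sum>k\<in>K. (norm (c k))\<^sup>2) \<le> card K * (F * (3 ^ CARD('n) * (Q1 * hmax)\<^sup>2) / \<mu>)\<^sup>2"
      proof (rule coefficient_bound[OF K c_supp KR R Lame dim])
        fix k assume "c k \<noteq> 0"
        then have k: "grid_point ?h k \<in> \<Omega>"
          using c by blast
        show "norm (discrete_operator lam \<mu> \<rho> \<delta> ?h (rk_interp ?h c) (grid_point ?h k)) \<le> F"
          using L_u[OF k] local_operator_bound[OF U Lame, of "grid_point ?h k"] by (simp add: u F_def)
      next
        have "R \<le> R * hmax" "\<delta> \<le> \<delta>0 * hmax"
          using R horizon delta0 h1 mult_left_mono[OF h1, of R] mult_left_mono[OF h1, of \<delta>0] by linarith+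
        then have "2 * (R + hmax) * ?n + \<delta> \<le> 2 * (R * hmax + hmax) * ?n + \<delta>0 * hmax"
          by (intro add_mono mult_right_mono mult_left_mono) auto
        then show "2 * (R + hmax) * real CARD('n) + \<delta> \<le> Q1 * hmax"
          by (simp add: Q1_def algebra_simps)
      qed
      have card: "card K \<le> (2 * R / \<eta> + 1) ^ CARD('n)"
      proof -
        have "card K \<le> (\<Prod>j\<in>(UNIV::'n set). 2 * R / ?h $ j + 1)"
          unfolding K_def by (rule card_nodes_in_ball[OF R])
        also have "\<dots> \<le> (\<Prod>j\<in>(UNIV::'n set). 2 * R / \<eta> + 1)"
        proof (intro prod_mono conjI add_mono divide_left_mono)
          fix j
          have "\<eta> * 1 \<le> \<eta> * hmax"
            using h1 \<open>\<eta> > 0\<close> by (intro mult_left_mono) auto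
          then show "\<eta> \<le> ?h $ j"
            using h_bounds(1)[of j] by linarith
          show "0 \<le> 2 * R / ?h $ j + 1"
            using R h_pos[of j] by (intro add_nonneg_nonneg divide_nonneg_pos) auto
          show "0 < ?h $ j * \<eta>"
            using h_pos[of j] \<open>\<eta> > 0\<close> by (intro mult_pos_pos)
        qed (use R in auto)
        finally show ?thesis
          by simp
      qed
      define A where "A = 2 * (?n * B)\<^sup>2 + 2 * (\<Sum>k\<in>K. (norm (c k))\<^sup>2)"
      \<comment> \<open>A cell may now be much larger than \<Omega>, so its volume is useless as a
        factor. Basis functions are bounded by 1 and everything goes into the pointwise part, with
        an empty sum over nodes.\<close>
      have "(LINT x:\<Omega>|lborel. (norm (u0 x - u x))\<^sup>2) \<le> A * measure lborel \<Omega>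
          + 4 ^ CARD('n) * (\<Prod>j\<in>UNIV. ?h $ j) * (\<Sum>k\<in>({} :: (int^'n) set). 0)"
      proof (rule set_integral_square_le[OF _ fin])
        fix x assume x: "x \<in> \<Omega>"
        have "norm (U x) \<le> (\<Sum>i\<in>(UNIV::'n set). B)"
          using U[of 0] by (intro order_trans[OF norm_le_l1_cart] sum_mono) (simp add: smooth_bdd_def)
        then have Ux: "norm (U x) \<le> ?n * B"
          by simp
        have "(norm (u x))\<^sup>2 \<le> (\<Sum>k\<in>K. b k x * (norm (c k))\<^sup>2)"
          unfolding u by (rule interp_square_le[OF K c_supp])
        also have "\<dots> \<le> (\<Sum>k\<in>K. 1 * (norm (c k))\<^sup>2)"
          by (intro sum_mono mult_right_mono basis_le_1) auto
        finally have ux: "(norm (u x))\<^sup>2 \<le> (\<Sum>k\<in>K. (norm (c k))\<^sup>2)"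
          by simp
        have "(norm (u0 x - u x))\<^sup>2 \<le> (norm (U x) + norm (u x))\<^sup>2"
          using x norm_triangle_ineq4[of "U x" "u x"] by (intro power_mono) (auto simp: U_def)
        also have "\<dots> \<le> 2 * (norm (U x))\<^sup>2 + 2 * (norm (u x))\<^sup>2"
          using sum_squares_bound[of "norm (U x)" "norm (u x)"] by (simp add: power2_sum)
        also have "\<dots> \<le> A"
          unfolding A_def using Ux ux by (intro add_mono mult_left_mono power_mono) auto
        finally show "(norm (u0 x - u x))\<^sup>2 \<le> A + (\<Sum>k\<in>{}. b k x * 0)"
          by simp
      qed (use Omega in \<open>auto simp: A_def intro!: add_nonneg_nonneg sum_nonneg\<close>)
      then have "(LINT x:\<Omega>|lborel. (norm (u0 x - u x))\<^sup>2) \<le> A * vol"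
        by (simp add: vol_def)
      also have "\<dots> \<le> ((2 * (?n * B)\<^sup>2 + 2 * F\<^sup>2 * (2 * R / \<eta> + 1) ^ CARD('n) * G\<^sup>2) * ?r\<^sup>2) * vol"
      proof (intro mult_right_mono)
        \<comment> \<open>Since hmax exceeds 1 this also gives a right-hand side of at least 1,
          which absorbs the size of the exact solution.\<close>
        have r: "hmax ^ 4 \<le> ?r\<^sup>2"
          using power_mono[of "hmax\<^sup>2" ?r 2] by (simp flip: power_mult)
        then have "1 \<le> ?r\<^sup>2"
          using one_le_power[OF h1, of 4] by linarith
        then have 1: "2 * (?n * B)\<^sup>2 * 1 \<le> 2 * (?n * B)\<^sup>2 * ?r\<^sup>2"
          by (intro mult_left_mono) auto
        have "(\<Sum>k\<in>K. (norm (c k))\<^sup>2) \<le> (2 * R / \<eta> + 1) ^ CARD('n) * (F * (3 ^ CARD('n) * (Q1 * hmax)\<^sup>2) / \<mu>)\<^sup>2"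
          by (rule order_trans[OF c_bd]) (intro mult_right_mono card, simp)
        also have "\<dots> = F\<^sup>2 * (2 * R / \<eta> + 1) ^ CARD('n) * G\<^sup>2 * hmax ^ 4"
          by (simp add: G_def power_mult_distrib power_divide flip: power_mult)
        also have "\<dots> \<le> F\<^sup>2 * (2 * R / \<eta> + 1) ^ CARD('n) * G\<^sup>2 * ?r\<^sup>2"
          using R \<open>\<eta> > 0\<close> by (intro mult_left_mono r mult_nonneg_nonneg) auto
        finally show "A \<le> (2 * (?n * B)\<^sup>2 + 2 * F\<^sup>2 * (2 * R / \<eta> + 1) ^ CARD('n) * G\<^sup>2) * ?r\<^sup>2"
          unfolding A_def distrib_right using 1 by (simp only: mult.assoc)
      qed (simp add: vol_def)
      also have "\<dots> = D2 * ?r\<^sup>2"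
        by (simp only: D2_def mult_ac)
      also have "\<dots> \<le> (D1 + D2) * ?r\<^sup>2"
        using D by (intro mult_right_mono) auto
      finally show ?thesis .
    qed
    then have "L2_norm_on \<Omega> (\<lambda>x. u0 x - u x) \<le> sqrt ((D1 + D2) * ?r\<^sup>2)"
      unfolding L2_norm_on_def by (rule real_sqrt_le_mono)
    also have "\<dots> = sqrt (D1 + D2) * ?r"
      by (simp add: real_sqrt_mult)
    also have "\<dots> \<le> (sqrt D1 + sqrt D2) * ?r"
      using D by (intro mult_right_mono sqrt_add_le_add_sqrt) auto
    finally show ?thesis .
  qed
  then show ?thesis
    by blast
qed

end
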